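(* There is a one-to-one correspondence (a duality) between: (1) compact ordered spaces $(X,\mathscr{T},\le)$, and (2) pairs $(B,C)$, where $B$ is a commutative unital complex $C^*$-algebra and $C$ is a subset of $B$ satisfying, with $H$ denoting the set of hermitian elements of $B$: (i) $C+C\subset C$, and $aC\subset C$ for every real $a>0$; (ii) $C$ is closed; (iii) $\overline{C-C}=H$; (iv) at least one of the following holds: (iv.1) $C$ consists of non-negative elements (elements with non-negative spectrum) and if $f\in C$ then $\frac{2f^2}{1+f^2}$ belongs to $C$; (iv.2) if $f\in C$ then $\left(\frac{2f}{1+f}\right)^2$ is well defined and belongs to $C$. This correspondence is implemented by the following maps, which are well defined, structure-preserving and mutually inverse up to canonical isomorphism. Map I (Algebra $\to$ Space): given $(B,C)$, construct $(X,\mathscr{T},\le)$ where $X$ is the Gelfand spectrum (set of characters) of $B$, $\mathscr{T}$ is the weak*-topology, and $\le$ is defined by $x\le y\iff x(f)\le y(f)$ for all $f\in C$. Map II (Space $\to$ Algebra): given $(X,\mathscr{T},\le)$, construct $(B,C)$ where $B=C(X,\mathbb{C})$ and $C=C^+(X,\le,\mathbb{R})$.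
   Context: A compact ordered space is a triple $(X,\mathscr{T},\le)$ where $(X,\mathscr{T})$ is a non-empty compact topological space and $\le$ is an order (reflexive, transitive, antisymmetric relation) whose graph is closed in $X\times X$ with the product topology. A function $f:X\to\mathbb{R}$ is isotone if $x\le y$ implies $f(x)\le f(y)$. $C^+(X,\le,\mathbb{R})$ is the set of non-negative continuous isotone real functions on $X$, regarded as a subset of $C(X,\mathbb{C})$, the $C^*$-algebra of continuous complex functions with sup norm and complex conjugation as involution. A $C^*$-algebra is a complex Banach $*$-algebra with $\|f^*f\|=\|f\|^2$; unital means that it has a unit $1$ with $\|1\|=1$. An element $f$ is hermitian if $f=f^*$. Closures in $B$ are with respect to the norm, and $C-C=\{f-g: f,g\in C\}$. A character is a non-zero multiplicative linear functional $B\to\mathbb{C}$. In (iv), quotients mean multiplication by the inverse in $B$; "well defined" in (iv.2) means that $1+f$ is invertible in $B$. "Mutually inverse up to canonical isomorphism" means: for $(B,C)$ as in (2), with $(X,\mathscr{T},\le)$ the image under Map I, the Gelfand map $B\to C(X,\mathbb{C})$, $f\mapsto\hat f$, $\hat f(x)=x(f)$, is a unit-preserving $*$-isomorphism which is isometric and maps $C$ onto $C^+(X,\le,\mathbb{R})$; and for a compact ordered space $(X,\mathscr{T},\le)$, the map sending $x\in X$ to the evaluation character $f\mapsto f(x)$ of $C(X,\mathbb{C})$ is a homeomorphism and an order isomorphism (in both directions) from $X$ onto the space obtained by applying Map II and then Map I. *)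

theory Defs
  imports "HOL-Analysis.Analysis" "HOL-Algebra.QuotRing" "HOL-Algebra.Module"
begin

section \<open>Compact ordered spaces\<close>

text \<open>The order is given by its graph, a subset of the square of the underlying set.\<close>

definition compact_ordered_space :: "'a topology \<times> 'a rel \<Rightarrow> bool" where
  "compact_ordered_space = (\<lambda>(X, R).
     topspace X \<noteq> {} \<and> compact_space X \<and>
     partial_order_on (topspace X) R \<and> closedin (prod_topology X X) R)"

definition ordered_space_iso ::
    "'a topology \<times> 'a rel \<Rightarrow> 'c topology \<times> 'c rel \<Rightarrow> ('a \<Rightarrow> 'c) \<Rightarrow> bool" where
  "ordered_space_iso = (\<lambda>(X, R) (Y, Q) \<phi>.
     homeomorphic_map X Y \<phi> \<and>
     (\<forall>x\<in>topspace X. \<forall>y\<in>topspace X. (x, y) \<in> R \<longleftrightarrow> (\<phi> x, \<phi> y) \<in> Q))"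


section \<open>Commutative unital complex C*-algebras\<close>

definition complex_ring :: "complex ring" where
  "complex_ring = \<lparr>carrier = UNIV, monoid.mult = (*), one = 1, zero = 0, add = (+)\<rparr>"

record 'b star_algebra = "(complex, 'b) module" +
  star :: "'b \<Rightarrow> 'b"
  nrm :: "'b \<Rightarrow> real"

text \<open>The locale \<^locale>\<open>Metric_space\<close> demands symmetry and nonnegativity of the distance also
  outside the carrier, hence the case distinction.\<close>

definition nrm_dist :: "'b star_algebra \<Rightarrow> 'b \<Rightarrow> 'b \<Rightarrow> real" where
  "nrm_dist B f g =
     (if f \<in> carrier B \<and> g \<in> carrier B then nrm B (f \<ominus>\<^bsub>B\<^esub> g) else 0)"

definition nrm_topology :: "'b star_algebra \<Rightarrow> 'b topology" where
  "nrm_topology B = Metric_space.mtopology (carrier B) (nrm_dist B)"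

text \<open>The locale \<^locale>\<open>algebra\<close> of the library already comprises commutativity of the
  multiplication and the existence of a unit.\<close>

locale comm_cstar_algebra = algebra complex_ring B
  for B :: "'b star_algebra" (structure) +
  assumes nrm_nonneg: "f \<in> carrier B \<Longrightarrow> 0 \<le> nrm B f"
    and nrm_eq_0_iff: "f \<in> carrier B \<Longrightarrow> nrm B f = 0 \<longleftrightarrow> f = \<zero>"
    and nrm_triangle:
      "\<lbrakk>f \<in> carrier B; g \<in> carrier B\<rbrakk> \<Longrightarrow> nrm B (f \<oplus> g) \<le> nrm B f + nrm B g"
    and nrm_smult: "f \<in> carrier B \<Longrightarrow> nrm B (a \<odot> f) = cmod a * nrm B f"
    and nrm_mult:
      "\<lbrakk>f \<in> carrier B; g \<in> carrier B\<rbrakk> \<Longrightarrow> nrm B (f \<otimes> g) \<le> nrm B f * nrm B g"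
    and nrm_one: "nrm B \<one> = 1"
    and complete: "Metric_space.mcomplete (carrier B) (nrm_dist B)"
    and star_closed: "f \<in> carrier B \<Longrightarrow> star B f \<in> carrier B"
    and star_star: "f \<in> carrier B \<Longrightarrow> star B (star B f) = f"
    and star_add:
      "\<lbrakk>f \<in> carrier B; g \<in> carrier B\<rbrakk> \<Longrightarrow> star B (f \<oplus> g) = star B f \<oplus> star B g"
    and star_smult: "f \<in> carrier B \<Longrightarrow> star B (a \<odot> f) = cnj a \<odot> star B f"
    and star_mult:
      "\<lbrakk>f \<in> carrier B; g \<in> carrier B\<rbrakk> \<Longrightarrow> star B (f \<otimes> g) = star B g \<otimes> star B f"
    and nrm_star: "f \<in> carrier B \<Longrightarrow> nrm B (star B f) = nrm B f"
    and cstar_identity: "f \<in> carrier B \<Longrightarrow> nrm B (star B f \<otimes> f) = (nrm B f)\<^sup>2"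

text \<open>Membership in \<^const>\<open>ring_iso\<close> includes bijectivity between the carriers and preservation
  of the unit.\<close>

definition cstar_iso :: "'b star_algebra \<Rightarrow> 'd star_algebra \<Rightarrow> ('b \<Rightarrow> 'd) set" where
  "cstar_iso B D = {h \<in> ring_iso B D.
     (\<forall>a. \<forall>f\<in>carrier B. h (a \<odot>\<^bsub>B\<^esub> f) = a \<odot>\<^bsub>D\<^esub> h f) \<and>
     (\<forall>f\<in>carrier B. h (star B f) = star D (h f)) \<and>
     (\<forall>f\<in>carrier B. nrm D (h f) = nrm B f)}"

definition hermitian :: "'b star_algebra \<Rightarrow> 'b set" where
  "hermitian B = {f \<in> carrier B. star B f = f}"

definition spectrum :: "'b star_algebra \<Rightarrow> 'b \<Rightarrow> complex set" where
  "spectrum B f = {z. f \<ominus>\<^bsub>B\<^esub> (z \<odot>\<^bsub>B\<^esub> \<one>\<^bsub>B\<^esub>) \<notin> Units B}"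

definition nonneg_elements :: "'b star_algebra \<Rightarrow> 'b set" where
  "nonneg_elements B = {f \<in> carrier B. spectrum B f \<subseteq> complex_of_real ` {0..}}"


section \<open>The pairs of an algebra and a cone\<close>

text \<open>In the first alternative of the last condition the inverse of \<open>1 + f\<^sup>2\<close> always exists,
  since the spectrum of \<open>f\<close> is nonnegative; in the second alternative the invertibility of
  \<open>1 + f\<close> is part of the condition.\<close>

definition cstar_cone :: "'b star_algebra \<times> 'b set \<Rightarrow> bool" where
  "cstar_cone = (\<lambda>(B, C).
     comm_cstar_algebra B \<and> C \<subseteq> carrier B \<and>
     (\<forall>f\<in>C. \<forall>g\<in>C. f \<oplus>\<^bsub>B\<^esub> g \<in> C) \<and>
     (\<forall>a>0. \<forall>f\<in>C. complex_of_real a \<odot>\<^bsub>B\<^esub> f \<in> C) \<and>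
     closedin (nrm_topology B) C \<and>
     nrm_topology B closure_of {f \<ominus>\<^bsub>B\<^esub> g | f g. f \<in> C \<and> g \<in> C} = hermitian B \<and>
     ((C \<subseteq> nonneg_elements B \<and>
       (\<forall>f\<in>C. (2 \<odot>\<^bsub>B\<^esub> (f [^]\<^bsub>B\<^esub> (2::nat))) \<otimes>\<^bsub>B\<^esub>
                inv\<^bsub>B\<^esub> (\<one>\<^bsub>B\<^esub> \<oplus>\<^bsub>B\<^esub> f [^]\<^bsub>B\<^esub> (2::nat)) \<in> C)) \<or>
      (\<forall>f\<in>C. \<one>\<^bsub>B\<^esub> \<oplus>\<^bsub>B\<^esub> f \<in> Units B \<and>
                ((2 \<odot>\<^bsub>B\<^esub> f) \<otimes>\<^bsub>B\<^esub> inv\<^bsub>B\<^esub> (\<one>\<^bsub>B\<^esub> \<oplus>\<^bsub>B\<^esub> f)) [^]\<^bsub>B\<^esub> (2::nat) \<in> C)))"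

definition cstar_cone_iso ::
    "'b star_algebra \<times> 'b set \<Rightarrow> 'd star_algebra \<times> 'd set \<Rightarrow> ('b \<Rightarrow> 'd) \<Rightarrow> bool" where
  "cstar_cone_iso = (\<lambda>(B, C) (D, E) h. h \<in> cstar_iso B D \<and> h ` C = E)"


section \<open>From algebras to spaces\<close>

text \<open>Functionals are taken extensional (fixed to \<^term>\<open>undefined\<close> outside the carrier), so
  that HOL equality of characters is equality on the algebra.\<close>

definition characters :: "'b star_algebra \<Rightarrow> ('b \<Rightarrow> complex) set" where
  "characters B = {x \<in> extensional (carrier B).
     (\<forall>f\<in>carrier B. \<forall>g\<in>carrier B. x (f \<oplus>\<^bsub>B\<^esub> g) = x f + x g) \<and>
     (\<forall>a. \<forall>f\<in>carrier B. x (a \<odot>\<^bsub>B\<^esub> f) = a * x f) \<and>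
     (\<forall>f\<in>carrier B. \<forall>g\<in>carrier B. x (f \<otimes>\<^bsub>B\<^esub> g) = x f * x g) \<and>
     (\<exists>f\<in>carrier B. x f \<noteq> 0)}"

text \<open>The weak* topology is the topology of pointwise convergence on the algebra, that is, the
  subspace topology inherited from the product of copies of the complex plane.\<close>

definition spectrum_topology :: "'b star_algebra \<Rightarrow> ('b \<Rightarrow> complex) topology" where
  "spectrum_topology B =
     subtopology (product_topology (\<lambda>_. euclidean) (carrier B)) (characters B)"

text \<open>Characters are real on the cone (this is part of the main statement), so that taking real
  parts only serves to convert to the type of real numbers.\<close>

definition spectrum_order :: "'b star_algebra \<Rightarrow> 'b set \<Rightarrow> ('b \<Rightarrow> complex) rel" where
  "spectrum_order B C =
     {(x, y). x \<in> characters B \<and> y \<in> characters B \<and> (\<forall>f\<in>C. Re (x f) \<le> Re (y f))}"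

definition map_I ::
    "'b star_algebra \<times> 'b set \<Rightarrow> ('b \<Rightarrow> complex) topology \<times> ('b \<Rightarrow> complex) rel" where
  "map_I = (\<lambda>(B, C). (spectrum_topology B, spectrum_order B C))"


section \<open>From spaces to algebras\<close>

definition continuous_functions :: "'a topology \<Rightarrow> ('a \<Rightarrow> complex) star_algebra" where
  "continuous_functions X =
    \<lparr>carrier = {f \<in> extensional (topspace X). continuous_map X euclidean f},
     monoid.mult = (\<lambda>f g. \<lambda>x\<in>topspace X. f x * g x),
     one = (\<lambda>x\<in>topspace X. 1),
     zero = (\<lambda>x\<in>topspace X. 0),
     add = (\<lambda>f g. \<lambda>x\<in>topspace X. f x + g x),
     smult = (\<lambda>a f. \<lambda>x\<in>topspace X. a * f x),
     star = (\<lambda>f. \<lambda>x\<in>topspace X. cnj (f x)),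
     nrm = (\<lambda>f. SUP x\<in>topspace X. cmod (f x))\<rparr>"

definition isotone_cone :: "'a topology \<Rightarrow> 'a rel \<Rightarrow> ('a \<Rightarrow> complex) set" where
  "isotone_cone X R =
     (\<lambda>u. \<lambda>x\<in>topspace X. complex_of_real (u x)) `
       {u :: 'a \<Rightarrow> real. continuous_map X euclidean u \<and>
          (\<forall>x\<in>topspace X. 0 \<le> u x) \<and>
          (\<forall>x\<in>topspace X. \<forall>y\<in>topspace X. (x, y) \<in> R \<longrightarrow> u x \<le> u y)}"

definition map_II :: "'a topology \<times> 'a rel \<Rightarrow> ('a \<Rightarrow> complex) star_algebra \<times> ('a \<Rightarrow> complex) set"
  where "map_II = (\<lambda>(X, R). (continuous_functions X, isotone_cone X R))"


section \<open>The canonical isomorphisms\<close>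

definition gelfand_map :: "'b star_algebra \<Rightarrow> 'b \<Rightarrow> ('b \<Rightarrow> complex) \<Rightarrow> complex" where
  "gelfand_map B f = (\<lambda>x\<in>characters B. x f)"

definition evaluation :: "'a topology \<Rightarrow> 'a \<Rightarrow> ('a \<Rightarrow> complex) \<Rightarrow> complex" where
  "evaluation X x = (\<lambda>f\<in>carrier (continuous_functions X). f x)"

end

theory Submission
  imports Defs
begin

text \<open>
  Let \<open>D\<close> be a cone of nonnegative continuous functions on a compact space, containing a strictly
  positive one and closed under composition with \<open>2t\<^sup>2 / (1 + t\<^sup>2)\<close> or with \<open>(2t / (1 + t))\<^sup>2\<close>. Both functions
  are increasing, lie below the identity and have only the fixed points \<open>0\<close> and \<open>1\<close>, so their iterates
  decrease to the indicator function of \<open>{1..}\<close>. Hence \<open>D\<close> contains approximate indicator functions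
  of the sets \<open>{f \<ge> a}\<close>, by compactness it separates any two closed sets whose points it separates in
  the right order, and summing over level sets shows that \<open>D\<close> is uniformly dense in the nonnegative
  continuous functions that are isotone for the order defined by \<open>D\<close>. This replaces both the
  Stone-Weierstrass theorem and the representation of functionals by measures.

  Characters are obtained without quotient algebras: a maximal proper preordering (a set of
  hermitian elements closed under sums and products and containing all squares) is total, and
  its Dedekind cuts define a character. That the preordering generated by \<open>f - \<parallel>f\<parallel>\<close> is
  proper for a square \<open>f\<close> makes the Gelfand map isometric. Its surjectivity and the description of
  the image of \<open>C\<close> both follow from the density statement above.

  For a compact ordered space, Nachbin's ordered version of Urysohn's lemma makes the isotone functions
  separate points in the right order, and the differences of isotone functions form a vector lattice, to
  which the density statement applies once more.
\<close>

section \<open>Uniform approximation by cones of isotone functions\<close>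

text \<open>The obstacle is that a cone offers only sums and positive multiples: no products, no
  lattice operations, no constants. Steepness compensates for this. A sum of n functions that are
  close to 0 or to 1 away from a gap behaves like a minimum when compared with n and like a maximum
  when compared with 1, so finite subcovers can be combined by addition alone. Instead of a
  constant, \<open>C\<close> supplies a strictly positive element, found by approximating the unit
  by a difference p - q. The density statement is used three times: for the elements with
  nonnegative character values, whose order is equality; for \<open>C\<close> itself; and for
  nonnegative differences of isotone functions, where steepness comes from truncation instead of
  iteration. This is why steepness, and not condition (iv), is its hypothesis. In the algebra,
  positivity must be controlled before any character is available. A sum of squares p satisfies ||t
  - p|| <= t for some real t; this follows from the C*-identity for f + i g and from square roots
  obtained as fixed points of contractions. It keeps -1 from being a sum of squares, so that maximal
  proper preorderings exist.\<close>

lemma compact_strict_bound: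
  fixes g :: "'a \<Rightarrow> real"
  assumes "compactin X K" "continuous_map X euclideanreal g" "\<And>x. x \<in> K \<Longrightarrow> g x < c"
  shows "\<exists>r<c. \<forall>x\<in>K. g x \<le> r"
proof (cases "K = {}")
  case True
  then show ?thesis
    by (auto intro: exI[of _ "c - 1"])
next
  case False
  have "compact (g ` K)"
    using image_compactin[OF assms(1,2)] by simp
  then obtain y where "y \<in> K" "\<forall>x\<in>K. g x \<le> g y"
    using compact_attains_sup[of "g ` K"] False by auto
  then show ?thesis
    using assms(3) by blast
qed

lemma compactin_finite_subcover_image:
  assumes "compactin X K" "\<And>i. i \<in> I \<Longrightarrow> openin X (U i)" "K \<subseteq> \<Union>(U ` I)"
  obtains J where "finite J" "J \<subseteq> I" "K \<subseteq> \<Union>(U ` J)"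
proof -
  have "\<forall>V\<in>U ` I. openin X V"
    using assms(2) by blast
  then obtain \<F> where \<F>: "finite \<F>" "\<F> \<subseteq> U ` I" "K \<subseteq> \<Union>\<F>"
    using assms(1,3) unfolding compactin_def by (elim conjE allE[of _ "U ` I"]) auto
  obtain J where "J \<subseteq> I" "finite J" "\<F> = U ` J"
    using finite_subset_image[OF \<F>(1,2)] by blast
  with \<F>(3) show thesis
    by (intro that) auto
qed

text \<open>\<open>positive\<close> takes the place of constants, which a cone need not contain; it
  settles the degenerate cases of the separation lemmas, where a covering family is empty.\<close>

locale function_cone =
  fixes X :: "'a topology" and D :: "('a \<Rightarrow> real) set"
  assumes compact: "compact_space X"
    and continuous: "f \<in> D \<Longrightarrow> continuous_map X euclideanreal f"
    and nonneg: "\<lbrakk>f \<in> D; x \<in> topspace X\<rbrakk> \<Longrightarrow> 0 \<le> f x"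
    and add: "\<lbrakk>f \<in> D; g \<in> D\<rbrakk> \<Longrightarrow> (\<lambda>x. f x + g x) \<in> D"
    and scale: "\<lbrakk>f \<in> D; 0 < a\<rbrakk> \<Longrightarrow> (\<lambda>x. a * f x) \<in> D"
    and positive: "\<exists>p\<in>D. \<forall>x\<in>topspace X. 0 < p x"

text \<open>Approximate indicators of the set where \<open>f\<close> is at least 1, with a gap where
  \<open>f\<close> lies between \<open>r\<close> and 1. The property is isolated as an interface
  because it arises in two ways: by iterating the map of condition (iv), and by truncation for
  differences of isotone functions.\<close>

locale steep_cone = function_cone +
  assumes steepen: "\<lbrakk>f \<in> D; 0 < \<epsilon>; r < 1\<rbrakk> \<Longrightarrow>
      \<exists>g\<in>D. \<forall>x\<in>topspace X. g x \<le> 1 + \<epsilon> \<and> (1 \<le> f x \<longrightarrow> 1 \<le> g x) \<and> (f x \<le> r \<longrightarrow> g x \<le> \<epsilon>)"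
begin

lemma sum_mem:
  assumes "finite I" "I \<noteq> {}" "\<And>i. i \<in> I \<Longrightarrow> f i \<in> D"
  shows "(\<lambda>x. \<Sum>i\<in>I. f i x) \<in> D"
  using assms by (induction rule: finite_ne_induct) (auto intro: add)

text \<open>A sum of \<open>n\<close> steep functions acts as a minimum. At \<open>x\<close> all
  summands are at least 1, so the sum is at least \<open>n\<close>; at a point of \<open>G\<close>
  one summand is at most \<open>1 / (2 * n)\<close> and the others at most
  \<open>1 + 1 / (2 * n)\<close>, so the sum is at most \<open>n - 1 / 2\<close>.\<close>

lemma separate_point_from_closed:
  assumes x: "x \<in> topspace X" and G: "closedin X G"
    and sep: "\<And>y. y \<in> G \<Longrightarrow> \<exists>f\<in>D. f y < f x"
  shows "\<exists>g\<in>D. 1 < g x \<and> (\<forall>y\<in>G. g y < 1)"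
proof -
  have GX: "G \<subseteq> topspace X"
    using G closedin_subset by blast
  have "\<exists>f r. f \<in> D \<and> r < 1 \<and> f y < r \<and> 1 < f x" if y: "y \<in> G" for y
  proof -
    obtain f where f: "f \<in> D" "f y < f x"
      using sep y by blast
    \<comment> \<open>Dividing by the midpoint puts the threshold 1 strictly between the two values.
      Nonnegativity of \<open>f y\<close> makes the midpoint positive, so the division is a
      permitted scaling.\<close>
    define c where "c = (f x + f y) / 2"
    have "0 \<le> f y"
      using nonneg f y GX by blast
    with f have c: "f y < c" "c < f x" "0 < c"
      by (auto simp: c_def)
    have "(\<lambda>z. (1 / c) * f z) \<in> D"
      using f c by (intro scale) auto
    moreover have "1 / c * f y < 1" "1 < 1 / c * f x"
      using c by auto
    moreover obtain r where "1 / c * f y < r" "r < 1"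
      using dense[OF \<open>1 / c * f y < 1\<close>] by blast
    ultimately show ?thesis
      by blast
  qed
  then obtain f r where fr: "\<And>y. y \<in> G \<Longrightarrow> f y \<in> D \<and> r y < 1 \<and> f y y < r y \<and> 1 < f y x"
    by metis
  define U where "U y = {z \<in> topspace X. f y z < r y}" for y
  have "openin X (U y)" if "y \<in> G" for y
    using continuous_map_upper_lower_semicontinuous_lt fr[OF that] continuous
    unfolding U_def by blast
  moreover have "G \<subseteq> \<Union>(U ` G)"
    using fr GX by (auto simp: U_def)
  moreover have "compactin X G"
    using compact G closedin_compact_space by blast
  ultimately obtain Y where Y: "finite Y" "Y \<subseteq> G" "G \<subseteq> \<Union>(U ` Y)"
    using compactin_finite_subcover_image[of X G G U] by blast
  show ?thesis
  proof (cases "Y = {}")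
    case True
    obtain p where p: "p \<in> D" "0 < p x"
      using positive x by blast
    have "(\<lambda>z. (2 / p x) * p z) \<in> D"
      using p by (intro scale) auto
    moreover have "1 < 2 / p x * p x"
      using p by simp
    moreover have "G = {}"
      using True Y by auto
    ultimately show ?thesis
      by (intro bexI[of _ "\<lambda>z. (2 / p x) * p z"]) auto
  next
    case False
    define n where "n = real (card Y)"
    have n: "1 \<le> n"
      using False Y by (simp add: n_def Suc_leI card_gt_0_iff)
    have "\<exists>g\<in>D. \<forall>z\<in>topspace X. g z \<le> 1 + 1 / (2 * n) \<and> (1 \<le> f y z \<longrightarrow> 1 \<le> g z) \<and>
        (f y z \<le> r y \<longrightarrow> g z \<le> 1 / (2 * n))" if "y \<in> Y" for y
      using that fr Y n by (intro steepen) auto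
    then have "\<exists>g. \<forall>y\<in>Y. g y \<in> D \<and> (\<forall>z\<in>topspace X. g y z \<le> 1 + 1 / (2 * n) \<and>
        (1 \<le> f y z \<longrightarrow> 1 \<le> g y z) \<and> (f y z \<le> r y \<longrightarrow> g y z \<le> 1 / (2 * n)))"
      by (intro bchoice) blast
    then obtain g where g: "\<And>y. y \<in> Y \<Longrightarrow> g y \<in> D"
      "\<And>y z. \<lbrakk>y \<in> Y; z \<in> topspace X\<rbrakk> \<Longrightarrow> g y z \<le> 1 + 1 / (2 * n)"
      "\<And>y z. \<lbrakk>y \<in> Y; z \<in> topspace X; 1 \<le> f y z\<rbrakk> \<Longrightarrow> 1 \<le> g y z"
      "\<And>y z. \<lbrakk>y \<in> Y; z \<in> topspace X; f y z \<le> r y\<rbrakk> \<Longrightarrow> g y z \<le> 1 / (2 * n)"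
      by blast
    let ?s = "\<lambda>z. \<Sum>y\<in>Y. g y z"
    have "?s \<in> D"
      using sum_mem[of Y g] Y False g by blast
    moreover have "n \<le> ?s x"
      unfolding n_def using sum_bounded_below[of Y 1 "\<lambda>y. g y x"] g(3) fr Y x
      by (simp add: subset_iff less_imp_le)
    moreover have "?s z \<le> n - 1 / 2" if z: "z \<in> G" for z
    proof -
      obtain y where y: "y \<in> Y" "f y z \<le> r y"
        using z Y(3) by (auto simp: U_def less_imp_le)
      have zX: "z \<in> topspace X"
        using z GX by blast
      have "?s z = g y z + (\<Sum>y\<in>Y-{y}. g y z)"
        using Y y by (simp add: sum.remove)
      also have "\<dots> \<le> 1 / (2 * n) + real (card (Y - {y})) * (1 + 1 / (2 * n))"
        using g(4)[OF y(1) zX y(2)] sum_bounded_above[of "Y-{y}" "\<lambda>y. g y z" "1 + 1 / (2 * n)"]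
          g(2) zX by (intro add_mono) auto
      also have "real (card (Y - {y})) = n - 1"
        using Y(1) y(1) card_Suc_Diff1[of Y y] by (simp add: n_def)
      also have "1 / (2 * n) + (n - 1) * (1 + 1 / (2 * n)) = n - 1 / 2"
        using n by (simp add: field_simps)
      finally show ?thesis .
    qed
    \<comment> \<open>Any divisor strictly between \<open>n - 1 / 2\<close> and \<open>n\<close>
      would do.\<close>
    moreover have "1 / (n - 1 / 4) * s < 1" if "s \<le> n - 1 / 2" for s
      using n that by (simp add: field_simps)
    moreover have "1 < 1 / (n - 1 / 4) * s" if "n \<le> s" for s
      using n that by (simp add: field_simps)
    moreover have "(\<lambda>z. 1 / (n - 1 / 4) * ?s z) \<in> D"
      using n \<open>?s \<in> D\<close> by (intro scale) auto
    ultimately show ?thesis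
      by (intro bexI[of _ "\<lambda>z. 1 / (n - 1 / 4) * ?s z"]) blast+
  qed
qed

text \<open>Now the sum acts as a maximum: at each point of \<open>F\<close> one summand is at least
  1 and the others are nonnegative, while on \<open>G\<close> all summands are at most
  \<open>1 / (2 * n)\<close> and add up to at most 1/2. The factor 4/3 moves the threshold 1 between
  these bounds.\<close>

lemma separate_closed:
  assumes F: "closedin X F" and G: "closedin X G"
    and sep: "\<And>x y. \<lbrakk>x \<in> F; y \<in> G\<rbrakk> \<Longrightarrow> \<exists>f\<in>D. f y < f x"
  shows "\<exists>g\<in>D. (\<forall>x\<in>F. 1 < g x) \<and> (\<forall>y\<in>G. g y < 1)"
proof -
  have FX: "F \<subseteq> topspace X" and GX: "G \<subseteq> topspace X"
    using F G closedin_subset by blast+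
  have cF: "compactin X F" and cG: "compactin X G"
    using compact F G closedin_compact_space by blast+
  \<comment> \<open>Compactness of \<open>G\<close> turns the strict inequality on \<open>G\<close>
    into a gap \<open>r < 1\<close>, as \<open>steepen\<close> requires.\<close>
  have "\<exists>g r. g \<in> D \<and> r < 1 \<and> 1 < g x \<and> (\<forall>y\<in>G. g y \<le> r)" if x: "x \<in> F" for x
  proof -
    obtain g where g: "g \<in> D" "1 < g x" "\<forall>y\<in>G. g y < 1"
      using separate_point_from_closed[OF _ G sep[OF x]] x FX by blast
    then show ?thesis
      using compact_strict_bound[OF cG continuous[OF g(1)], of 1] by blast
  qed
  then obtain f r where fr: "\<And>x. x \<in> F \<Longrightarrow> f x \<in> D \<and> r x < 1 \<and> 1 < f x x \<and> (\<forall>y\<in>G. f x y \<le> r x)"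
    by metis
  define U where "U x = {z \<in> topspace X. 1 < f x z}" for x
  have "openin X (U y)" if "y \<in> F" for y
    using continuous_map_upper_lower_semicontinuous_lt fr[OF that] continuous
    unfolding U_def by blast
  moreover have "F \<subseteq> \<Union>(U ` F)"
    using fr FX by (auto simp: U_def)
  ultimately obtain Y where Y: "finite Y" "Y \<subseteq> F" "F \<subseteq> \<Union>(U ` Y)"
    using cF compactin_finite_subcover_image[of X F F U] by blast
  show ?thesis
  proof (cases "Y = {}")
    case True
    obtain p where p: "p \<in> D"
      using positive by blast
    obtain M where M: "0 < M" "\<forall>x\<in>G. p x < M"
    proof -
      have "compact (p ` G)"
        using image_compactin[OF cG continuous[OF p]] by simp
      then have "bounded (p ` G)"
        by (rule compact_imp_bounded)
      then obtain b where "\<forall>x\<in>p ` G. norm x \<le> b"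
        unfolding bounded_iff by blast
      then have "\<forall>x\<in>G. p x < \<bar>b\<bar> + 1"
        by force
      then show thesis
        using that[of "\<bar>b\<bar> + 1"] by auto
    qed
    have "(\<lambda>z. (1 / M) * p z) \<in> D"
      using p M by (intro scale) auto
    moreover have "\<forall>x\<in>G. 1 / M * p x < 1"
      using M by simp
    moreover have "F = {}"
      using True Y by auto
    ultimately show ?thesis
      by (intro bexI[of _ "\<lambda>z. (1 / M) * p z"]) auto
  next
    case False
    define n where "n = real (card Y)"
    have n: "1 \<le> n"
      using False Y by (simp add: n_def Suc_leI card_gt_0_iff)
    have "\<exists>g\<in>D. \<forall>z\<in>topspace X. g z \<le> 1 + 1 / (2 * n) \<and> (1 \<le> f y z \<longrightarrow> 1 \<le> g z) \<and>
        (f y z \<le> r y \<longrightarrow> g z \<le> 1 / (2 * n))" if "y \<in> Y" for y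
      using that fr Y n by (intro steepen) auto
    then have "\<exists>g. \<forall>y\<in>Y. g y \<in> D \<and> (\<forall>z\<in>topspace X. g y z \<le> 1 + 1 / (2 * n) \<and>
        (1 \<le> f y z \<longrightarrow> 1 \<le> g y z) \<and> (f y z \<le> r y \<longrightarrow> g y z \<le> 1 / (2 * n)))"
      by (intro bchoice) blast
    then obtain g where g: "\<And>y. y \<in> Y \<Longrightarrow> g y \<in> D"
      "\<And>y z. \<lbrakk>y \<in> Y; z \<in> topspace X; 1 \<le> f y z\<rbrakk> \<Longrightarrow> 1 \<le> g y z"
      "\<And>y z. \<lbrakk>y \<in> Y; z \<in> topspace X; f y z \<le> r y\<rbrakk> \<Longrightarrow> g y z \<le> 1 / (2 * n)"
      by blast
    let ?s = "\<lambda>z. \<Sum>y\<in>Y. g y z"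
    have "?s \<in> D"
      using sum_mem[of Y g] Y False g by blast
    moreover have "1 < 4 / 3 * ?s z" if z: "z \<in> F" for z
    proof -
      obtain y where y: "y \<in> Y" "1 \<le> f y z"
        using z Y(3) by (auto simp: U_def less_imp_le)
      have zX: "z \<in> topspace X"
        using z FX by blast
      have "1 \<le> g y z"
        using g y zX by blast
      also have "g y z \<le> ?s z"
        using Y y g(1) nonneg zX by (intro member_le_sum) auto
      finally show ?thesis
        by simp
    qed
    moreover have "4 / 3 * ?s z < 1" if z: "z \<in> G" for z
    proof -
      have "?s z \<le> real (card Y) * (1 / (2 * n))"
        using z GX Y fr by (intro sum_bounded_above g(3)) auto
      also have "\<dots> = 1 / 2"
        using n by (simp add: n_def)
      finally show ?thesis
        by simp
    qed
    moreover have "(\<lambda>z. 4 / 3 * ?s z) \<in> D"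
      using \<open>?s \<in> D\<close> by (intro scale) auto
    ultimately show ?thesis
      by (intro bexI[of _ "\<lambda>z. 4 / 3 * ?s z"]) blast+
  qed
qed

text \<open>\<open>separate_closed\<close> fixes only on which side of 1 the values lie; one more
  steepening pushes them to the approximate values 1 and 0.\<close>

lemma separate_closed_steeply:
  assumes F: "closedin X F" and G: "closedin X G"
    and sep: "\<And>x y. \<lbrakk>x \<in> F; y \<in> G\<rbrakk> \<Longrightarrow> \<exists>f\<in>D. f y < f x"
    and "0 < \<epsilon>"
  shows "\<exists>g\<in>D. (\<forall>x\<in>topspace X. g x \<le> 1 + \<epsilon>) \<and> (\<forall>x\<in>F. 1 \<le> g x) \<and> (\<forall>y\<in>G. g y \<le> \<epsilon>)"
proof -
  obtain f where f: "f \<in> D" "\<forall>x\<in>F. 1 < f x" "\<forall>y\<in>G. f y < 1"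
    using separate_closed[OF F G sep] by blast
  have "compactin X G"
    using compact G closedin_compact_space by blast
  then obtain r where r: "r < 1" "\<forall>y\<in>G. f y \<le> r"
    using compact_strict_bound continuous f by metis
  obtain g where "g \<in> D" "\<forall>x\<in>topspace X. g x \<le> 1 + \<epsilon> \<and> (1 \<le> f x \<longrightarrow> 1 \<le> g x) \<and> (f x \<le> r \<longrightarrow> g x \<le> \<epsilon>)"
    using steepen[OF f(1) \<open>0 < \<epsilon>\<close> r(1)] by blast
  with f r closedin_subset[OF F] closedin_subset[OF G] show ?thesis
    by (intro bexI[of _ g]) (auto simp: subset_iff less_imp_le)
qed

text \<open>Layer-cake decomposition: \<open>h\<close> is, up to \<open>2\<delta>\<close>, the sum of \<open>\<delta>\<close> times the indicators of
  \<open>{h \<ge> i\<delta>}\<close>, and each indicator is replaced by a steep element of \<open>D\<close>.\<close>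

theorem approximates_isotone:
  fixes h :: "'a \<Rightarrow> real"
  assumes h: "continuous_map X euclideanreal h" "\<And>x. x \<in> topspace X \<Longrightarrow> 0 \<le> h x"
    and mono: "\<And>x y. \<lbrakk>x \<in> topspace X; y \<in> topspace X; \<forall>f\<in>D. f x \<le> f y\<rbrakk> \<Longrightarrow> h x \<le> h y"
    and "0 < \<epsilon>"
  shows "\<exists>f\<in>D. \<forall>x\<in>topspace X. \<bar>f x - h x\<bar> \<le> \<epsilon>"
proof -
  define \<delta> where "\<delta> = \<epsilon> / 2"
  have \<delta>: "0 < \<delta>"
    using \<open>0 < \<epsilon>\<close> by (simp add: \<delta>_def)
  obtain N :: nat where N: "1 \<le> N" "\<And>x. x \<in> topspace X \<Longrightarrow> h x \<le> real N * \<delta>"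
  proof -
    have "compact (h ` topspace X)"
      using image_compactin[of X "topspace X" euclideanreal h] compact h
      by (simp add: compact_space_def)
    then have "bounded (h ` topspace X)"
      by (rule compact_imp_bounded)
    then obtain b where b: "\<forall>x\<in>h ` topspace X. norm x \<le> b"
      unfolding bounded_iff by blast
    obtain n :: nat where n: "b / \<delta> \<le> real n"
      using real_arch_simple by blast
    have "h x \<le> real (Suc n) * \<delta>" if "x \<in> topspace X" for x
    proof -
      have "h x \<le> b"
        using b that by force
      also have "b \<le> real (Suc n) * \<delta>"
        using n \<delta> by (simp add: field_simps)
      finally show ?thesis .
    qed
    then show thesis
      using that[of "Suc n"] by auto
  qed
  \<comment> \<open>Each \<open>g\<close> separates two level sets whose levels differ by
    \<open>\<delta>\<close>. The tolerance \<open>1 / real N\<close> lets the errors of the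
    \<open>N\<close> summands add up to at most 1.\<close>
  have "\<exists>g. g \<in> D \<and> (\<forall>x\<in>topspace X. g x \<le> 1 + 1 / real N) \<and>
      (\<forall>x\<in>topspace X. real i * \<delta> \<le> h x \<longrightarrow> 1 \<le> g x) \<and>
      (\<forall>x\<in>topspace X. h x \<le> (real i - 1) * \<delta> \<longrightarrow> g x \<le> 1 / real N)" for i
  proof -
    have "closedin X {x \<in> topspace X. real i * \<delta> \<le> h x}"
      "closedin X {x \<in> topspace X. h x \<le> (real i - 1) * \<delta>}"
      using h(1) continuous_map_upper_lower_semicontinuous_le by blast+
    moreover have "\<exists>f\<in>D. f y < f x" if "x \<in> {x \<in> topspace X. real i * \<delta> \<le> h x}"
      "y \<in> {x \<in> topspace X. h x \<le> (real i - 1) * \<delta>}" for x y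
    proof -
      have "h y < h x"
        using that \<delta> by (auto simp: algebra_simps)
      then show ?thesis
        using mono[of x y] that by force
    qed
    ultimately show ?thesis
      using separate_closed_steeply[of "{x \<in> topspace X. real i * \<delta> \<le> h x}"
          "{x \<in> topspace X. h x \<le> (real i - 1) * \<delta>}" "1 / real N"] N(1)
      by (simp add: Ball_def imp_conjL Bex_def)
  qed
  then have "\<exists>g. \<forall>i. g i \<in> D \<and> (\<forall>x\<in>topspace X. g i x \<le> 1 + 1 / real N) \<and>
      (\<forall>x\<in>topspace X. real i * \<delta> \<le> h x \<longrightarrow> 1 \<le> g i x) \<and>
      (\<forall>x\<in>topspace X. h x \<le> (real i - 1) * \<delta> \<longrightarrow> g i x \<le> 1 / real N)"
    by (intro choice) blast
  then obtain g where g: "\<And>i. g i \<in> D"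
    "\<And>i x. x \<in> topspace X \<Longrightarrow> g i x \<le> 1 + 1 / real N"
    "\<And>i x. \<lbrakk>x \<in> topspace X; real i * \<delta> \<le> h x\<rbrakk> \<Longrightarrow> 1 \<le> g i x"
    "\<And>i x. \<lbrakk>x \<in> topspace X; h x \<le> (real i - 1) * \<delta>\<rbrakk> \<Longrightarrow> g i x \<le> 1 / real N"
    by blast
  let ?s = "\<lambda>x. \<Sum>i=1..N. g i x"
  have "?s \<in> D"
    using sum_mem[of "{1..N}" g] g(1) N(1) by auto
  have "\<bar>\<delta> * ?s x - h x\<bar> \<le> \<epsilon>" if x: "x \<in> topspace X" for x
  proof -
    define k where "k = nat \<lfloor>h x / \<delta>\<rfloor>"
    have "real k = of_int \<lfloor>h x / \<delta>\<rfloor>"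
      using h(2)[OF x] \<delta> by (simp add: k_def)
    then have "real k \<le> h x / \<delta>" "h x / \<delta> < real k + 1"
      by linarith+
    then have k: "real k * \<delta> \<le> h x" "h x \<le> (real k + 1) * \<delta>"
      using \<delta> by (simp_all add: field_simps)
    have "real k * \<delta> \<le> real N * \<delta>"
      using k(1) N(2)[OF x] by linarith
    then have kN: "k \<le> N"
      using \<delta> by simp
    have ind: "(\<Sum>i=1..N. if i \<le> m then 1 else (0::real)) = real m" if "m \<le> N" for m
    proof -
      have "{1..N} \<inter> {i. i \<le> m} = {1..m}"
        using that by auto
      then show ?thesis
        by (simp add: sum.If_cases)
    qed
    have "real k = (\<Sum>i=1..N. if i \<le> k then 1 else (0::real))"
      using ind[OF kN] by simp
    also have "\<dots> \<le> ?s x"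
    proof (rule sum_mono)
      fix i
      have "real i * \<delta> \<le> h x" if "i \<le> k"
        using that k(1) \<delta> by (meson mult_right_mono less_imp_le of_nat_mono order_trans)
      then show "(if i \<le> k then 1 else 0) \<le> g i x"
        using g(3)[OF x] nonneg[OF g(1) x] by auto
    qed
    finally have lower: "real k \<le> ?s x" .
    \<comment> \<open>\<open>Suc k\<close> is the only index whose gap may contain
      \<open>h x\<close>: smaller indices give values between 1 and \<open>1 + 1 / real N\<close>,
      larger ones at most \<open>1 / real N\<close>. Hence the sum lies between \<open>k\<close> and
      \<open>k + 2\<close>, which accounts for the error of two steps.\<close>
    have "?s x \<le> (\<Sum>i=1..N. 1 / real N + ((if i \<le> k then 1 else 0) + (if i = Suc k then 1 else 0)))"
    proof (rule sum_mono)
      fix i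
      have "h x \<le> (real i - 1) * \<delta>" if "\<not> i \<le> Suc k"
      proof -
        have "real k + 1 \<le> real i - 1"
          using that by simp
        then have "(real k + 1) * \<delta> \<le> (real i - 1) * \<delta>"
          using \<delta> by (intro mult_right_mono) auto
        then show ?thesis
          using k(2) by linarith
      qed
      then show "g i x \<le> 1 / real N + ((if i \<le> k then 1 else 0) + (if i = Suc k then 1 else 0))"
        using g(4)[OF x] g(2)[OF x, of i] by (cases "i \<le> Suc k") (auto simp: le_Suc_eq)
    qed
    also have "\<dots> = 1 + (real k + (\<Sum>i=1..N. if i = Suc k then 1 else (0::real)))"
      using N(1) ind[OF kN] by (simp only: sum.distrib) simp
    also have "\<dots> \<le> 1 + (real k + 1)"
      by (simp add: sum.delta)
    finally have "?s x \<le> real k + 2"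
      by simp
    then have "\<delta> * ?s x \<le> \<delta> * (real k + 2)"
      using \<delta> by (intro mult_left_mono) auto
    moreover have "\<delta> * real k \<le> \<delta> * ?s x"
      using lower \<delta> by (intro mult_left_mono) auto
    ultimately have "\<delta> * ?s x - h x \<le> 2 * \<delta>" "h x - \<delta> * ?s x \<le> 2 * \<delta>"
      using k \<delta> by (simp_all only: distrib_left distrib_right mult.commute[of _ \<delta>] mult_1_right)
    then show ?thesis
      by (simp add: \<delta>_def abs_le_iff)
  qed
  moreover have "(\<lambda>x. \<delta> * ?s x) \<in> D"
    using \<open>?s \<in> D\<close> \<delta> by (intro scale) auto
  ultimately show ?thesis
    by (intro bexI[of _ "\<lambda>x. \<delta> * ?s x"]) blast+
qed

end

text \<open>The iterates of \<open>\<phi>\<close> decrease to the indicator function of \<open>{1..}\<close>, uniformly away from the gap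
  between \<open>r\<close> and \<open>1\<close>.\<close>

lemma iterates_steep:
  fixes \<phi> :: "real \<Rightarrow> real"
  assumes cont: "continuous_on {0..} \<phi>"
    and mono: "\<And>s t. \<lbrakk>0 \<le> s; s \<le> t\<rbrakk> \<Longrightarrow> \<phi> s \<le> \<phi> t"
    and bounds: "\<And>t. 0 \<le> t \<Longrightarrow> 0 \<le> \<phi> t \<and> \<phi> t \<le> t"
    and fixpt: "\<And>t. 0 \<le> t \<Longrightarrow> \<phi> t = t \<longleftrightarrow> t = 0 \<or> t = 1"
    and "0 < \<epsilon>" "r < 1"
  shows "\<exists>n. \<forall>t\<in>{0..M}. (\<phi> ^^ n) t \<le> 1 + \<epsilon> \<and> (1 \<le> t \<longrightarrow> 1 \<le> (\<phi> ^^ n) t) \<and> (t \<le> r \<longrightarrow> (\<phi> ^^ n) t \<le> \<epsilon>)"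
proof -
  have nn: "0 \<le> (\<phi> ^^ n) t" if "0 \<le> t" for n t
    using that by (induction n) (auto simp: bounds)
  have mn: "(\<phi> ^^ n) s \<le> (\<phi> ^^ n) t" if "0 \<le> s" "s \<le> t" for n s t
    using that by (induction n) (auto intro: mono nn)
  have one: "(\<phi> ^^ n) 1 = 1" for n
    using fixpt[of 1] by (induction n) auto
  \<comment> \<open>The iterates decrease, and by continuity their limit is a fixed point.\<close>
  have lim: "\<exists>L. (\<lambda>n. (\<phi> ^^ n) t) \<longlonglongrightarrow> L \<and> (L = 0 \<or> L = 1) \<and> (\<forall>n. L \<le> (\<phi> ^^ n) t)" if t: "0 \<le> t" for t
  proof -
    have "decseq (\<lambda>n. (\<phi> ^^ n) t)"
      by (intro decseq_SucI) (simp add: bounds nn t)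
    then obtain L where L: "(\<lambda>n. (\<phi> ^^ n) t) \<longlonglongrightarrow> L" "\<forall>n. L \<le> (\<phi> ^^ n) t"
      using decseq_convergent[of "\<lambda>n. (\<phi> ^^ n) t" 0] nn[OF t] by blast
    have "0 \<le> L"
      using LIMSEQ_le_const[OF L(1)] nn[OF t] by blast
    have "(\<lambda>n. \<phi> ((\<phi> ^^ n) t)) \<longlonglongrightarrow> \<phi> L"
      using continuous_on_tendsto_compose[OF cont L(1)] \<open>0 \<le> L\<close> nn[OF t] by auto
    moreover have "(\<lambda>n. \<phi> ((\<phi> ^^ n) t)) \<longlonglongrightarrow> L"
      using LIMSEQ_Suc[OF L(1)] by simp
    ultimately have "\<phi> L = L"
      using LIMSEQ_unique by blast
    then show ?thesis
      using L fixpt \<open>0 \<le> L\<close> by blast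
  qed
  \<comment> \<open>Monotonicity of the iterates reduces the uniform claim to two starting points.
    The limit from \<open>r'\<close> is at most \<open>r' < 1\<close>, so it is 0; the iterates from
    \<open>M'\<close> stay at least 1, so their limit is 1.\<close>
  define r' where "r' = max r 0"
  define M' where "M' = max M 1"
  have "(\<lambda>n. (\<phi> ^^ n) r') \<longlonglongrightarrow> 0"
  proof -
    obtain L where L: "(\<lambda>n. (\<phi> ^^ n) r') \<longlonglongrightarrow> L" "L = 0 \<or> L = 1" "\<forall>n. L \<le> (\<phi> ^^ n) r'"
      using lim[of r'] by (auto simp: r'_def)
    have "L \<le> r'"
      using L(3)[rule_format, of 0] by simp
    then show ?thesis
      using L \<open>r < 1\<close> by (auto simp: r'_def)
  qed
  then have "\<forall>\<^sub>F n in sequentially. (\<phi> ^^ n) r' < \<epsilon>"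
    using \<open>0 < \<epsilon>\<close> by (simp add: order_tendstoD)
  moreover have "(\<lambda>n. (\<phi> ^^ n) M') \<longlonglongrightarrow> 1"
  proof -
    obtain L where L: "(\<lambda>n. (\<phi> ^^ n) M') \<longlonglongrightarrow> L" "L = 0 \<or> L = 1"
      using lim[of M'] M'_def by fastforce
    have "1 \<le> (\<phi> ^^ n) M'" for n
      using mn[of 1 M' n] one by (simp add: M'_def)
    then have "1 \<le> L"
      using LIMSEQ_le_const[OF L(1)] by blast
    then show ?thesis
      using L by auto
  qed
  then have "\<forall>\<^sub>F n in sequentially. (\<phi> ^^ n) M' < 1 + \<epsilon>"
    using \<open>0 < \<epsilon>\<close> by (simp add: order_tendstoD)
  ultimately have "\<forall>\<^sub>F n in sequentially. (\<phi> ^^ n) r' < \<epsilon> \<and> (\<phi> ^^ n) M' < 1 + \<epsilon>"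
    by eventually_elim simp
  then obtain n where n: "(\<phi> ^^ n) r' < \<epsilon>" "(\<phi> ^^ n) M' < 1 + \<epsilon>"
    by (auto simp: eventually_sequentially)
  have "(\<phi> ^^ n) t \<le> 1 + \<epsilon>" if "0 \<le> t" "t \<le> M" for t
    using mn[of t M' n] n(2) that max.coboundedI1[of t M 1] unfolding M'_def by linarith
  moreover have "1 \<le> (\<phi> ^^ n) t" if "1 \<le> t" for t
    using mn[of 1 t n] one that by simp
  moreover have "(\<phi> ^^ n) t \<le> \<epsilon>" if "0 \<le> t" "t \<le> r" for t
    using mn[of t r' n] n(1) that max.coboundedI1[of t r 0] unfolding r'_def by linarith
  ultimately show ?thesis
    by (intro exI[of _ n]) auto
qed

lemma (in function_cone) steep_cone_if_closed_under:
  assumes \<phi>: "continuous_on {0..} \<phi>"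
      "\<And>s t. \<lbrakk>0 \<le> s; s \<le> t\<rbrakk> \<Longrightarrow> \<phi> s \<le> \<phi> t"
      "\<And>t. 0 \<le> t \<Longrightarrow> 0 \<le> \<phi> t \<and> \<phi> t \<le> t"
      "\<And>t. 0 \<le> t \<Longrightarrow> \<phi> t = t \<longleftrightarrow> t = 0 \<or> t = 1"
    and closed: "\<And>f. f \<in> D \<Longrightarrow> (\<lambda>x. \<phi> (f x)) \<in> D"
  shows "steep_cone X D"
proof unfold_locales
  fix f :: "'a \<Rightarrow> real" and \<epsilon> r :: real
  assume f: "f \<in> D" and "0 < \<epsilon>" "r < 1"
  have "compact (f ` topspace X)"
    using image_compactin[of X "topspace X" euclideanreal f] compact continuous[OF f]
    by (simp add: compact_space_def)
  then have "bounded (f ` topspace X)"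
    by (rule compact_imp_bounded)
  then obtain M where M: "\<forall>y\<in>f ` topspace X. norm y \<le> M"
    unfolding bounded_iff by blast
  obtain n where n: "\<forall>t\<in>{0..M}. (\<phi> ^^ n) t \<le> 1 + \<epsilon> \<and> (1 \<le> t \<longrightarrow> 1 \<le> (\<phi> ^^ n) t) \<and> (t \<le> r \<longrightarrow> (\<phi> ^^ n) t \<le> \<epsilon>)"
    using iterates_steep[OF \<phi> \<open>0 < \<epsilon>\<close> \<open>r < 1\<close>, of M] by blast
  have "f x \<in> {0..M}" if "x \<in> topspace X" for x
    using M nonneg[OF f that] that by force
  moreover have "(\<lambda>x. (\<phi> ^^ n) (f x)) \<in> D"
    by (induction n) (use f closed in auto)
  ultimately show "\<exists>g\<in>D. \<forall>x\<in>topspace X. g x \<le> 1 + \<epsilon> \<and> (1 \<le> f x \<longrightarrow> 1 \<le> g x) \<and> (f x \<le> r \<longrightarrow> g x \<le> \<epsilon>)"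
    using n by (intro bexI[of _ "\<lambda>x. (\<phi> ^^ n) (f x)"]) auto
qed

text \<open>For both maps \<open>t - \<phi> t\<close> equals \<open>t * (t - 1)\<^sup>2\<close>
  divided by something positive when \<open>t\<close> is nonnegative; the upper bound by
  \<open>t\<close> and the fixed points 0 and 1 are read off from this.\<close>

lemma (in function_cone) steep_cone_if_condition_iv:
  assumes iv: "(\<forall>f\<in>D. (\<lambda>x. 2 * (f x)\<^sup>2 / (1 + (f x)\<^sup>2)) \<in> D) \<or> (\<forall>f\<in>D. (\<lambda>x. (2 * f x / (1 + f x))\<^sup>2) \<in> D)"
  shows "steep_cone X D"
  using iv
proof
  assume A: "\<forall>f\<in>D. (\<lambda>x. 2 * (f x)\<^sup>2 / (1 + (f x)\<^sup>2)) \<in> D"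
  have pos: "0 < 1 + t\<^sup>2" for t :: real
    by (simp add: add_pos_nonneg)
  have diff: "t - 2 * t\<^sup>2 / (1 + t\<^sup>2) = t * (t - 1)\<^sup>2 / (1 + t\<^sup>2)" for t :: real
    using pos[of t] by (simp add: field_simps power2_eq_square)
  show ?thesis
  proof (rule steep_cone_if_closed_under[where \<phi> = "\<lambda>t. 2 * t\<^sup>2 / (1 + t\<^sup>2)"])
    show "continuous_on {0..} (\<lambda>t::real. 2 * t\<^sup>2 / (1 + t\<^sup>2))"
      using pos by (intro continuous_intros) (metis less_irrefl)
    show "2 * s\<^sup>2 / (1 + s\<^sup>2) \<le> 2 * t\<^sup>2 / (1 + t\<^sup>2)" if "0 \<le> s" "s \<le> t" for s t :: real
    proof -
      have "s\<^sup>2 \<le> t\<^sup>2"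
        using that by (intro power_mono)
      then show ?thesis
        using pos[of s] pos[of t] by (simp add: divide_le_eq le_divide_eq field_simps)
    qed
    show "0 \<le> 2 * t\<^sup>2 / (1 + t\<^sup>2) \<and> 2 * t\<^sup>2 / (1 + t\<^sup>2) \<le> t" if "0 \<le> t" for t :: real
    proof -
      have "0 \<le> t * (t - 1)\<^sup>2 / (1 + t\<^sup>2)"
        using that by simp
      then show ?thesis
        using diff[of t] by simp
    qed
    show "2 * t\<^sup>2 / (1 + t\<^sup>2) = t \<longleftrightarrow> t = 0 \<or> t = 1" if "0 \<le> t" for t :: real
      using diff[of t] pos[of t] by (metis cancel_comm_monoid_add_class.diff_cancel diff_eq_diff_less_eq divide_eq_0_iff eq_iff_diff_eq_0 less_irrefl mult_eq_0_iff zero_eq_power2)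
  qed (use A in auto)
next
  assume A: "\<forall>f\<in>D. (\<lambda>x. (2 * f x / (1 + f x))\<^sup>2) \<in> D"
  have diff: "t - (2 * t / (1 + t))\<^sup>2 = t * (t - 1)\<^sup>2 / (1 + t)\<^sup>2" if "0 \<le> t" for t :: real
  proof -
    have "1 + t \<noteq> 0"
      using that by simp
    then show ?thesis
      by (simp add: power_divide diff_divide_eq_iff) (simp add: power2_eq_square algebra_simps)
  qed
  show ?thesis
  proof (rule steep_cone_if_closed_under[where \<phi> = "\<lambda>t. (2 * t / (1 + t))\<^sup>2"])
    show "continuous_on {0..} (\<lambda>t::real. (2 * t / (1 + t))\<^sup>2)"
      by (intro continuous_intros) auto
    show "(2 * s / (1 + s))\<^sup>2 \<le> (2 * t / (1 + t))\<^sup>2" if "0 \<le> s" "s \<le> t" for s t :: real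
      using that by (intro power_mono) (auto simp: divide_le_eq le_divide_eq field_simps)
    show "0 \<le> (2 * t / (1 + t))\<^sup>2 \<and> (2 * t / (1 + t))\<^sup>2 \<le> t" if "0 \<le> t" for t :: real
    proof -
      have "0 \<le> t * (t - 1)\<^sup>2 / (1 + t)\<^sup>2"
        using that by simp
      then show ?thesis
        using diff[OF that] by simp
    qed
    show "(2 * t / (1 + t))\<^sup>2 = t \<longleftrightarrow> t = 0 \<or> t = 1" if "0 \<le> t" for t :: real
    proof -
      have "(2 * t / (1 + t))\<^sup>2 = t \<longleftrightarrow> t * (t - 1)\<^sup>2 / (1 + t)\<^sup>2 = 0"
        using diff[OF that] by auto
      then show ?thesis
        using that by auto
    qed
  qed (use A in auto)
qed

section \<open>Separation in compact ordered spaces\<close>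

text \<open>The Urysohn family constructed below is indexed only by dyadics of the unit interval, so
  indices between two reals must be found among these. The witness is the first grid point of mesh
  \<open>1 / 2 ^ n\<close> beyond \<open>a\<close>.\<close>

lemma dyadics_dense:
  assumes "0 \<le> a" "a < (b::real)" "b \<le> 1"
  obtains r where "r \<in> dyadics \<inter> {0..1}" "a < r" "r < b"
proof -
  obtain n where n: "(1/2::real) ^ n < b - a"
    using real_arch_pow_inv[of "b - a" "1/2"] assms by auto
  define m where "m = nat \<lfloor>a * 2 ^ n\<rfloor> + 1"
  have "real (nat \<lfloor>a * 2 ^ n\<rfloor>) = of_int \<lfloor>a * 2 ^ n\<rfloor>"
    using assms by simp
  then have m: "a * 2 ^ n < real m" "real m \<le> a * 2 ^ n + 1"
    unfolding m_def by (simp_all, linarith+)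
  have "a < real m / 2 ^ n"
    using m by (simp add: field_simps)
  moreover have "real m / 2 ^ n \<le> a + (1/2) ^ n"
    using m by (simp add: field_simps)
  ultimately have "a < real m / 2 ^ n" "real m / 2 ^ n < b"
    using n by linarith+
  moreover from this have "0 \<le> real m / 2 ^ n" "real m / 2 ^ n \<le> 1"
    using assms by linarith+
  moreover have "real m / 2 ^ n \<in> dyadics"
    unfolding dyadics_def by blast
  ultimately show thesis
    using that unfolding Int_iff atLeastAtMost_iff by blast
qed

locale compact_ordered =
  fixes X :: "'a topology" and R :: "'a rel"
  assumes compact_ordered_space: "compact_ordered_space (X, R)"
begin

lemma compact: "compact_space X"
  and nonempty: "topspace X \<noteq> {}"
  and closed_order: "closedin (prod_topology X X) R"
  and order_refl: "x \<in> topspace X \<Longrightarrow> (x, x) \<in> R"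
  and order_trans: "\<lbrakk>(x, y) \<in> R; (y, z) \<in> R\<rbrakk> \<Longrightarrow> (x, z) \<in> R"
  and order_antisym: "\<lbrakk>(x, y) \<in> R; (y, x) \<in> R\<rbrakk> \<Longrightarrow> x = y"
  and order_subset: "(x, y) \<in> R \<Longrightarrow> x \<in> topspace X \<and> y \<in> topspace X"
  using compact_ordered_space
  unfolding compact_ordered_space_def partial_order_on_def preorder_on_def
  by (auto dest: refl_onD transD antisymD)

text \<open>By reflexivity and antisymmetry the diagonal is the intersection of the closed order
  with its converse.\<close>

lemma Hausdorff: "Hausdorff_space X"
proof -
  have "continuous_map (prod_topology X X) (prod_topology X X) (\<lambda>p. (snd p, fst p))"
    by (intro continuous_intros)
  then have "closedin (prod_topology X X)
      {p \<in> topspace (prod_topology X X). (snd p, fst p) \<in> R}"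
    using closed_order by (rule closedin_continuous_map_preimage)
  then have "closedin (prod_topology X X)
      (R \<inter> {p \<in> topspace (prod_topology X X). (snd p, fst p) \<in> R})"
    using closed_order by blast
  also have "R \<inter> {p \<in> topspace (prod_topology X X). (snd p, fst p) \<in> R} = (\<lambda>x. (x, x)) ` topspace X"
    using order_refl order_antisym order_subset by auto
  finally show ?thesis
    by (simp add: Hausdorff_space_closedin_diagonal)
qed

lemma normal: "normal_space X"
  using compact Hausdorff compact_Hausdorff_or_regular_imp_normal_space by blast

text \<open>The increasing and decreasing hulls of \<open>K\<close> are projections of compact
  pieces of the order, and compact sets are closed in a Hausdorff space.\<close>

lemma closedin_image_order:
  assumes "closedin X K"
  shows "closedin X (R `` K)" "closedin X (R\<inverse> `` K)"
proof -
  have cc: "compact_space (prod_topology X X)"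
    using compact by (simp add: compact_space_prod_topology)
  have "closedin (prod_topology X X) (R \<inter> K \<times> topspace X)"
    "closedin (prod_topology X X) (R \<inter> topspace X \<times> K)"
    using assms closed_order by (auto simp: closedin_prod_Times_iff intro!: closedin_Int)
  then have "compactin (prod_topology X X) (R \<inter> K \<times> topspace X)"
    "compactin (prod_topology X X) (R \<inter> topspace X \<times> K)"
    using cc closedin_compact_space by blast+
  then have "compactin X (snd ` (R \<inter> K \<times> topspace X))" "compactin X (fst ` (R \<inter> topspace X \<times> K))"
    using image_compactin continuous_map_fst continuous_map_snd by blast+
  moreover have "snd ` (R \<inter> K \<times> topspace X) = R `` K" "fst ` (R \<inter> topspace X \<times> K) = R\<inverse> `` K"
    using order_subset by force+
  ultimately show "closedin X (R `` K)" "closedin X (R\<inverse> `` K)"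
    using compactin_imp_closedin[OF Hausdorff] by simp_all
qed

definition down :: "'a set \<Rightarrow> bool" where
  "down S \<longleftrightarrow> (\<forall>x y. (x, y) \<in> R \<longrightarrow> y \<in> S \<longrightarrow> x \<in> S)"

text \<open>Normality gives an open \<open>U\<close> between \<open>A\<close> and \<open>V\<close>,
  but neither \<open>U\<close> nor its closure need be decreasing. \<open>W\<close> is the largest
  decreasing subset of \<open>U\<close> and \<open>A'\<close> the smallest decreasing superset of
  its closure; \<open>closedin_image_order\<close> keeps them open and closed.\<close>

lemma down_interpolation:
  assumes A: "closedin X A" "down A" and V: "openin X V" "down V" and "A \<subseteq> V"
  obtains W A' where "openin X W" "down W" "closedin X A'" "down A'" "A \<subseteq> W" "W \<subseteq> A'" "A' \<subseteq> V"
proof -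
  obtain U where U: "openin X U" "A \<subseteq> U" "X closure_of U \<subseteq> V"
    using normal[unfolded normal_space_alt, rule_format, of A V] A(1) V(1) \<open>A \<subseteq> V\<close> by auto
  define A' where "A' = R\<inverse> `` (X closure_of U)"
  define W where "W = topspace X - R `` (topspace X - U)"
  have UX: "U \<subseteq> topspace X"
    using U(1) openin_subset by blast
  have "openin X W"
    unfolding W_def using U(1) by (intro openin_diff closedin_image_order) auto
  moreover have "down W"
    unfolding W_def down_def using order_trans order_subset by blast
  moreover have "closedin X A'"
    unfolding A'_def by (intro closedin_image_order) auto
  moreover have "down A'"
    unfolding A'_def down_def using order_trans by blast
  moreover have "A \<subseteq> W"
    using A(2) U(2) UX unfolding W_def down_def by blast
  moreover have "W \<subseteq> A'"
  proof
    fix x assume "x \<in> W"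
    then have "x \<in> topspace X" "x \<in> U"
      using order_refl unfolding W_def by blast+
    then show "x \<in> A'"
      using order_refl closure_of_subset[OF UX] unfolding A'_def by blast
  qed
  moreover have "A' \<subseteq> V"
    using U(3) V(2) unfolding A'_def down_def by blast
  ultimately show thesis
    using that by blast
qed

text \<open>Urysohn's construction with open decreasing sets in place of open sets.\<close>

theorem Nachbin_separation:
  assumes xy: "x \<in> topspace X" "y \<in> topspace X" "(x, y) \<notin> R"
  obtains f :: "'a \<Rightarrow> real" where "continuous_map X euclideanreal f"
    "\<And>z. 0 \<le> f z" "\<And>z w. (z, w) \<in> R \<Longrightarrow> f z \<le> f w" "f y < f x"
proof -
  \<comment> \<open>A closed decreasing set between \<open>U\<close> and \<open>V\<close> replaces
    the usual requirement that the closure of \<open>U\<close> lie in \<open>V\<close>: it is what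
    \<open>down_interpolation\<close> accepts as input.\<close>
  define P where "P U V \<longleftrightarrow> openin X U \<and> down U \<and> openin X V \<and> down V \<and>
    (\<exists>A. closedin X A \<and> down A \<and> U \<subseteq> A \<and> A \<subseteq> V)" for U V
  have pt: "closedin X {z}" if "z \<in> topspace X" for z
    using Hausdorff that by (simp add: closedin_Hausdorff_singleton)
  \<comment> \<open>The smallest set of the family must contain \<open>y\<close> and the largest
    must omit \<open>x\<close>; then the Urysohn function is 1 at \<open>x\<close> and smaller at
    \<open>y\<close>.\<close>
  let ?A = "R\<inverse> `` {y}" and ?V = "topspace X - R `` {x}"
  have "closedin X ?A" "closedin X (R `` {x})"
    using closedin_image_order pt xy by blast+
  then have "openin X ?V"
    by blast
  have "down ?A"
    unfolding down_def using order_trans by blast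
  have "down ?V"
    unfolding down_def using order_trans order_subset by blast
  have "?A \<subseteq> ?V"
    using order_trans order_subset xy by blast
  with \<open>closedin X ?A\<close> \<open>down ?A\<close> \<open>openin X ?V\<close> \<open>down ?V\<close> obtain U A' where U: "openin X U" "down U" "closedin X A'" "down A'" "?A \<subseteq> U" "U \<subseteq> A'" "A' \<subseteq> ?V"
    by (rule down_interpolation)
  have "\<exists>G :: real \<Rightarrow> 'a set. G 0 = U \<and> G 1 = ?V \<and>
      (\<forall>r \<in> dyadics \<inter> {0..1}. \<forall>s \<in> dyadics \<inter> {0..1}. r < s \<longrightarrow> P (G r) (G s))"
  proof (rule recursion_on_dyadic_fractions)
    show "P U ?V"
      unfolding P_def using U \<open>openin X ?V\<close> \<open>down ?V\<close> by blast
    show "\<exists>W. P S W \<and> P W T" if "P S T" for S T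
    proof -
      obtain A where A: "openin X S" "down S" "openin X T" "down T" "closedin X A" "down A" "S \<subseteq> A" "A \<subseteq> T"
        using \<open>P S T\<close> unfolding P_def by blast
      obtain W B where "openin X W" "down W" "closedin X B" "down B" "A \<subseteq> W" "W \<subseteq> B" "B \<subseteq> T"
        using down_interpolation[OF A(5,6,3,4,8)] by blast
      with A show ?thesis
        unfolding P_def by blast
    qed
    show "P S T" if "P S W" "P W T" for S W T
    proof -
      obtain A where "openin X S" "down S" "closedin X A" "down A" "S \<subseteq> A" "A \<subseteq> W"
        using \<open>P S W\<close> unfolding P_def by blast
      moreover have "openin X T" "down T" "W \<subseteq> T"
        using \<open>P W T\<close> unfolding P_def by blast+
      ultimately show ?thesis
        unfolding P_def by blast
    qed
  qed
  then obtain G :: "real \<Rightarrow> 'a set" where G0: "G 0 = U" and G1: "G 1 = ?V"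
    and G: "\<And>r s. \<lbrakk>r \<in> dyadics \<inter> {0..1}; s \<in> dyadics \<inter> {0..1}; r < s\<rbrakk> \<Longrightarrow> P (G r) (G s)"
    by blast
  have 01: "0 \<in> dyadics \<inter> {0..1::real}" "1 \<in> dyadics \<inter> {0..1::real}"
    by (force simp: dyadics_def)+
  have G': "openin X (G r) \<and> down (G r) \<and> G r \<subseteq> ?V" if r: "r \<in> dyadics \<inter> {0..1}" for r
  proof (cases "r = 0")
    case True
    then show ?thesis
      using U G0 by blast
  next
    case False
    then have "P (G 0) (G r)"
      using G 01(1) r by simp
    moreover have "G r \<subseteq> ?V"
    proof (cases "r = 1")
      case True
      then show ?thesis
        using G1 by blast
    next
      case False
      then have "P (G r) (G 1)"
        using G 01(2) r by simp
      then show ?thesis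
        using G1 unfolding P_def by blast
    qed
    ultimately show ?thesis
      unfolding P_def by blast
  qed
  then have openG: "openin X (G r)" and downG: "down (G r)" and GV: "G r \<subseteq> ?V"
    if "r \<in> dyadics \<inter> {0..1}" for r
    using that by blast+
  \<comment> \<open>Inserting 1 keeps the infimum defined and gives the value 1 at points outside
    every member of the family.\<close>
  define I where "I z = insert 1 {r \<in> dyadics \<inter> {0..1}. z \<in> G r}" for z
  define f where "f z = Inf (I z)" for z
  have bdd: "bdd_below (I z)" and nonempty: "I z \<noteq> {}" and I01: "I z \<subseteq> {0..1}" for z
    by (auto simp: I_def)
  have f0: "0 \<le> f z" for z
    unfolding f_def using nonempty I01[of z] by (intro cInf_greatest) auto
  have f_mono: "f z \<le> f w" if "(z, w) \<in> R" for z w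
  proof -
    have "I w \<subseteq> I z"
      using that downG unfolding I_def down_def by blast
    then show ?thesis
      unfolding f_def using bdd nonempty by (intro cInf_superset_mono) auto
  qed
  have f_less: "f z < a \<longleftrightarrow> (\<exists>r\<in>I z. r < a)" for z a
    unfolding f_def using bdd nonempty by (simp add: cInf_less_iff)
  have "continuous_map X euclideanreal f"
    unfolding continuous_map_upper_lower_semicontinuous_lt
  proof (intro conjI allI)
    fix a :: real
    show "openin X {z \<in> topspace X. f z < a}"
    proof (cases "1 < a")
      case True
      then have "{z \<in> topspace X. f z < a} = topspace X"
        by (auto simp: f_less I_def)
      then show ?thesis
        by simp
    next
      case False
      then have "{z \<in> topspace X. f z < a} = \<Union>(G ` {r \<in> dyadics \<inter> {0..1}. r < a})"
        using openG openin_subset by (fastforce simp: f_less I_def)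
      then show ?thesis
        using openG by auto
    qed
    show "openin X {z \<in> topspace X. a < f z}"
    proof (cases "a < 0")
      case True
      then have "{z \<in> topspace X. a < f z} = topspace X"
        using f0 by (auto intro: less_le_trans)
      then show ?thesis
        by simp
    next
      case False
      have "\<exists>T. openin X T \<and> z \<in> T \<and> T \<subseteq> {z \<in> topspace X. a < f z}"
        if z: "z \<in> topspace X" "a < f z" for z
      proof -
        have "f z \<le> 1"
          unfolding f_def using bdd by (intro cInf_lower) (auto simp: I_def)
        \<comment> \<open>Two dyadics between \<open>a\<close> and \<open>f z\<close> are needed:
          the closed set between \<open>G r\<close> and \<open>G s\<close> misses \<open>z\<close>,
          and on its complement the function is at least \<open>r > a\<close>.\<close>
        obtain s where s: "s \<in> dyadics \<inter> {0..1}" "a < s" "s < f z"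
          using dyadics_dense[of a "f z"] False z \<open>f z \<le> 1\<close> by auto
        obtain r where r: "r \<in> dyadics \<inter> {0..1}" "a < r" "r < s"
          using dyadics_dense[of a s] False s by auto
        obtain A where A: "closedin X A" "G r \<subseteq> A" "A \<subseteq> G s"
          using G[OF r(1) s(1) r(3)] unfolding P_def by blast
        have "z \<notin> G s"
          using s f_less[of z "f z"] by (auto simp: I_def)
        have "a < f w" if w: "w \<in> topspace X - A" for w
        proof -
          have "r \<le> t" if "t \<in> I w" for t
          proof (rule ccontr)
            assume "\<not> r \<le> t"
            then have "t \<in> dyadics \<inter> {0..1}" "w \<in> G t" "t < r"
              using that r by (auto simp: I_def)
            then have "w \<in> G r"
              using G[of t r] r(1) unfolding P_def by blast
            then show False
              using A w by blast
          qed
          then have "r \<le> f w"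
            unfolding f_def using nonempty by (intro cInf_greatest)
          then show ?thesis
            using r by linarith
        qed
        then show ?thesis
          using A \<open>z \<notin> G s\<close> z by (intro exI[of _ "topspace X - A"]) blast
      qed
      then show ?thesis
        unfolding openin_subopen[of X "{z \<in> topspace X. a < f z}"] by blast
    qed
  qed
  moreover have "f y < f x"
  proof -
    have "y \<in> G 0"
      using G0 U(5) order_refl xy by blast
    then have "0 \<in> I y"
      using 01(1) unfolding I_def by blast
    then have "f y < 1"
      unfolding f_less by (rule bexI[rotated]) simp
    moreover have "x \<notin> G r" if "r \<in> dyadics \<inter> {0..1}" for r
      using GV[OF that] order_refl xy by blast
    then have "I x = {1}"
      unfolding I_def by blast
    then have "f x = 1"
      by (simp add: f_def)
    ultimately show ?thesis
      by simp
  qed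
  ultimately show thesis
    using that[OF _ f0 f_mono] by simp
qed

end

section \<open>Norm topology and algebras of continuous functions\<close>

lemma cring_complex_ring: "cring complex_ring"
proof (rule cringI)
  show "abelian_group complex_ring"
    by (rule abelian_groupI) (auto simp: complex_ring_def intro: exI[of _ "- _"] add.left_inverse)
  show "comm_monoid complex_ring"
    by (rule comm_monoidI) (auto simp: complex_ring_def)
qed (auto simp: complex_ring_def algebra_simps)

lemma complex_ring_simps [simp]:
  "carrier complex_ring = UNIV" "a \<otimes>\<^bsub>complex_ring\<^esub> b = a * b" "a \<oplus>\<^bsub>complex_ring\<^esub> b = a + b"
  "\<one>\<^bsub>complex_ring\<^esub> = 1" "\<zero>\<^bsub>complex_ring\<^esub> = 0"
  by (simp_all add: complex_ring_def)

text \<open>Stated from bare norm axioms, because for the algebra of continuous functions the metric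
  is needed to express completeness before that algebra is known to be a C*-algebra.\<close>

lemma Metric_space_nrm_dist:
  fixes B :: "'b star_algebra" (structure)
  assumes "abelian_group B"
    and nonneg: "\<And>f. f \<in> carrier B \<Longrightarrow> 0 \<le> nrm B f"
    and eq_0: "\<And>f. f \<in> carrier B \<Longrightarrow> nrm B f = 0 \<longleftrightarrow> f = \<zero>"
    and triangle: "\<And>f g. \<lbrakk>f \<in> carrier B; g \<in> carrier B\<rbrakk> \<Longrightarrow> nrm B (f \<oplus> g) \<le> nrm B f + nrm B g"
    and minus: "\<And>f. f \<in> carrier B \<Longrightarrow> nrm B (\<ominus> f) = nrm B f"
  shows "Metric_space (carrier B) (nrm_dist B)"
proof -
  interpret abelian_group B by fact
  show ?thesis
  proof
    show "0 \<le> nrm_dist B f g" for f g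
      by (auto simp: nrm_dist_def intro: nonneg)
    show "nrm_dist B f g = nrm_dist B g f" for f g
    proof -
      have "\<ominus> (f \<ominus> g) = g \<ominus> f" if "f \<in> carrier B" "g \<in> carrier B"
        using that by (simp add: a_minus_def minus_add a_comm)
      then show ?thesis
        using minus[of "f \<ominus> g"] by (auto simp: nrm_dist_def)
    qed
    show "nrm_dist B f g = 0 \<longleftrightarrow> f = g" if "f \<in> carrier B" "g \<in> carrier B" for f g
    proof -
      have "f \<ominus> g = \<zero> \<longleftrightarrow> f = g"
        using that minus_equality[of f "\<ominus> g"] by (auto simp: a_minus_def r_neg)
      then show ?thesis
        using that by (simp add: nrm_dist_def eq_0)
    qed
    show "nrm_dist B f h \<le> nrm_dist B f g + nrm_dist B g h"
      if "f \<in> carrier B" "g \<in> carrier B" "h \<in> carrier B" for f g h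
    proof -
      have "f \<ominus> h = (f \<ominus> g) \<oplus> (g \<ominus> h)"
        using that by (simp add: a_minus_def a_assoc r_neg1)
      then show ?thesis
        using that triangle[of "f \<ominus> g" "g \<ominus> h"] by (simp add: nrm_dist_def)
    qed
  qed
qed

context comm_cstar_algebra
begin

lemma minus_eq_smult: "f \<in> carrier B \<Longrightarrow> \<ominus> f = (- 1) \<odot> f"
proof -
  assume f: "f \<in> carrier B"
  have "(- 1) \<odot> f \<oplus> f = ((- 1) + 1) \<odot> f"
    using smult_l_distr[of "- 1" 1 f] smult_one[OF f] f by (simp only: complex_ring_simps) simp
  also have "\<dots> = \<zero>"
    using smult_l_null[OF f] by simp
  finally show ?thesis
    using f by (intro minus_equality) auto
qed

lemma nrm_minus: "f \<in> carrier B \<Longrightarrow> nrm B (\<ominus> f) = nrm B f"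
  by (simp add: minus_eq_smult nrm_smult)

sublocale Metric: Metric_space "carrier B" "nrm_dist B"
  by (intro Metric_space_nrm_dist nrm_nonneg nrm_eq_0_iff nrm_triangle nrm_minus) unfold_locales

lemma nrm_dist: "\<lbrakk>f \<in> carrier B; g \<in> carrier B\<rbrakk> \<Longrightarrow> nrm_dist B f g = nrm B (f \<ominus> g)"
  by (simp add: nrm_dist_def)

lemma nrm_closure_of:
  assumes "S \<subseteq> carrier B"
  shows "nrm_topology B closure_of S = {f \<in> carrier B. \<forall>\<epsilon>>0. \<exists>g\<in>S. nrm B (f \<ominus> g) < \<epsilon>}"
  using assms unfolding nrm_topology_def Metric.metric_closure_of
  by (fastforce simp: Metric.in_mball nrm_dist)

lemma nrm_closedin_iff:
  assumes "S \<subseteq> carrier B"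
  shows "closedin (nrm_topology B) S \<longleftrightarrow> (\<forall>f\<in>carrier B. (\<forall>\<epsilon>>0. \<exists>g\<in>S. nrm B (f \<ominus> g) < \<epsilon>) \<longrightarrow> f \<in> S)"
proof -
  have "topspace (nrm_topology B) = carrier B"
    by (simp add: nrm_topology_def)
  then have "closedin (nrm_topology B) S \<longleftrightarrow> nrm_topology B closure_of S \<subseteq> S"
    using assms by (metis closure_of_closedin closure_of_subset_eq subset_refl)
  then show ?thesis
    using nrm_closure_of[OF assms] by auto
qed

end

section \<open>The C*-algebra of continuous functions on a compact space\<close>

lemma continuous_map_complex_mult:
  fixes f g :: "'a \<Rightarrow> complex"
  assumes "continuous_map X euclidean f" "continuous_map X euclidean g"
  shows "continuous_map X euclidean (\<lambda>x. f x * g x)"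
  using assms by (simp add: continuous_map_atin tendsto_mult)

text \<open>The common setting for compact ordered spaces and for Gelfand spectra, so that the
  function algebra is treated once.\<close>

locale nonempty_compact =
  fixes X :: "'a topology"
  assumes compact: "compact_space X" and nonempty: "topspace X \<noteq> {}"
begin

abbreviation "A \<equiv> continuous_functions X"

lemma A_simps:
  "carrier A = {f \<in> extensional (topspace X). continuous_map X euclidean f}"
  "f \<otimes>\<^bsub>A\<^esub> g = (\<lambda>x\<in>topspace X. f x * g x)"
  "f \<oplus>\<^bsub>A\<^esub> g = (\<lambda>x\<in>topspace X. f x + g x)"
  "\<one>\<^bsub>A\<^esub> = (\<lambda>x\<in>topspace X. 1)" "\<zero>\<^bsub>A\<^esub> = (\<lambda>x\<in>topspace X. 0)"
  "a \<odot>\<^bsub>A\<^esub> f = (\<lambda>x\<in>topspace X. a * f x)"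
  "star A f = (\<lambda>x\<in>topspace X. cnj (f x))"
  "nrm A f = (SUP x\<in>topspace X. cmod (f x))"
  by (simp_all add: continuous_functions_def)

lemma restrict_in_A:
  "continuous_map X euclidean f \<Longrightarrow> (\<lambda>x\<in>topspace X. f x) \<in> carrier A"
  by (auto simp: A_simps intro: continuous_map_eq)

lemma continuous_A: "f \<in> carrier A \<Longrightarrow> continuous_map X euclidean f"
  by (simp add: A_simps)

lemma A_eqI:
  "\<lbrakk>f \<in> carrier A; g \<in> carrier A; \<And>x. x \<in> topspace X \<Longrightarrow> f x = g x\<rbrakk> \<Longrightarrow> f = g"
  by (auto simp: A_simps intro: extensionalityI)

lemma A_closed:
  assumes "f \<in> carrier A" "g \<in> carrier A"
  shows "f \<oplus>\<^bsub>A\<^esub> g \<in> carrier A" "f \<otimes>\<^bsub>A\<^esub> g \<in> carrier A" "a \<odot>\<^bsub>A\<^esub> f \<in> carrier A"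
    "star A f \<in> carrier A" "\<one>\<^bsub>A\<^esub> \<in> carrier A" "\<zero>\<^bsub>A\<^esub> \<in> carrier A"
proof -
  have "continuous_map X euclidean (\<lambda>x. cnj (f x))"
    using continuous_map_compose[OF continuous_A[OF assms(1)], of euclidean cnj]
    by (simp add: o_def continuous_on_cnj)
  then show "star A f \<in> carrier A"
    using restrict_in_A by (simp add: A_simps(7))
qed (use assms[THEN continuous_A] in \<open>auto simp: A_simps(2-6) intro!: restrict_in_A continuous_map_add
    continuous_map_complex_mult\<close>)

lemma cring_A: "cring A"
proof (rule cringI)
  show "abelian_group A"
  proof (rule abelian_groupI)
    show "\<exists>g\<in>carrier A. g \<oplus>\<^bsub>A\<^esub> f = \<zero>\<^bsub>A\<^esub>" if "f \<in> carrier A" for f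
      using that A_closed(3)[of f f "- 1"]
      by (intro bexI[of _ "(- 1) \<odot>\<^bsub>A\<^esub> f"]) (auto simp: A_simps)
  qed (auto simp: A_closed intro!: A_eqI, auto simp: A_simps)
  show "comm_monoid A"
    by (rule comm_monoidI) (auto simp: A_closed intro!: A_eqI, auto simp: A_simps)
qed (auto simp: A_closed intro!: A_eqI, auto simp: A_simps algebra_simps)

lemma A_minus:
  assumes "f \<in> carrier A" "g \<in> carrier A"
  shows "\<ominus>\<^bsub>A\<^esub> g = (\<lambda>x\<in>topspace X. - g x)" "f \<ominus>\<^bsub>A\<^esub> g = (\<lambda>x\<in>topspace X. f x - g x)"
proof -
  interpret cring A by (rule cring_A)
  have "(- 1) \<odot>\<^bsub>A\<^esub> g \<oplus>\<^bsub>A\<^esub> g = \<zero>\<^bsub>A\<^esub>"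
    by (auto simp: A_simps)
  then have "\<ominus>\<^bsub>A\<^esub> g = (- 1) \<odot>\<^bsub>A\<^esub> g"
    using assms A_closed by (intro minus_equality) auto
  then show "\<ominus>\<^bsub>A\<^esub> g = (\<lambda>x\<in>topspace X. - g x)"
    by (auto simp: A_simps)
  then show "f \<ominus>\<^bsub>A\<^esub> g = (\<lambda>x\<in>topspace X. f x - g x)"
    by (auto simp: a_minus_def A_simps)
qed

lemma bdd_A: "f \<in> carrier A \<Longrightarrow> bdd_above ((\<lambda>x. cmod (f x)) ` topspace X)"
proof -
  assume "f \<in> carrier A"
  then have "compact (f ` topspace X)"
    using image_compactin[of X "topspace X" euclidean f] compact
    by (simp add: compact_space_def continuous_A)
  then have "bounded (f ` topspace X)"
    by (rule compact_imp_bounded)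
  then show ?thesis
    by (auto simp: bounded_iff bdd_above_def)
qed

lemma nrm_A_upper: "\<lbrakk>f \<in> carrier A; x \<in> topspace X\<rbrakk> \<Longrightarrow> cmod (f x) \<le> nrm A f"
  unfolding A_simps(8) by (intro cSUP_upper bdd_A)

lemma nrm_A_least: "(\<And>x. x \<in> topspace X \<Longrightarrow> cmod (f x) \<le> c) \<Longrightarrow> nrm A f \<le> c"
  unfolding A_simps(8) using nonempty by (intro cSUP_least)

lemma nrm_A_nonneg: "f \<in> carrier A \<Longrightarrow> 0 \<le> nrm A f"
  using nonempty nrm_A_upper[of f] norm_ge_zero order_trans by blast

lemma nrm_A_eqI: "(\<And>x. x \<in> topspace X \<Longrightarrow> cmod (f x) = cmod (g x)) \<Longrightarrow> nrm A f = nrm A g"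
  unfolding A_simps(8) by (intro SUP_cong) auto

lemma nrm_A_eq_0: "f \<in> carrier A \<Longrightarrow> nrm A f = 0 \<longleftrightarrow> f = \<zero>\<^bsub>A\<^esub>"
proof
  assume f: "f \<in> carrier A" "nrm A f = 0"
  then show "f = \<zero>\<^bsub>A\<^esub>"
    using nrm_A_upper[OF f(1)] A_closed(6)[OF f(1) f(1)]
    by (intro A_eqI) (auto simp: A_simps(5))
next
  assume "f = \<zero>\<^bsub>A\<^esub>"
  then show "nrm A f = 0"
    using nonempty by (simp add: A_simps(5,8))
qed

lemma nrm_A_triangle:
  "\<lbrakk>f \<in> carrier A; g \<in> carrier A\<rbrakk> \<Longrightarrow> nrm A (f \<oplus>\<^bsub>A\<^esub> g) \<le> nrm A f + nrm A g"
  by (intro nrm_A_least) (auto simp: A_simps(3) intro: norm_triangle_le add_mono nrm_A_upper)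

lemma Metric_A: "Metric_space (carrier A) (nrm_dist A)"
proof (rule Metric_space_nrm_dist)
  show "abelian_group A"
    using cring_A cring.axioms(1) ring.axioms(1) by blast
  show "nrm A (\<ominus>\<^bsub>A\<^esub> f) = nrm A f" if "f \<in> carrier A" for f
    using that by (intro nrm_A_eqI) (simp add: A_minus)
qed (auto intro: nrm_A_nonneg nrm_A_triangle simp: nrm_A_eq_0)

lemma nrm_dist_A_upper:
  "\<lbrakk>f \<in> carrier A; g \<in> carrier A; x \<in> topspace X\<rbrakk> \<Longrightarrow> dist (f x) (g x) \<le> nrm_dist A f g"
proof -
  assume fg: "f \<in> carrier A" "g \<in> carrier A" "x \<in> topspace X"
  interpret cring A by (rule cring_A)
  show "dist (f x) (g x) \<le> nrm_dist A f g"
    using nrm_A_upper[of "f \<ominus>\<^bsub>A\<^esub> g" x] minus_closed[OF fg(1,2)] fg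
    by (simp add: nrm_dist_def A_minus(2)[OF fg(1,2)] dist_norm)
qed

lemma nrm_dist_A_least:
  "\<lbrakk>f \<in> carrier A; g \<in> carrier A; \<And>x. x \<in> topspace X \<Longrightarrow> dist (f x) (g x) \<le> c\<rbrakk> \<Longrightarrow> nrm_dist A f g \<le> c"
  by (simp add: nrm_dist_def A_minus dist_norm nrm_A_least)

lemma mcomplete_A: "Metric_space.mcomplete (carrier A) (nrm_dist A)"
proof -
  interpret Metric: Metric_space "carrier A" "nrm_dist A"
    by (rule Metric_A)
  show ?thesis
    unfolding Metric.mcomplete_def
  proof (intro allI impI)
    fix \<sigma> assume \<sigma>: "Metric.MCauchy \<sigma>"
    have mem: "\<sigma> n \<in> carrier A" for n
      using \<sigma> by (auto simp: Metric.MCauchy_def)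
    have Cauchy: "Cauchy (\<lambda>n. \<sigma> n x)" if x: "x \<in> topspace X" for x
      unfolding Cauchy_def
    proof (intro allI impI)
      fix \<epsilon> :: real assume "0 < \<epsilon>"
      then obtain N where "\<forall>n n'. N \<le> n \<longrightarrow> N \<le> n' \<longrightarrow> nrm_dist A (\<sigma> n) (\<sigma> n') < \<epsilon>"
        using \<sigma> by (auto simp: Metric.MCauchy_def)
      then show "\<exists>M. \<forall>m\<ge>M. \<forall>n\<ge>M. dist (\<sigma> m x) (\<sigma> n x) < \<epsilon>"
        using nrm_dist_A_upper[OF mem mem x] order_le_less_trans by blast
    qed
    define g where "g = (\<lambda>x\<in>topspace X. lim (\<lambda>n. \<sigma> n x))"
    have lim: "(\<lambda>n. \<sigma> n x) \<longlonglongrightarrow> g x" if "x \<in> topspace X" for x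
      using Cauchy[OF that] that by (simp add: g_def convergent_LIMSEQ_iff Cauchy_convergent_iff)
    have unif: "\<exists>N. \<forall>n\<ge>N. \<forall>x\<in>topspace X. dist (\<sigma> n x) (g x) \<le> \<epsilon>" if "0 < \<epsilon>" for \<epsilon>
    proof -
      obtain N where N: "\<forall>n n'. N \<le> n \<longrightarrow> N \<le> n' \<longrightarrow> nrm_dist A (\<sigma> n) (\<sigma> n') < \<epsilon>"
        using \<sigma> \<open>0 < \<epsilon>\<close> by (auto simp: Metric.MCauchy_def)
      \<comment> \<open>Letting the second index tend to infinity in the Cauchy estimate, whose
        \<open>N\<close> does not depend on \<open>x\<close>, makes the pointwise convergence
        uniform.\<close>
      have "dist (\<sigma> n x) (g x) \<le> \<epsilon>" if "N \<le> n" "x \<in> topspace X" for n x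
      proof (rule LIMSEQ_le_const2)
        show "(\<lambda>m. dist (\<sigma> n x) (\<sigma> m x)) \<longlonglongrightarrow> dist (\<sigma> n x) (g x)"
          using lim[OF that(2)] by (intro tendsto_intros)
        show "\<exists>M. \<forall>m\<ge>M. dist (\<sigma> n x) (\<sigma> m x) \<le> \<epsilon>"
          using N nrm_dist_A_upper[OF mem mem that(2)] that(1)
          by (meson less_imp_le order_trans)
      qed
      then show ?thesis
        by blast
    qed
    have "continuous_map X Met_TC.mtopology g"
    proof (rule Met_TC.continuous_map_uniform_limit)
      show "\<forall>\<^sub>F n in sequentially. continuous_map X Met_TC.mtopology (\<sigma> n)"
        using continuous_A[OF mem] by simp
      show "\<forall>\<^sub>F n in sequentially. \<forall>x\<in>topspace X. g x \<in> UNIV \<and> dist (\<sigma> n x) (g x) < \<epsilon>" if "0 < \<epsilon>" for \<epsilon>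
        using unif[of "\<epsilon> / 2"] that unfolding eventually_sequentially
        by (metis UNIV_I field_sum_of_halves half_gt_zero less_add_same_cancel1 order_le_less_trans)
    qed simp
    then have g: "g \<in> carrier A"
      by (simp add: A_simps g_def)
    have "limitin Metric.mtopology \<sigma> g sequentially"
      unfolding Metric.limit_metric_sequentially
    proof (intro conjI allI impI g)
      fix \<epsilon> :: real assume "0 < \<epsilon>"
      then obtain N where "\<forall>n\<ge>N. \<forall>x\<in>topspace X. dist (\<sigma> n x) (g x) \<le> \<epsilon> / 2"
        using unif[of "\<epsilon> / 2"] by auto
      then have "\<forall>n\<ge>N. nrm_dist A (\<sigma> n) g \<le> \<epsilon> / 2"
        using nrm_dist_A_least[OF mem g] by blast
      then show "\<exists>N. \<forall>n\<ge>N. \<sigma> n \<in> carrier A \<and> nrm_dist A (\<sigma> n) g < \<epsilon>"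
        using mem \<open>0 < \<epsilon>\<close> by (intro exI[of _ N]) force
    qed
    then show "\<exists>g. limitin Metric.mtopology \<sigma> g sequentially"
      by blast
  qed
qed

lemma nrm_A_mult_const:
  assumes f: "f \<in> carrier A"
  shows "nrm A (a \<odot>\<^bsub>A\<^esub> f) = cmod a * nrm A f"
proof (rule antisym)
  show "nrm A (a \<odot>\<^bsub>A\<^esub> f) \<le> cmod a * nrm A f"
    using f by (intro nrm_A_least) (auto simp: A_simps(6) norm_mult intro: mult_left_mono nrm_A_upper)
  show "cmod a * nrm A f \<le> nrm A (a \<odot>\<^bsub>A\<^esub> f)"
  proof (cases "a = 0")
    case False
    have "nrm A f \<le> nrm A (a \<odot>\<^bsub>A\<^esub> f) / cmod a"
      using False nrm_A_upper[OF A_closed(3)[OF f f, of a]]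
      by (intro nrm_A_least) (auto simp: A_simps(6) norm_mult field_simps)
    then show ?thesis
      using False by (simp add: field_simps)
  qed (use nrm_A_nonneg A_closed(3) f in auto)
qed

lemma nrm_A_star_mult:
  assumes f: "f \<in> carrier A"
  shows "nrm A (star A f \<otimes>\<^bsub>A\<^esub> f) = (nrm A f)\<^sup>2"
proof (rule antisym)
  have sq: "cmod ((star A f \<otimes>\<^bsub>A\<^esub> f) x) = (cmod (f x))\<^sup>2" if "x \<in> topspace X" for x
    using that by (simp add: A_simps norm_mult power2_eq_square)
  show "nrm A (star A f \<otimes>\<^bsub>A\<^esub> f) \<le> (nrm A f)\<^sup>2"
    using f by (intro nrm_A_least) (auto simp: sq intro: power_mono nrm_A_upper)
  have mem: "star A f \<otimes>\<^bsub>A\<^esub> f \<in> carrier A"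
    using A_closed(2)[OF A_closed(4)[OF f f] f] .
  have "nrm A f \<le> sqrt (nrm A (star A f \<otimes>\<^bsub>A\<^esub> f))"
    using nrm_A_upper[OF mem] by (intro nrm_A_least real_le_rsqrt) (simp add: sq)
  then show "(nrm A f)\<^sup>2 \<le> nrm A (star A f \<otimes>\<^bsub>A\<^esub> f)"
    using nrm_A_nonneg[OF f] nrm_A_nonneg[OF mem]
    by (metis real_sqrt_pow2 power_mono)
qed

theorem comm_cstar_algebra_A: "comm_cstar_algebra A"
proof (intro comm_cstar_algebra.intro comm_cstar_algebra_axioms.intro)
  show "algebra complex_ring A"
    by (rule algebraI[OF cring_complex_ring cring_A])
      (auto simp: A_closed intro!: A_eqI, auto simp: A_simps algebra_simps)
  show "nrm A (star A f \<otimes>\<^bsub>A\<^esub> f) = (nrm A f)\<^sup>2" if "f \<in> carrier A" for f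
    using that by (rule nrm_A_star_mult)
  show "nrm A (f \<otimes>\<^bsub>A\<^esub> g) \<le> nrm A f * nrm A g" if "f \<in> carrier A" "g \<in> carrier A" for f g
    using that by (intro nrm_A_least) (auto simp: A_simps(2) norm_mult intro: mult_mono nrm_A_upper nrm_A_nonneg)
  show "nrm A \<one>\<^bsub>A\<^esub> = 1"
    using nonempty by (simp add: A_simps)
  show "nrm A (star A f) = nrm A f" if "f \<in> carrier A" for f
    using that by (intro nrm_A_eqI) (simp add: A_simps)
qed (auto simp: A_closed nrm_A_nonneg nrm_A_eq_0 nrm_A_mult_const mcomplete_A
    intro: nrm_A_triangle intro!: A_eqI, auto simp: A_simps)

end

section \<open>Squares of hermitian elements\<close>

context comm_cstar_algebra
begin

text \<open>Embedding the scalars as ring elements turns scalar multiplication into ring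
  multiplication, so that identities with scalars become ring identities.\<close>

definition sc :: "complex \<Rightarrow> 'b" where "sc a = a \<odot> \<one>"

lemma sc_closed [simp, intro]: "sc a \<in> carrier B"
  by (simp add: sc_def)

lemma sc_add: "sc (a + b) = sc a \<oplus> sc b"
  using smult_l_distr[of a b "\<one>"] by (simp add: sc_def)

lemma sc_mult: "sc (a * b) = sc a \<otimes> sc b"
  using smult_assoc1[of a b "\<one>"] smult_assoc2[of a "\<one>" "b \<odot> \<one>"] by (simp add: sc_def)

lemma sc_1 [simp]: "sc 1 = \<one>"
  using smult_one[of "\<one>"] by (simp add: sc_def)

lemma sc_0 [simp]: "sc 0 = \<zero>"
  using smult_l_null[of "\<one>"] by (simp add: sc_def)

lemma sc_minus: "sc (- a) = \<ominus> sc a"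
  using sc_add[of "- a" a] by (intro minus_equality[symmetric]) auto

lemma sc_diff: "sc (a - b) = sc a \<ominus> sc b"
  using sc_add[of a "- b"] by (simp add: sc_minus minus_eq)

lemma smult_eq: "f \<in> carrier B \<Longrightarrow> a \<odot> f = sc a \<otimes> f"
  using smult_assoc2[of a "\<one>" f] by (simp add: sc_def)

lemma star_one: "star B \<one> = \<one>"
proof -
  have "\<one> = star B (star B \<one> \<otimes> \<one>)"
    by (simp add: star_closed star_star)
  also have "\<dots> = star B \<one>"
    by (subst star_mult) (simp_all add: star_closed star_star)
  finally show ?thesis
    by (rule sym)
qed

lemma star_sc: "star B (sc a) = sc (cnj a)"
  by (simp add: sc_def star_smult star_one)

lemma nrm_sc [simp]: "nrm B (sc a) = cmod a"
  by (simp add: sc_def nrm_smult nrm_one)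

lemma star_minus: "f \<in> carrier B \<Longrightarrow> star B (\<ominus> f) = \<ominus> star B f"
  by (simp add: minus_eq_smult star_smult star_closed)

abbreviation "H \<equiv> hermitian B"

lemma H_iff: "f \<in> H \<longleftrightarrow> f \<in> carrier B \<and> star B f = f"
  by (simp add: hermitian_def)

lemma H_closed [intro]:
  "\<lbrakk>f \<in> H; g \<in> H\<rbrakk> \<Longrightarrow> f \<oplus> g \<in> H" "\<lbrakk>f \<in> H; g \<in> H\<rbrakk> \<Longrightarrow> f \<otimes> g \<in> H"
  "f \<in> H \<Longrightarrow> \<ominus> f \<in> H" "\<lbrakk>f \<in> H; g \<in> H\<rbrakk> \<Longrightarrow> f \<ominus> g \<in> H" "\<one> \<in> H" "\<zero> \<in> H"
  "sc (of_real r) \<in> H"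
proof -
  have "star B \<zero> = \<zero>"
    using star_sc[of 0] by simp
  then show "\<lbrakk>f \<in> H; g \<in> H\<rbrakk> \<Longrightarrow> f \<oplus> g \<in> H" "\<lbrakk>f \<in> H; g \<in> H\<rbrakk> \<Longrightarrow> f \<otimes> g \<in> H"
    "f \<in> H \<Longrightarrow> \<ominus> f \<in> H" "\<lbrakk>f \<in> H; g \<in> H\<rbrakk> \<Longrightarrow> f \<ominus> g \<in> H" "\<one> \<in> H" "\<zero> \<in> H"
    "sc (of_real r) \<in> H"
    by (auto simp: H_iff star_add star_mult star_minus star_one star_sc minus_eq m_comm)
qed

text \<open>The inverse is the fixed point of
  \<open>y \<mapsto> \<one> \<oplus> a \<otimes> y\<close>, a contraction with constant
  \<open>nrm B a\<close>.\<close>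

lemma one_minus_in_Units:
  assumes a: "a \<in> carrier B" and "nrm B a < 1"
  shows "\<one> \<ominus> a \<in> Units B"
proof -
  obtain y where y: "y \<in> carrier B" "\<one> \<oplus> a \<otimes> y = y"
  proof (rule Metric.Banach_fixedpoint_thm[OF complete, of "\<lambda>y. \<one> \<oplus> a \<otimes> y" "nrm B a"])
    fix y z assume yz: "y \<in> carrier B" "z \<in> carrier B"
    have "(\<one> \<oplus> a \<otimes> y) \<ominus> (\<one> \<oplus> a \<otimes> z) = a \<otimes> (y \<ominus> z)"
      using a yz one_closed by algebra
    then show "nrm_dist B (\<one> \<oplus> a \<otimes> y) (\<one> \<oplus> a \<otimes> z) \<le> nrm B a * nrm_dist B y z"
      using a yz nrm_mult[of a "y \<ominus> z"] by (simp add: nrm_dist)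
  qed (use assms in auto)
  have "(\<one> \<ominus> a) \<otimes> y = (\<one> \<oplus> a \<otimes> y) \<ominus> a \<otimes> y"
    using a y(1) one_closed unfolding y(2) by algebra
  also have "\<dots> = \<one>"
    using a y(1) one_closed by algebra
  finally have "(\<one> \<ominus> a) \<otimes> y = \<one>" .
  moreover from this have "y \<otimes> (\<one> \<ominus> a) = \<one>"
    using a y(1) by (simp add: m_comm)
  ultimately show ?thesis
    using a y(1) by (auto simp: Units_def)
qed

text \<open>For hermitian \<open>g\<close> the defect \<open>star B f \<ominus> f\<close> is the
  difference of \<open>star B (f \<ominus> g)\<close> and \<open>f \<ominus> g\<close>, and the
  involution preserves the norm.\<close>

lemma H_closedin: "closedin (nrm_topology B) H"
proof -
  have "f \<in> H" if f: "f \<in> carrier B" and lim: "\<forall>\<epsilon>>0. \<exists>g\<in>H. nrm B (f \<ominus> g) < \<epsilon>" for f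
  proof -
    have "nrm B (star B f \<ominus> f) \<le> \<epsilon>" if "0 < \<epsilon>" for \<epsilon>
    proof -
      obtain g where g: "g \<in> H" "nrm B (f \<ominus> g) < \<epsilon> / 2"
        using lim \<open>0 < \<epsilon>\<close> half_gt_zero by blast
      have gc: "g \<in> carrier B" "star B g = g"
        using g by (auto simp: H_iff)
      have "star B (f \<ominus> g) = star B f \<ominus> g"
        using f gc by (simp add: minus_eq star_add star_minus)
      moreover have "star B f \<ominus> f = (star B f \<ominus> g) \<oplus> \<ominus> (f \<ominus> g)"
        using f gc(1) star_closed[OF f] by algebra
      ultimately have "star B f \<ominus> f = star B (f \<ominus> g) \<oplus> \<ominus> (f \<ominus> g)"
        by simp
      then show ?thesis
        using nrm_triangle[of "star B (f \<ominus> g)" "\<ominus> (f \<ominus> g)"] g(2) f gc(1)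
        by (simp add: nrm_star nrm_minus star_closed)
    qed
    then have "nrm B (star B f \<ominus> f) \<le> 0"
      by (rule field_le_epsilon[where y = 0, simplified])
    then have "nrm_dist B (star B f) f = 0"
      using f nrm_nonneg[of "star B f \<ominus> f"] by (simp add: nrm_dist star_closed)
    then show ?thesis
      using f by (simp add: H_iff star_closed)
  qed
  then show ?thesis
    by (subst nrm_closedin_iff) (auto simp: H_iff)
qed

text \<open>A fixed point \<open>y\<close> of \<open>y \<mapsto> (a + y\<^sup>2) / 2\<close> satisfies \<open>(1 - y)\<^sup>2 = 1 - a\<close>; the map is a contraction of the ball of
  radius \<open>1 - sqrt (1 - \<parallel>a\<parallel>)\<close>.\<close>

lemma exists_sqrt_one_minus:
  assumes a: "a \<in> H" and "nrm B a < 1"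
  obtains b where "b \<in> H" "\<one> \<ominus> a = b \<otimes> b"
proof -
  \<comment> \<open>\<open>1 - s\<close> is the smaller root of
    \<open>t = (nrm B a + t\<^sup>2) / 2\<close>, so the ball of this radius is mapped into itself;
    \<open>0 < s\<close> makes the same number a contraction constant below 1.\<close>
  define s where "s = sqrt (1 - nrm B a)"
  define \<rho> where "\<rho> = 1 - s"
  have ac: "a \<in> carrier B"
    using a by (simp add: H_iff)
  have s: "0 < s" "s \<le> 1" "s\<^sup>2 = 1 - nrm B a"
    using assms(2) nrm_nonneg[OF ac] by (auto simp: s_def)
  then have "nrm B a = 1 - s\<^sup>2"
    by simp
  with s have \<rho>: "0 \<le> \<rho>" "\<rho> < 1" "(nrm B a + \<rho>\<^sup>2) / 2 = \<rho>"
    by (simp_all add: \<rho>_def power2_eq_square field_simps)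
  \<comment> \<open>Intersecting the ball with the closed set \<open>H\<close>, which the map also
    preserves, makes the fixed point hermitian.\<close>
  define K where "K = H \<inter> {y \<in> carrier B. nrm B y \<le> \<rho>}"
  have KH: "y \<in> carrier B" "y \<in> H" "nrm B y \<le> \<rho>" if "y \<in> K" for y
    using that by (auto simp: K_def)
  have "closedin (nrm_topology B) {y \<in> carrier B. nrm B y \<le> \<rho>}"
  proof -
    have "nrm B f \<le> \<rho>" if f: "f \<in> carrier B" and lim: "\<forall>\<epsilon>>0. \<exists>g\<in>{y \<in> carrier B. nrm B y \<le> \<rho>}. nrm B (f \<ominus> g) < \<epsilon>" for f
    proof (rule field_le_epsilon)
      fix \<epsilon> :: real assume "0 < \<epsilon>"
      then obtain g where g: "g \<in> carrier B" "nrm B g \<le> \<rho>" "nrm B (f \<ominus> g) < \<epsilon>"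
        using lim by blast
      have "f = g \<oplus> (f \<ominus> g)"
        using f g(1) by algebra
      then show "nrm B f \<le> \<rho> + \<epsilon>"
        using nrm_triangle[of g "f \<ominus> g"] f g by simp
    qed
    then show ?thesis
      by (subst nrm_closedin_iff) auto
  qed
  then have "closedin Metric.mtopology K"
    using H_closedin unfolding K_def nrm_topology_def by (rule closedin_Int[rotated])
  interpret K: Submetric "carrier B" "nrm_dist B" K
    by unfold_locales (use KH(1) in auto)
  have cK: "K.sub.mcomplete"
    using K.closedin_mcomplete_imp_mcomplete \<open>closedin Metric.mtopology K\<close> complete by blast
  let ?T = "\<lambda>y. (1/2) \<odot> (a \<oplus> y \<otimes> y)"
  obtain y where y: "y \<in> K" "?T y = y"
  proof (rule K.sub.Banach_fixedpoint_thm[OF cK, of ?T \<rho>])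
    have "nrm B \<zero> = 0"
      by (simp add: nrm_eq_0_iff)
    then show "K \<noteq> {}"
      using \<rho>(1) by (auto simp: K_def)
    show "?T \<in> K \<rightarrow> K"
    proof
      fix y assume "y \<in> K"
      note y = KH[OF this]
      have "?T y \<in> H"
        using H_closed(2)[OF H_closed(7)[of "1/2"] H_closed(1)[OF a H_closed(2)[OF y(2) y(2)]]] ac y(1)
        by (simp add: smult_eq)
      moreover have "nrm B (?T y) \<le> \<rho>"
      proof -
        have "nrm B (y \<otimes> y) \<le> nrm B y * nrm B y"
          using y by (intro nrm_mult)
        also have "\<dots> \<le> \<rho>\<^sup>2"
          using y \<rho> nrm_nonneg[of y] by (simp add: power2_eq_square mult_mono)
        finally have "nrm B (a \<oplus> y \<otimes> y) \<le> nrm B a + \<rho>\<^sup>2"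
          using nrm_triangle[of a "y \<otimes> y"] y ac by simp
        then show ?thesis
          using \<rho>(3) y ac by (simp add: nrm_smult)
      qed
      ultimately show "?T y \<in> K"
        by (auto simp: K_def H_iff)
    qed
    show "\<rho> < 1"
      by fact
    fix y z assume "y \<in> K" "z \<in> K"
    note y = KH[OF \<open>y \<in> K\<close>] and z = KH[OF \<open>z \<in> K\<close>]
    have "?T y \<ominus> ?T z = sc (1/2) \<otimes> ((y \<oplus> z) \<otimes> (y \<ominus> z))"
    proof -
      have "?T y \<ominus> ?T z = sc (1/2) \<otimes> (a \<oplus> y \<otimes> y) \<ominus> sc (1/2) \<otimes> (a \<oplus> z \<otimes> z)"
        using ac y(1) z(1) by (simp add: smult_eq)
      also have "\<dots> = sc (1/2) \<otimes> ((y \<oplus> z) \<otimes> (y \<ominus> z))"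
        using ac y(1) z(1) sc_closed[of "1/2"] by algebra
      finally show ?thesis .
    qed
    then have "nrm B (?T y \<ominus> ?T z) = nrm B ((y \<oplus> z) \<otimes> (y \<ominus> z)) / 2"
      using y(1) z(1) by (simp add: nrm_smult flip: smult_eq)
    also have "\<dots> \<le> nrm B (y \<oplus> z) * nrm B (y \<ominus> z) / 2"
      using y(1) z(1) by (simp add: nrm_mult)
    also have "\<dots> \<le> (2 * \<rho>) * nrm B (y \<ominus> z) / 2"
      using nrm_triangle[OF y(1) z(1)] y z nrm_nonneg[of "y \<ominus> z"]
      by (intro divide_right_mono mult_right_mono) auto
    finally show "nrm_dist B (?T y) (?T z) \<le> \<rho> * nrm_dist B y z"
      using y(1) z(1) ac by (simp add: nrm_dist)
  qed
  note yc = KH[OF y(1)]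
  have "y \<oplus> y = a \<oplus> y \<otimes> y"
  proof -
    have "y \<oplus> y = sc 2 \<otimes> y"
      using sc_add[of 1 1] yc(1) by (simp add: l_distr)
    also have "\<dots> = sc 2 \<otimes> (sc (1/2) \<otimes> (a \<oplus> y \<otimes> y))"
      using y(2) ac yc(1) by (simp add: smult_eq)
    also have "\<dots> = sc (2 * (1/2)) \<otimes> (a \<oplus> y \<otimes> y)"
      using ac yc(1) by (simp only: sc_mult) (simp add: m_assoc)
    finally show ?thesis
      using ac yc(1) by simp
  qed
  moreover have "(\<one> \<ominus> y) \<otimes> (\<one> \<ominus> y) = \<one> \<oplus> y \<otimes> y \<ominus> (y \<oplus> y)"
    using yc(1) one_closed by algebra
  moreover have "\<one> \<oplus> y \<otimes> y \<ominus> (a \<oplus> y \<otimes> y) = \<one> \<ominus> a"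
    using yc(1) ac one_closed by algebra
  ultimately have "\<one> \<ominus> a = (\<one> \<ominus> y) \<otimes> (\<one> \<ominus> y)"
    by simp
  then show thesis
    using yc by (intro that[of "\<one> \<ominus> y"]) auto
qed

text \<open>The left-hand side is \<open>u\<^sup>* u\<close> for \<open>u = f + \<i> g\<close>, so the C*-identity gives \<open>\<parallel>u\<parallel> = r\<close>, and \<open>f\<close> is the real part of \<open>u\<close>.\<close>

lemma nrm_le_if_sum_of_squares_eq:
  assumes f: "f \<in> H" and g: "g \<in> H" and eq: "f \<otimes> f \<oplus> g \<otimes> g = sc (of_real (r\<^sup>2))" and "0 \<le> r"
  shows "nrm B f \<le> r"
proof -
  have fc: "f \<in> carrier B" "star B f = f" and gc: "g \<in> carrier B" "star B g = g"
    using f g by (auto simp: H_iff)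
  define j where "j = sc \<i>"
  have j: "j \<in> carrier B" "j \<otimes> j = \<ominus> \<one>" "star B j = \<ominus> j"
    using sc_mult[of \<i> \<i>] sc_minus[of 1] by (auto simp: j_def star_sc sc_minus)
  define u where "u = f \<oplus> j \<otimes> g"
  have u: "u \<in> carrier B" "star B u = f \<ominus> j \<otimes> g"
    using fc gc j by (auto simp: u_def star_add star_mult m_comm l_minus r_minus minus_eq)
  have "star B u \<otimes> u = f \<otimes> f \<ominus> (j \<otimes> j) \<otimes> (g \<otimes> g)"
    unfolding u(2) unfolding u_def using fc(1) gc(1) j(1) by algebra
  also have "\<dots> = f \<otimes> f \<oplus> g \<otimes> g"
    unfolding j(2) using fc(1) gc(1) one_closed by algebra
  finally have "(nrm B u)\<^sup>2 = r\<^sup>2"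
    using cstar_identity[OF u(1)] eq by (simp add: norm_power)
  then have nu: "nrm B u = r"
    using \<open>0 \<le> r\<close> nrm_nonneg[OF u(1)] by (simp add: power2_eq_iff_nonneg)
  have "u \<oplus> star B u = f \<oplus> f"
    unfolding u(2) unfolding u_def using fc(1) gc(1) j(1) by algebra
  also have "\<dots> = 2 \<odot> f"
    using smult_l_distr[of 1 1 f] smult_one fc(1) by simp
  finally have "2 * nrm B f = nrm B (u \<oplus> star B u)"
    using fc(1) by (simp add: nrm_smult)
  also have "\<dots> \<le> 2 * r"
    using nrm_triangle[of u "star B u"] u(1) nu by (simp add: nrm_star star_closed)
  finally show ?thesis
    by simp
qed

end

section \<open>Sums of squares in place of positive elements\<close>

context comm_cstar_algebra
begin

text \<open>After division by \<open>t\<close> the element is the unit minus a hermitian element of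
  norm below 1, to which \<open>exists_sqrt_one_minus\<close> applies.\<close>

lemma scalar_minus_is_square:
  assumes f: "f \<in> H" and t: "nrm B f < t"
  obtains b where "b \<in> H" "sc (of_real t) \<ominus> f = b \<otimes> b"
proof -
  have fc: "f \<in> carrier B"
    using f by (simp add: H_iff)
  have "0 < t"
    using t nrm_nonneg[OF fc] by linarith
  define a where "a = sc (of_real (1 / t)) \<otimes> f"
  have a: "a \<in> H"
    unfolding a_def by (rule H_closed(2)[OF H_closed(7) f])
  then have ac: "a \<in> carrier B"
    by (simp add: H_iff)
  have "nrm B a < 1"
    unfolding a_def using fc t \<open>0 < t\<close> by (simp add: nrm_smult norm_divide flip: smult_eq)
  then obtain c where c: "c \<in> H" "\<one> \<ominus> a = c \<otimes> c"
    using exists_sqrt_one_minus[OF a] by blast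
  have cc: "c \<in> carrier B"
    using c by (simp add: H_iff)
  define q where "q = sc (of_real (sqrt t))"
  have q: "q \<in> carrier B" "q \<in> H" "q \<otimes> q = sc (of_real t)"
    using sc_mult[of "of_real (sqrt t)" "of_real (sqrt t)"] \<open>0 < t\<close>
    by (auto simp: q_def simp flip: of_real_mult)
  have "sc (of_real t) \<otimes> sc (of_real (1 / t)) = \<one>"
    unfolding sc_mult[symmetric] using \<open>0 < t\<close> by simp
  then have "sc (of_real t) \<otimes> a = f"
    unfolding a_def using fc by (simp only: m_assoc[symmetric] sc_closed l_one)
  then have "sc (of_real t) \<ominus> f = (q \<otimes> q) \<otimes> (\<one> \<ominus> a)"
    unfolding q(3) using ac sc_closed[of "of_real t"]
    by (simp add: minus_eq r_distr r_minus)
  also have "\<dots> = (q \<otimes> c) \<otimes> (q \<otimes> c)"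
    unfolding c(2) using q(1) cc by algebra
  finally show thesis
    using H_closed(2)[OF q(2) c(1)] that by blast
qed

text \<open>A positive cone available before any functional calculus and any character. By
  commutativity it is closed under products, which makes it the smallest preordering.\<close>

inductive_set sos :: "'b set" where
  square: "f \<in> H \<Longrightarrow> f \<otimes> f \<in> sos"
| add: "\<lbrakk>p \<in> sos; q \<in> sos\<rbrakk> \<Longrightarrow> p \<oplus> q \<in> sos"

lemma sos_H: "p \<in> sos \<Longrightarrow> p \<in> H"
  by (induction rule: sos.induct) auto

lemma sos_mult:
  assumes "p \<in> sos" "q \<in> sos"
  shows "p \<otimes> q \<in> sos"
proof -
  have sq: "(f \<otimes> f) \<otimes> q \<in> sos" if f: "f \<in> H" and q: "q \<in> sos" for f q
    using q
  proof (induction rule: sos.induct)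
    case (square g)
    have "(f \<otimes> f) \<otimes> (g \<otimes> g) = (f \<otimes> g) \<otimes> (f \<otimes> g)"
      using f square unfolding H_iff by (simp add: m_ac)
    then show ?case
      using sos.square[OF H_closed(2)[OF f square]] by simp
  next
    case (add p q)
    have "(f \<otimes> f) \<otimes> (p \<oplus> q) = (f \<otimes> f) \<otimes> p \<oplus> (f \<otimes> f) \<otimes> q"
      using f add.hyps[THEN sos_H] unfolding H_iff by (simp add: r_distr)
    then show ?case
      using sos.add[OF add.IH] by simp
  qed
  show ?thesis
    using assms(1)
  proof (induction rule: sos.induct)
    case (square f)
    then show ?case
      using sq assms(2) by blast
  next
    case (add p r)
    have "(p \<oplus> r) \<otimes> q = p \<otimes> q \<oplus> r \<otimes> q"
      using add.hyps[THEN sos_H] assms(2)[THEN sos_H] unfolding H_iff by (simp add: l_distr)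
    then show ?case
      using sos.add[OF add.IH] by simp
  qed
qed

lemma sos_sc: "0 \<le> r \<Longrightarrow> sc (of_real r) \<in> sos"
  using sos.square[OF H_closed(7)[of "sqrt r"]] sc_mult[of "of_real (sqrt r)" "of_real (sqrt r)"]
  by (simp flip: of_real_mult)

text \<open>A norm criterion for positivity that the triangle inequality makes additive. For a
  square, \<open>t\<^sup>2 - f\<^sup>2 = (t - f) (t + f)\<close> is a product of two squares, hence
  the square of some hermitian h; then \<open>h\<^sup>2 + f\<^sup>2 = t\<^sup>2\<close> bounds the
  norm of h by \<open>t\<close>.\<close>

lemma sos_nrm:
  assumes "p \<in> sos"
  shows "\<exists>t. nrm B (sc (of_real t) \<ominus> p) \<le> t"
  using assms
proof (induction rule: sos.induct)
  case (square f)
  have fc: "f \<in> carrier B"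
    using square by (simp add: H_iff)
  define t where "t = nrm B f + 1"
  have t: "0 \<le> t" "nrm B f < t" "nrm B (\<ominus> f) < t"
    using nrm_nonneg[OF fc] fc by (auto simp: t_def nrm_minus)
  obtain b where b: "b \<in> H" "sc (of_real t) \<ominus> f = b \<otimes> b"
    using scalar_minus_is_square[OF square t(2)] by blast
  obtain c where c: "c \<in> H" "sc (of_real t) \<ominus> (\<ominus> f) = c \<otimes> c"
    using scalar_minus_is_square[OF H_closed(3)[OF square] t(3)] by blast
  have bc: "b \<in> carrier B" "c \<in> carrier B"
    using b c by (auto simp: H_iff)
  have tt: "sc (of_real (t\<^sup>2)) = sc (of_real t) \<otimes> sc (of_real t)"
    by (simp add: power2_eq_square sc_mult)
  have "sc (of_real t) \<otimes> sc (of_real t) \<ominus> f \<otimes> f = (sc (of_real t) \<ominus> f) \<otimes> (sc (of_real t) \<ominus> (\<ominus> f))"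
    using fc sc_closed[of "of_real t"] by algebra
  also have "\<dots> = (b \<otimes> c) \<otimes> (b \<otimes> c)"
    unfolding b(2) c(2) using bc by algebra
  finally have eq: "sc (of_real (t\<^sup>2)) \<ominus> f \<otimes> f = (b \<otimes> c) \<otimes> (b \<otimes> c)"
    unfolding tt .
  have "(b \<otimes> c) \<otimes> (b \<otimes> c) \<oplus> f \<otimes> f = sc (of_real (t\<^sup>2))"
    unfolding eq[symmetric] using fc sc_closed[of "of_real (t\<^sup>2)"] by algebra
  then have "nrm B (b \<otimes> c) \<le> t"
    using nrm_le_if_sum_of_squares_eq[OF H_closed(2)[OF b(1) c(1)] square] t(1) by blast
  then have "nrm B (b \<otimes> c) * nrm B (b \<otimes> c) \<le> t * t"
    using bc t(1) nrm_nonneg[of "b \<otimes> c"] by (intro mult_mono) auto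
  moreover have "nrm B ((b \<otimes> c) \<otimes> (b \<otimes> c)) \<le> nrm B (b \<otimes> c) * nrm B (b \<otimes> c)"
    using bc by (intro nrm_mult) auto
  ultimately show ?case
    using eq by (intro exI[of _ "t\<^sup>2"]) (simp add: power2_eq_square)
next
  case (add p q)
  then obtain s t where st: "nrm B (sc (of_real s) \<ominus> p) \<le> s" "nrm B (sc (of_real t) \<ominus> q) \<le> t"
    by blast
  have pq: "p \<in> carrier B" "q \<in> carrier B"
    using add.hyps[THEN sos_H] by (auto simp: H_iff)
  have "sc (of_real (s + t)) \<ominus> (p \<oplus> q) = (sc (of_real s) \<oplus> sc (of_real t)) \<ominus> (p \<oplus> q)"
    by (simp add: sc_add)
  also have "\<dots> = (sc (of_real s) \<ominus> p) \<oplus> (sc (of_real t) \<ominus> q)"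
    using pq sc_closed[of "of_real s"] sc_closed[of "of_real t"] by algebra
  finally show ?case
    using nrm_triangle[of "sc (of_real s) \<ominus> p" "sc (of_real t) \<ominus> q"] pq st
    by (intro exI[of _ "s + t"]) simp
qed

text \<open>Write p + \<epsilon> as (t + \<epsilon>) - (t - p) with \<open>t\<close> from
  \<open>sos_nrm\<close>; since ||t - p|| <= t < t + \<epsilon>, this is a single square.\<close>

lemma sos_plus_scalar_is_square:
  assumes p: "p \<in> sos" and "0 < \<epsilon>"
  obtains b where "b \<in> H" "p \<oplus> sc (of_real \<epsilon>) = b \<otimes> b"
proof -
  have pc: "p \<in> H" "p \<in> carrier B"
    using p sos_H by (auto simp: H_iff)
  obtain t where t: "nrm B (sc (of_real t) \<ominus> p) \<le> t"
    using sos_nrm[OF p] by blast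
  have "nrm B (sc (of_real t) \<ominus> p) < t + \<epsilon>"
    using t \<open>0 < \<epsilon>\<close> by linarith
  then obtain b where b: "b \<in> H" "sc (of_real (t + \<epsilon>)) \<ominus> (sc (of_real t) \<ominus> p) = b \<otimes> b"
    using scalar_minus_is_square[OF H_closed(4)[OF H_closed(7) pc(1)]] by blast
  have "(sc (of_real t) \<oplus> sc (of_real \<epsilon>)) \<ominus> (sc (of_real t) \<ominus> p) = p \<oplus> sc (of_real \<epsilon>)"
    using pc(2) sc_closed[of "of_real t"] sc_closed[of "of_real \<epsilon>"] by algebra
  then show thesis
    using b that by (simp add: sc_add)
qed

text \<open>The criterion \<open>sos_nrm\<close> would give |t + 1| <= t. This is what makes the
  smallest preordering proper.\<close>

lemma minus_one_notin_sos: "sc (- 1) \<notin> sos"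
proof
  assume "sc (- 1) \<in> sos"
  then obtain t where "nrm B (sc (of_real t) \<ominus> sc (- 1)) \<le> t"
    using sos_nrm by blast
  then have "cmod (of_real t + 1) \<le> t"
    by (simp flip: sc_diff)
  moreover have "t + 1 \<le> cmod (of_real t + 1)"
    using complex_Re_le_cmod[of "of_real t + 1"] by simp
  ultimately show False
    by linarith
qed

text \<open>With R = r + \<epsilon>, both R - p and R + p are squares, say of a and b, so
  \<open>p\<^sup>2 + (a b)\<^sup>2 = R\<^sup>2\<close> and the C*-identity bounds the norm of p by
  R.\<close>

lemma nrm_le_if_sos:
  assumes p: "p \<in> sos" and rp: "sc (of_real r) \<ominus> p \<in> sos"
  shows "nrm B p \<le> r"
proof -
  have pc: "p \<in> H" "p \<in> carrier B"
    using p sos_H by (auto simp: H_iff)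
  have "p \<oplus> (sc (of_real r) \<ominus> p) = sc (of_real r)"
    using pc(2) sc_closed[of "of_real r"] by algebra
  then have rs: "sc (of_real r) \<in> sos"
    using sos.add[OF p rp] by simp
  \<comment> \<open>A negative scalar in \<open>sos\<close> could be rescaled to -1.\<close>
  have r0: "0 \<le> r"
  proof (rule ccontr)
    assume "\<not> 0 \<le> r"
    then have "sc (of_real (1 / - r)) \<in> sos"
      by (intro sos_sc) simp
    from sos_mult[OF rs this] have "sc (of_real (r * (1 / - r))) \<in> sos"
      by (simp only: of_real_mult sc_mult)
    moreover have "of_real (r * (1 / - r)) = (- 1 :: complex)"
      using \<open>\<not> 0 \<le> r\<close> by (simp add: field_simps)
    ultimately show False
      using minus_one_notin_sos by simp
  qed
  show ?thesis
  proof (rule field_le_epsilon)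
    fix \<epsilon> :: real assume "0 < \<epsilon>"
    define R where "R = sc (of_real r)"
    define E where "E = sc (of_real \<epsilon>)"
    have RE: "R \<in> carrier B" "E \<in> carrier B"
      by (auto simp: R_def E_def)
    obtain a where a: "a \<in> H" "(R \<ominus> p) \<oplus> E = a \<otimes> a"
      unfolding R_def E_def using sos_plus_scalar_is_square[OF rp \<open>0 < \<epsilon>\<close>] .
    obtain b where b: "b \<in> H" "(R \<oplus> p) \<oplus> E = b \<otimes> b"
      unfolding R_def E_def using sos_plus_scalar_is_square[OF sos.add[OF rs p] \<open>0 < \<epsilon>\<close>] .
    have ab: "a \<in> carrier B" "b \<in> carrier B"
      using a b by (auto simp: H_iff)
    have "p \<otimes> p \<oplus> (a \<otimes> b) \<otimes> (a \<otimes> b) = p \<otimes> p \<oplus> (a \<otimes> a) \<otimes> (b \<otimes> b)"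
      using ab pc(2) by algebra
    also have "\<dots> = (R \<oplus> E) \<otimes> (R \<oplus> E)"
      unfolding a(2)[symmetric] b(2)[symmetric] using pc(2) RE by algebra
    also have "\<dots> = sc (of_real ((r + \<epsilon>)\<^sup>2))"
      unfolding R_def E_def power2_eq_square of_real_mult of_real_add sc_mult sc_add ..
    finally show "nrm B p \<le> r + \<epsilon>"
      using nrm_le_if_sum_of_squares_eq[OF pc(1) H_closed(2)[OF a(1) b(1)]] r0 \<open>0 < \<epsilon>\<close> by simp
  qed
qed

end

section \<open>Characters from total preorderings\<close>

locale preordering = comm_cstar_algebra B
  for B :: "'b star_algebra" (structure) +
  fixes T :: "'b set"
  assumes T_H: "T \<subseteq> H" and sos_T: "sos \<subseteq> T"
    and T_add: "\<lbrakk>f \<in> T; g \<in> T\<rbrakk> \<Longrightarrow> f \<oplus> g \<in> T"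
    and T_mult: "\<lbrakk>f \<in> T; g \<in> T\<rbrakk> \<Longrightarrow> f \<otimes> g \<in> T"
begin

definition extend where "extend g = {a \<oplus> g \<otimes> b | a b. a \<in> T \<and> b \<in> T}"

lemma T_carrier: "f \<in> T \<Longrightarrow> f \<in> carrier B"
  using T_H by (auto simp: H_iff)

lemma T_sc: "0 \<le> r \<Longrightarrow> sc (of_real r) \<in> T"
  using sos_sc sos_T by blast

lemma zero_one_T: "\<zero> \<in> T" "\<one> \<in> T"
  using T_sc[of 0] T_sc[of 1] by simp_all

text \<open>Elements linear in \<open>g\<close> suffice for the generated preordering, because the
  square of \<open>g\<close> already belongs to \<open>T\<close>.\<close>

lemma preordering_extend:
  assumes g: "g \<in> H"
  shows "preordering B (extend g)" "T \<subseteq> extend g" "g \<in> extend g"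
proof -
  have gc: "g \<in> carrier B"
    using g by (simp add: H_iff)
  show "T \<subseteq> extend g"
  proof
    fix a assume "a \<in> T"
    then show "a \<in> extend g"
      using zero_one_T(1) T_carrier[of a] gc unfolding extend_def
      by (intro CollectI exI[of _ a] exI[of _ \<zero>]) auto
  qed
  show "g \<in> extend g"
    using zero_one_T gc unfolding extend_def by (intro CollectI exI[of _ \<zero>] exI[of _ \<one>]) auto
  show "preordering B (extend g)"
  proof unfold_locales
    show "extend g \<subseteq> H"
      using T_H g unfolding extend_def by (auto intro!: H_closed)
    show "sos \<subseteq> extend g"
      using sos_T \<open>T \<subseteq> extend g\<close> by blast
    fix p q assume "p \<in> extend g" "q \<in> extend g"
    then obtain a b c d where p: "p = a \<oplus> g \<otimes> b" "a \<in> T" "b \<in> T" and q: "q = c \<oplus> g \<otimes> d" "c \<in> T" "d \<in> T"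
      unfolding extend_def by blast
    have abcd: "a \<in> carrier B" "b \<in> carrier B" "c \<in> carrier B" "d \<in> carrier B"
      using p q T_carrier by blast+
    have "p \<oplus> q = (a \<oplus> c) \<oplus> g \<otimes> (b \<oplus> d)"
      unfolding p q using abcd gc by algebra
    then show "p \<oplus> q \<in> extend g"
      unfolding extend_def using T_add[OF p(2) q(2)] T_add[OF p(3) q(3)] by blast
    have gg: "g \<otimes> g \<in> T"
      using sos.square[OF g] sos_T by blast
    have "p \<otimes> q = (a \<otimes> c \<oplus> (g \<otimes> g) \<otimes> (b \<otimes> d)) \<oplus> g \<otimes> (a \<otimes> d \<oplus> b \<otimes> c)"
      unfolding p q using abcd gc by algebra
    then show "p \<otimes> q \<in> extend g"
      unfolding extend_def
      using T_add[OF T_mult[OF p(2) q(2)] T_mult[OF gg T_mult[OF p(3) q(3)]]]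
        T_add[OF T_mult[OF p(2) q(3)] T_mult[OF p(3) q(2)]] by blast
  qed
qed

text \<open>The Artin-Schreier argument: from -1 = a + g b = c - g d one gets
  \<open>(1 + a) (1 + c) = - g\<^sup>2 b d\<close>, so
  \<open>-1 = a + c + a c + g\<^sup>2 b d\<close> would lie in \<open>T\<close>.\<close>

lemma extend_proper:
  assumes g: "g \<in> H" and proper: "sc (- 1) \<notin> T"
  shows "sc (- 1) \<notin> extend g \<or> sc (- 1) \<notin> extend (\<ominus> g)"
proof (rule ccontr)
  assume "\<not> ?thesis"
  then obtain a b c d where abcd: "a \<in> T" "b \<in> T" "c \<in> T" "d \<in> T"
    and ab: "\<ominus> \<one> = a \<oplus> g \<otimes> b" and cd: "\<ominus> \<one> = c \<oplus> \<ominus> g \<otimes> d"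
    unfolding extend_def by (auto simp: sc_minus)
  have gc: "g \<in> carrier B"
    using g by (simp add: H_iff)
  have cc: "a \<in> carrier B" "b \<in> carrier B" "c \<in> carrier B" "d \<in> carrier B"
    using abcd T_carrier by blast+
  have "\<one> \<oplus> a = \<ominus> (g \<otimes> b)"
  proof -
    have "\<one> \<oplus> a = \<one> \<oplus> (a \<oplus> g \<otimes> b) \<ominus> g \<otimes> b"
      using gc cc one_closed by algebra
    also have "\<dots> = \<one> \<oplus> \<ominus> \<one> \<ominus> g \<otimes> b"
      by (simp only: ab)
    also have "\<dots> = \<ominus> (g \<otimes> b)"
      using gc cc one_closed by algebra
    finally show ?thesis .
  qed
  moreover have "\<one> \<oplus> c = g \<otimes> d"
  proof -
    have "\<one> \<oplus> c = \<one> \<oplus> (c \<oplus> \<ominus> g \<otimes> d) \<oplus> g \<otimes> d"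
      using gc cc one_closed by algebra
    also have "\<dots> = \<one> \<oplus> \<ominus> \<one> \<oplus> g \<otimes> d"
      by (simp only: cd)
    also have "\<dots> = g \<otimes> d"
      using gc cc one_closed by algebra
    finally show ?thesis .
  qed
  ultimately have "(\<one> \<oplus> a) \<otimes> (\<one> \<oplus> c) = \<ominus> (g \<otimes> b) \<otimes> (g \<otimes> d)"
    by simp
  then have "\<ominus> \<one> = (a \<oplus> c) \<oplus> a \<otimes> c \<oplus> (g \<otimes> g) \<otimes> (b \<otimes> d)"
  proof -
    assume eq: "(\<one> \<oplus> a) \<otimes> (\<one> \<oplus> c) = \<ominus> (g \<otimes> b) \<otimes> (g \<otimes> d)"
    have "(a \<oplus> c) \<oplus> a \<otimes> c \<oplus> (g \<otimes> g) \<otimes> (b \<otimes> d) =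
        \<ominus> \<one> \<oplus> ((\<one> \<oplus> a) \<otimes> (\<one> \<oplus> c)) \<ominus> (\<ominus> (g \<otimes> b) \<otimes> (g \<otimes> d))"
      using gc cc one_closed by algebra
    also have "\<dots> = \<ominus> \<one> \<oplus> (\<ominus> (g \<otimes> b) \<otimes> (g \<otimes> d)) \<ominus> (\<ominus> (g \<otimes> b) \<otimes> (g \<otimes> d))"
      by (simp only: eq)
    also have "\<dots> = \<ominus> \<one>"
      using gc cc one_closed by algebra
    finally show ?thesis
      by (rule sym)
  qed
  moreover have "(a \<oplus> c) \<oplus> a \<otimes> c \<oplus> (g \<otimes> g) \<otimes> (b \<otimes> d) \<in> T"
    using T_add[OF T_add[OF T_add[OF abcd(1,3)] T_mult[OF abcd(1,3)]] T_mult[OF _ T_mult[OF abcd(2,4)]]]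
      sos.square[OF g] sos_T by blast
  ultimately show False
    using proper by (simp add: sc_minus)
qed

end

context comm_cstar_algebra
begin

lemma preordering_sos: "preordering B sos"
  by unfold_locales (auto intro: sos_H sos.add sos_mult)

text \<open>Zorn's lemma applies because any two elements of the union of a chain lie in one member.
  Maximality then absorbs whichever of the extensions by f and by -f remains proper.\<close>

lemma exists_total_preordering:
  assumes "preordering B T" "sc (- 1) \<notin> T"
  obtains M where "preordering B M" "T \<subseteq> M" "sc (- 1) \<notin> M" "\<And>f. f \<in> H \<Longrightarrow> f \<in> M \<or> \<ominus> f \<in> M"
proof -
  let ?P = "{S. preordering B S \<and> T \<subseteq> S \<and> sc (- 1) \<notin> S}"
  have "\<exists>M\<in>?P. \<forall>S\<in>?P. M \<subseteq> S \<longrightarrow> S = M"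
  proof (rule subset_Zorn_nonempty)
    show "?P \<noteq> {}"
      using assms by blast
    fix \<C> assume \<C>: "\<C> \<noteq> {}" "subset.chain ?P \<C>"
    have mem: "preordering B S" "T \<subseteq> S" "sc (- 1) \<notin> S" if "S \<in> \<C>" for S
      using \<C>(2) that by (auto simp: subset.chain_def)
    have common: "\<exists>S\<in>\<C>. f \<in> S \<and> g \<in> S" if fg: "f \<in> \<Union>\<C>" "g \<in> \<Union>\<C>" for f g
    proof -
      obtain S S' where S: "S \<in> \<C>" "f \<in> S" "S' \<in> \<C>" "g \<in> S'"
        using fg by blast
      then have "S \<subseteq> S' \<or> S' \<subseteq> S"
        using \<C>(2) by (meson subset_chain_def)
      then show ?thesis
        using S by blast
    qed
    have "preordering B (\<Union>\<C>)"
    proof unfold_locales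
      show "\<Union>\<C> \<subseteq> H"
        using preordering.T_H[OF mem(1)] by blast
      show "sos \<subseteq> \<Union>\<C>"
        using preordering.sos_T[OF mem(1)] \<C>(1) by blast
      fix f g assume fg: "f \<in> \<Union>\<C>" "g \<in> \<Union>\<C>"
      obtain S where S: "S \<in> \<C>" "f \<in> S" "g \<in> S"
        using common[OF fg] by blast
      have "f \<oplus> g \<in> S" "f \<otimes> g \<in> S"
        using preordering.T_add[OF mem(1)[OF S(1)] S(2,3)] preordering.T_mult[OF mem(1)[OF S(1)] S(2,3)] .
      then show "f \<oplus> g \<in> \<Union>\<C>" "f \<otimes> g \<in> \<Union>\<C>"
        using S(1) by blast+
    qed
    then show "\<Union>\<C> \<in> ?P"
      using mem(2,3) \<C>(1) by blast
  qed
  then obtain M where MP: "M \<in> ?P" and max': "\<forall>S\<in>?P. M \<subseteq> S \<longrightarrow> S = M" ..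
  from MP have M: "preordering B M" "T \<subseteq> M" "sc (- 1) \<notin> M"
    by simp_all
  have max: "S = M" if "preordering B S" "T \<subseteq> S" "sc (- 1) \<notin> S" "M \<subseteq> S" for S
    using max' that by simp
  interpret M: preordering B M
    by (rule M(1))
  have *: "f \<in> M" if "f \<in> H" "sc (- 1) \<notin> M.extend f" for f
  proof -
    have "M.extend f = M"
      using M.preordering_extend(1,2)[OF that(1)] M(2) that(2) by (intro max) auto
    then show ?thesis
      using M.preordering_extend(3)[OF that(1)] by simp
  qed
  have "f \<in> M \<or> \<ominus> f \<in> M" if "f \<in> H" for f
    using M.extend_proper[OF that M(3)] *[OF that] *[OF H_closed(3)[OF that]] by blast
  then show thesis
    using that M by blast
qed

end

text \<open>A total preordering is the set of hermitian elements that are nonnegative at one character; the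
  Dedekind cuts \<open>upper\<close> and \<open>lower\<close> recover the values of that character.\<close>

locale total_preordering = preordering +
  assumes proper: "sc (- 1) \<notin> T" and total: "f \<in> H \<Longrightarrow> f \<in> T \<or> \<ominus> f \<in> T"
begin

definition upper where "upper f r \<longleftrightarrow> sc (of_real r) \<ominus> f \<in> T"
definition lower where "lower f r \<longleftrightarrow> f \<ominus> sc (of_real r) \<in> T"

lemma HcI: "f \<in> H \<Longrightarrow> f \<in> carrier B"
  by (simp add: H_iff)

lemma T_scD:
  assumes "sc (of_real r) \<in> T"
  shows "0 \<le> r"
proof (rule ccontr)
  assume "\<not> 0 \<le> r"
  then have "sc (of_real (1 / - r)) \<in> T"
    by (intro T_sc) simp
  from T_mult[OF assms this] have "sc (of_real (r * (1 / - r))) \<in> T"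
    by (simp only: of_real_mult sc_mult)
  moreover have "of_real (r * (1 / - r)) = (- 1 :: complex)"
    using \<open>\<not> 0 \<le> r\<close> by (simp add: field_simps)
  ultimately show False
    using proper by simp
qed

lemma upper_or_lower: "f \<in> H \<Longrightarrow> upper f r \<or> lower f r"
proof -
  assume f: "f \<in> H"
  have "\<ominus> (sc (of_real r) \<ominus> f) = f \<ominus> sc (of_real r)"
    using HcI[OF f] sc_closed[of "of_real r"] by algebra
  then show ?thesis
    using total[OF H_closed(4)[OF H_closed(7)[of r] f]] by (auto simp: upper_def lower_def)
qed

lemma lower_le_upper:
  assumes f: "f \<in> H" and "lower f r" "upper f s"
  shows "r \<le> s"
proof -
  have "(f \<ominus> sc (of_real r)) \<oplus> (sc (of_real s) \<ominus> f) = sc (of_real s) \<ominus> sc (of_real r)"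
    using HcI[OF f] sc_closed[of "of_real r"] sc_closed[of "of_real s"] by algebra
  also have "\<dots> = sc (of_real (s - r))"
    by (simp add: sc_diff)
  finally show ?thesis
    using T_add[OF assms(2,3)[unfolded upper_def lower_def]] T_scD[of "s - r"] by simp
qed

text \<open>Both t - f and t + f are squares. This makes the cuts nonempty and bounded, so that
  their infimum is meaningful.\<close>

lemma upper_nrm:
  assumes f: "f \<in> H" and "nrm B f < t"
  shows "upper f t" "lower f (- t)"
proof -
  have *: "sc (of_real t) \<ominus> g \<in> T" if "g \<in> H" "nrm B g < t" for g
  proof -
    obtain b where "b \<in> H" "sc (of_real t) \<ominus> g = b \<otimes> b"
      using scalar_minus_is_square[OF \<open>g \<in> H\<close> \<open>nrm B g < t\<close>] .
    then show ?thesis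
      using sos.square[of b] sos_T by auto
  qed
  show "upper f t"
    unfolding upper_def by (rule *[OF assms])
  have "f \<ominus> sc (of_real (- t)) = sc (of_real t) \<ominus> (\<ominus> f)"
    using HcI[OF f] sc_closed[of "of_real t"] unfolding of_real_minus sc_minus by algebra
  then show "lower f (- t)"
    unfolding lower_def using *[OF H_closed(3)[OF f]] assms HcI[OF f] by (simp add: nrm_minus)
qed

lemma upper_mono:
  assumes f: "f \<in> H" and "upper f r" "r \<le> s"
  shows "upper f s"
proof -
  have "sc (of_real s) \<ominus> f = (sc (of_real r) \<ominus> f) \<oplus> (sc (of_real s) \<ominus> sc (of_real r))"
    using HcI[OF f] sc_closed[of "of_real r"] sc_closed[of "of_real s"] by algebra
  moreover have "sc (of_real s) \<ominus> sc (of_real r) \<in> T"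
    using T_sc[of "s - r"] assms(3) by (simp add: sc_diff)
  ultimately show ?thesis
    using T_add assms(2) unfolding upper_def by simp
qed

lemma upper_add:
  assumes "f \<in> H" "g \<in> H" "upper f r" "upper g s"
  shows "upper (f \<oplus> g) (r + s)"
proof -
  have "sc (of_real (r + s)) \<ominus> (f \<oplus> g) = (sc (of_real r) \<ominus> f) \<oplus> (sc (of_real s) \<ominus> g)"
    using assms(1,2)[THEN HcI] sc_closed[of "of_real r"] sc_closed[of "of_real s"]
    unfolding of_real_add sc_add by algebra
  then show ?thesis
    using T_add assms(3,4) unfolding upper_def by simp
qed

lemma upper_minus_iff: "f \<in> H \<Longrightarrow> upper (\<ominus> f) r \<longleftrightarrow> lower f (- r)"
proof -
  assume f: "f \<in> H"
  have "sc (of_real r) \<ominus> (\<ominus> f) = f \<ominus> sc (of_real (- r))"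
    using HcI[OF f] sc_closed[of "of_real r"] unfolding of_real_minus sc_minus by algebra
  then show ?thesis
    by (simp add: upper_def lower_def)
qed

text \<open>\<open>r\<^sup>2 - f\<^sup>2 = (r - f) (f + r)\<close>: closure of \<open>T\<close>
  under products enters here and makes the functional \<open>state\<close> multiplicative in the
  end.\<close>

lemma upper_square:
  assumes f: "f \<in> H" and "upper f r" "lower f (- r)"
  shows "upper (f \<otimes> f) (r\<^sup>2)"
proof -
  have "sc (of_real (r\<^sup>2)) \<ominus> f \<otimes> f = (sc (of_real r) \<ominus> f) \<otimes> (f \<ominus> sc (of_real (- r)))"
    using HcI[OF f] sc_closed[of "of_real r"]
    unfolding power2_eq_square of_real_mult of_real_minus sc_minus sc_mult by algebra
  then show ?thesis
    using T_mult assms(2,3) unfolding upper_def lower_def by simp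
qed

definition state where "state f = Inf {r. upper f r}"

lemma state_upper:
  assumes f: "f \<in> H" and "state f < r"
  shows "upper f r"
proof -
  have "{r. upper f r} \<noteq> {}"
    using upper_nrm(1)[OF f, of "nrm B f + 1"] by auto
  then obtain s where "upper f s" "s < r"
    using cInf_lessD[of "{r. upper f r}" r] assms(2) unfolding state_def by blast
  then show ?thesis
    using upper_mono[OF f] by simp
qed

lemma state_le:
  assumes f: "f \<in> H" and "upper f r"
  shows "state f \<le> r"
proof -
  have "lower f (- (nrm B f + 1))"
    by (rule upper_nrm(2)[OF f]) simp
  then have "bdd_below {r. upper f r}"
    using lower_le_upper[OF f] by (intro bdd_belowI[of _ "- (nrm B f + 1)"]) blast
  then show ?thesis
    unfolding state_def using assms(2) by (intro cInf_lower) auto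
qed

lemma state_lower:
  assumes f: "f \<in> H" and "r < state f"
  shows "lower f r"
  using upper_or_lower[OF f, of r] state_le[OF f, of r] assms(2) by linarith

lemma state_ge:
  assumes f: "f \<in> H" and "lower f r"
  shows "r \<le> state f"
proof (rule ccontr)
  assume "\<not> r \<le> state f"
  then obtain s where "state f < s" "s < r"
    using dense[of "state f" r] by auto
  then show False
    using lower_le_upper[OF f assms(2) state_upper[OF f]] by fastforce
qed

text \<open>Adding upper bounds gives subadditivity. The reverse inequality is subadditivity for
  \<open>f \<oplus> g\<close> and \<open>\<ominus> g\<close>, with the bound on
  \<open>state (\<ominus> g)\<close> obtained from lower bounds.\<close>

lemma state_add:
  assumes f: "f \<in> H" and g: "g \<in> H"
  shows "state (f \<oplus> g) = state f + state g"
proof -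
  have le: "state (f \<oplus> g) \<le> state f + state g" if f: "f \<in> H" and g: "g \<in> H" for f g
  proof (rule field_le_epsilon)
    fix \<epsilon> :: real assume "0 < \<epsilon>"
    then have "upper (f \<oplus> g) ((state f + \<epsilon> / 2) + (state g + \<epsilon> / 2))"
      using f g by (intro upper_add state_upper) auto
    then show "state (f \<oplus> g) \<le> state f + state g + \<epsilon>"
      using state_le[OF H_closed(1)[OF f g]] by fastforce
  qed
  have minus: "state (\<ominus> f) \<le> - state f" if f: "f \<in> H" for f
  proof (rule field_le_epsilon)
    fix \<epsilon> :: real assume "0 < \<epsilon>"
    then have "upper (\<ominus> f) (- state f + \<epsilon>)"
      using f by (simp add: upper_minus_iff state_lower)
    then show "state (\<ominus> f) \<le> - state f + \<epsilon>"
      using state_le[OF H_closed(3)[OF f]] by blast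
  qed
  have "state f = state ((f \<oplus> g) \<oplus> \<ominus> g)"
    using f g by (simp add: H_iff a_assoc r_neg)
  also have "\<dots> \<le> state (f \<oplus> g) + - state g"
    using le[OF H_closed(1)[OF f g] H_closed(3)[OF g]] minus[OF g] by simp
  finally show ?thesis
    using le[OF f g] by simp
qed

lemma state_sc: "state (sc (of_real r)) = r"
proof (rule antisym)
  have "sc (of_real r) \<ominus> sc (of_real r) = sc (of_real 0)"
    by (simp flip: sc_diff)
  then have "upper (sc (of_real r)) r" "lower (sc (of_real r)) r"
    unfolding upper_def lower_def using T_sc[of 0] by simp_all
  then show "state (sc (of_real r)) \<le> r" "r \<le> state (sc (of_real r))"
    using state_le state_ge H_closed(7) by blast+
qed

lemma state_minus: "f \<in> H \<Longrightarrow> state (\<ominus> f) = - state f"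
  using state_add[of f "\<ominus> f"] state_sc[of 0] H_closed(3)[of f] by (simp add: H_iff r_neg)

text \<open>If \<open>f\<close> lies between \<open>- sqrt \<epsilon>\<close> and
  \<open>sqrt \<epsilon>\<close>, then its square lies between 0 and
  \<open>\<epsilon>\<close>.\<close>

lemma state_square_if_zero:
  assumes f: "f \<in> H" and "state f = 0"
  shows "state (f \<otimes> f) = 0"
proof (rule antisym)
  have ff: "f \<otimes> f \<in> H"
    by (rule H_closed(2)[OF f f])
  have "f \<otimes> f \<ominus> sc (of_real 0) = f \<otimes> f"
    using HcI[OF f] by (simp add: minus_eq)
  then have "lower (f \<otimes> f) 0"
    unfolding lower_def using sos.square[OF f] sos_T by auto
  then show "0 \<le> state (f \<otimes> f)"
    by (rule state_ge[OF ff])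
  show "state (f \<otimes> f) \<le> 0"
  proof (rule field_le_epsilon)
    fix \<epsilon> :: real assume "0 < \<epsilon>"
    then have "upper (f \<otimes> f) ((sqrt \<epsilon>)\<^sup>2)"
      using assms(2) by (intro upper_square[OF f] state_upper[OF f] state_lower[OF f]) auto
    then show "state (f \<otimes> f) \<le> 0 + \<epsilon>"
      using state_le[OF ff, of \<epsilon>] \<open>0 < \<epsilon>\<close> by simp
  qed
qed

lemma state_scale_nonneg:
  assumes f: "f \<in> H" and c: "0 < c"
  shows "state (sc (of_real c) \<otimes> f) \<le> c * state f"
proof -
  have cf: "sc (of_real c) \<otimes> f \<in> H"
    by (rule H_closed(2)[OF H_closed(7) f])
  have up: "upper (sc (of_real c) \<otimes> f) (c * r)" if "upper f r" for r
  proof -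
    have "sc (of_real (c * r)) \<ominus> sc (of_real c) \<otimes> f = sc (of_real c) \<otimes> (sc (of_real r) \<ominus> f)"
      using HcI[OF f] sc_closed[of "of_real r"] sc_closed[of "of_real c"]
      unfolding of_real_mult sc_mult by algebra
    then show ?thesis
      unfolding upper_def using T_mult[OF T_sc[of c]] c that[unfolded upper_def] by simp
  qed
  have "state (sc (of_real c) \<otimes> f) / c \<le> state f"
  proof (rule dense_ge)
    fix r assume "state f < r"
    from state_le[OF cf up[OF state_upper[OF f this]]]
    show "state (sc (of_real c) \<otimes> f) / c \<le> r"
      using c by (simp add: pos_divide_le_eq mult.commute)
  qed
  then show ?thesis
    using c by (simp add: field_simps)
qed

lemma state_scale:
  assumes f: "f \<in> H"
  shows "state (sc (of_real c) \<otimes> f) = c * state f"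
proof -
  have pos: "state (sc (of_real c) \<otimes> f) = c * state f" if c: "0 < c" for c
  proof (rule antisym)
    show "state (sc (of_real c) \<otimes> f) \<le> c * state f"
      using state_scale_nonneg[OF f c] .
    have "\<ominus> (sc (of_real c) \<otimes> f) = sc (of_real c) \<otimes> \<ominus> f"
      using HcI[OF f] by (simp add: r_minus)
    then have "- state (sc (of_real c) \<otimes> f) = state (sc (of_real c) \<otimes> \<ominus> f)"
      using state_minus[OF H_closed(2)[OF H_closed(7)[of c] f]] by simp
    then show "c * state f \<le> state (sc (of_real c) \<otimes> f)"
      using state_scale_nonneg[OF H_closed(3)[OF f] c] state_minus[OF f] by simp
  qed
  consider "0 < c" | "c = 0" | "0 < - c"
    by linarith
  then show ?thesis
  proof cases
    case 2
    then show ?thesis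
      using HcI[OF f] state_sc[of 0] by simp
  next
    case 3
    have "sc (of_real c) \<otimes> f = \<ominus> (sc (of_real (- c)) \<otimes> f)"
      using HcI[OF f] by (simp add: sc_minus l_minus)
    then show ?thesis
      using pos[OF 3] state_minus[OF H_closed(2)[OF H_closed(7)[of "- c"] f]] by simp
  qed (rule pos)
qed

text \<open>The difference of \<open>f\<close> and its own value has value 0, so its square has
  value 0; expanding that square by linearity gives the claim.\<close>

lemma state_square:
  assumes f: "f \<in> H"
  shows "state (f \<otimes> f) = (state f)\<^sup>2"
proof -
  define c where "c = state f"
  define C where "C = sc (of_real c)"
  define g where "g = f \<oplus> \<ominus> C"
  have C: "C \<in> H" "C \<in> carrier B" "f \<in> carrier B"
    using f by (auto simp: C_def H_iff star_sc)
  have g: "g \<in> H"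
    unfolding g_def using f C by (intro H_closed)
  have "state g = 0"
    unfolding g_def using f C state_sc[of c] by (simp add: state_add state_minus H_closed(3)) (simp add: C_def c_def)
  then have "0 = state (g \<otimes> g)"
    using state_square_if_zero[OF g] by simp
  have two: "sc (of_real (- 2 * c)) = \<ominus> C \<oplus> \<ominus> C"
    using sc_add[of "- of_real c" "- of_real c"] by (simp add: sc_minus C_def)
  have cc: "sc (of_real (c * c)) = C \<otimes> C"
    by (simp add: C_def sc_mult)
  have "g \<otimes> g = f \<otimes> f \<oplus> (sc (of_real (- 2 * c)) \<otimes> f \<oplus> sc (of_real (c * c)))"
    unfolding g_def two cc using C(2,3) by algebra
  then have "state (g \<otimes> g) = state (f \<otimes> f) + (- 2 * c * state f + c * c)"
    using state_add[OF H_closed(2)[OF f f] H_closed(1)[OF H_closed(2)[OF H_closed(7) f] H_closed(7)], of "- 2 * c" "c * c"]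
      state_add[OF H_closed(2)[OF H_closed(7) f] H_closed(7), of "- 2 * c" "c * c"]
      state_scale[OF f, of "- 2 * c"] state_sc[of "c * c"] by simp
  then show ?thesis
    using \<open>0 = state (g \<otimes> g)\<close> by (simp add: c_def power2_eq_square)
qed

text \<open>Polarization of \<open>state_square\<close>, applied to the sum of \<open>f\<close> and
  \<open>g\<close>.\<close>

lemma state_mult:
  assumes f: "f \<in> H" and g: "g \<in> H"
  shows "state (f \<otimes> g) = state f * state g"
proof -
  have fg: "f \<otimes> g \<in> H" "f \<otimes> f \<in> H" "g \<otimes> g \<in> H"
    using f g by auto
  have "(f \<oplus> g) \<otimes> (f \<oplus> g) = (f \<otimes> f \<oplus> g \<otimes> g) \<oplus> (f \<otimes> g \<oplus> f \<otimes> g)"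
    using HcI[OF f] HcI[OF g] by algebra
  then have "state ((f \<oplus> g) \<otimes> (f \<oplus> g)) = (state (f \<otimes> f) + state (g \<otimes> g)) + 2 * state (f \<otimes> g)"
    using state_add[OF H_closed(1)[OF fg(2,3)] H_closed(1)[OF fg(1,1)]] state_add[OF fg(2,3)] state_add[OF fg(1,1)]
    by simp
  then show ?thesis
    using state_square[OF f] state_square[OF g] state_square[OF H_closed(1)[OF f g]] state_add[OF f g]
    by (simp add: power2_eq_square algebra_simps)
qed

end

text \<open>Used to write the identities that define characters as zero sets of continuous functions
  of the functional.\<close>

lemma closedin_zeros:
  fixes h :: "'i \<Rightarrow> 'x \<Rightarrow> complex"
  assumes "\<And>i. i \<in> I \<Longrightarrow> continuous_map P euclidean (h i)"
  shows "closedin P {x \<in> topspace P. \<forall>i\<in>I. h i x = 0}"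
proof (cases "I = {}")
  case False
  have "closedin P {x \<in> topspace P. h i x \<in> {0}}" if "i \<in> I" for i
    using assms[OF that] by (rule closedin_continuous_map_preimage) simp
  then have "closedin P (\<Inter>i\<in>I. {x \<in> topspace P. h i x \<in> {0}})"
    using False by (intro closedin_INT) auto
  moreover have "(\<Inter>i\<in>I. {x \<in> topspace P. h i x \<in> {0}}) = {x \<in> topspace P. \<forall>i\<in>I. h i x = 0}"
    using False by auto
  ultimately show ?thesis
    by simp
qed auto

section \<open>Hermitian decomposition and extension of the state to a character\<close>

context comm_cstar_algebra
begin

definition re :: "'b \<Rightarrow> 'b" where "re f = sc (1/2) \<otimes> (f \<oplus> star B f)"
definition im :: "'b \<Rightarrow> 'b" where "im f = sc (- \<i>/2) \<otimes> (f \<ominus> star B f)"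

lemma re_im_H:
  assumes f: "f \<in> carrier B"
  shows "re f \<in> H" "im f \<in> H"
proof -
  have sf: "star B f \<in> carrier B"
    using f by (rule star_closed)
  have "star B (re f) = re f"
    using f sf by (simp add: re_def star_mult star_add star_star star_sc m_comm a_comm)
  then show "re f \<in> H"
    using f sf by (simp add: H_iff re_def)
  have "star B (im f) = (star B f \<ominus> f) \<otimes> sc (- (- \<i> / 2))"
    using f sf by (simp add: im_def star_mult star_add star_minus star_star star_sc minus_eq)
  also have "\<dots> = (star B f \<ominus> f) \<otimes> \<ominus> sc (- \<i> / 2)"
    by (simp only: sc_minus)
  also have "\<dots> = im f"
    unfolding im_def using f sf sc_closed[of "- \<i> / 2"] by algebra
  finally show "im f \<in> H"
    using f sf by (simp add: H_iff im_def)
qed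

lemma re_im_eq:
  assumes f: "f \<in> carrier B"
  shows "f = re f \<oplus> sc \<i> \<otimes> im f"
proof -
  have sf: "star B f \<in> carrier B"
    using f by (rule star_closed)
  have "sc \<i> \<otimes> im f = (sc \<i> \<otimes> sc (- \<i>/2)) \<otimes> (f \<ominus> star B f)"
    unfolding im_def using f sf by (simp add: m_assoc)
  also have "sc \<i> \<otimes> sc (- \<i>/2) = sc (1/2)"
    unfolding sc_mult[symmetric] by simp
  finally have eq: "sc \<i> \<otimes> im f = sc (1/2) \<otimes> (f \<ominus> star B f)" .
  have "re f \<oplus> sc \<i> \<otimes> im f = (sc (1/2) \<oplus> sc (1/2)) \<otimes> f"
    unfolding eq re_def using f sf sc_closed[of "1/2"] by algebra
  also have "sc (1/2) \<oplus> sc (1/2) = \<one>"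
    unfolding sc_add[symmetric] by simp
  finally show ?thesis
    using f by simp
qed

lemma re_im_unique:
  assumes a: "a \<in> H" and b: "b \<in> H"
  shows "re (a \<oplus> sc \<i> \<otimes> b) = a" "im (a \<oplus> sc \<i> \<otimes> b) = b"
proof -
  have ab: "a \<in> carrier B" "b \<in> carrier B" "star B a = a" "star B b = b"
    using a b by (auto simp: H_iff)
  define j where "j = sc \<i>"
  have j: "j \<in> carrier B"
    by (simp add: j_def)
  have st: "star B (a \<oplus> j \<otimes> b) = a \<oplus> (\<ominus> j) \<otimes> b"
    using ab by (simp add: j_def star_add star_mult star_sc sc_minus m_comm)
  have "re (a \<oplus> j \<otimes> b) = (sc (1/2) \<oplus> sc (1/2)) \<otimes> a"
    unfolding re_def st using ab(1,2) j sc_closed[of "1/2"] by algebra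
  also have "sc (1/2) \<oplus> sc (1/2) = \<one>"
    unfolding sc_add[symmetric] by simp
  finally show "re (a \<oplus> sc \<i> \<otimes> b) = a"
    using ab by (simp add: j_def)
  have "im (a \<oplus> j \<otimes> b) = (sc (- \<i>/2) \<otimes> j \<oplus> sc (- \<i>/2) \<otimes> j) \<otimes> b"
    unfolding im_def st using ab(1,2) j sc_closed[of "- \<i>/2"] by algebra
  also have "sc (- \<i>/2) \<otimes> j \<oplus> sc (- \<i>/2) \<otimes> j = \<one>"
    unfolding j_def sc_add[symmetric] sc_mult[symmetric] by simp
  finally show "im (a \<oplus> sc \<i> \<otimes> b) = b"
    using ab by (simp add: j_def)
qed

end

context total_preordering
begin

definition character where
  "character = (\<lambda>f\<in>carrier B. complex_of_real (state (re f)) + \<i> * complex_of_real (state (im f)))"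

lemma character_eq:
  assumes "a \<in> H" "b \<in> H"
  shows "character (a \<oplus> sc \<i> \<otimes> b) = complex_of_real (state a) + \<i> * complex_of_real (state b)"
  using assms HcI by (simp add: character_def re_im_unique)

lemma character_add:
  assumes f: "f \<in> carrier B" and g: "g \<in> carrier B"
  shows "character (f \<oplus> g) = character f + character g"
proof -
  define a b c d where "a = re f" "b = im f" "c = re g" "d = im g"
  have h: "a \<in> H" "b \<in> H" "c \<in> H" "d \<in> H"
    using re_im_H f g by (auto simp: a_b_c_d_def)
  have fg: "f = a \<oplus> sc \<i> \<otimes> b" "g = c \<oplus> sc \<i> \<otimes> d"
    using re_im_eq f g by (auto simp: a_b_c_d_def)
  have "f \<oplus> g = (a \<oplus> c) \<oplus> sc \<i> \<otimes> (b \<oplus> d)"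
    unfolding fg using h[THEN HcI] sc_closed[of \<i>] by algebra
  then show ?thesis
    using character_eq[OF H_closed(1)[OF h(1,3)] H_closed(1)[OF h(2,4)]]
      character_eq[OF h(1,2)] character_eq[OF h(3,4)] state_add h fg
    by (simp add: algebra_simps)
qed

lemma character_mult:
  assumes f: "f \<in> carrier B" and g: "g \<in> carrier B"
  shows "character (f \<otimes> g) = character f * character g"
proof -
  define a b c d where "a = re f" "b = im f" "c = re g" "d = im g"
  have h: "a \<in> H" "b \<in> H" "c \<in> H" "d \<in> H"
    using re_im_H f g by (auto simp: a_b_c_d_def)
  have fg: "f = a \<oplus> sc \<i> \<otimes> b" "g = c \<oplus> sc \<i> \<otimes> d"
    using re_im_eq f g by (auto simp: a_b_c_d_def)
  have m: "a \<otimes> c \<in> H" "b \<otimes> d \<in> H" "a \<otimes> d \<in> H" "b \<otimes> c \<in> H" "\<ominus> (b \<otimes> d) \<in> H"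
    using h by auto
  have jj: "sc \<i> \<otimes> sc \<i> = \<ominus> \<one>"
    unfolding sc_mult[symmetric] by (simp add: sc_minus)
  have "f \<otimes> g = (a \<otimes> c \<oplus> (sc \<i> \<otimes> sc \<i>) \<otimes> (b \<otimes> d)) \<oplus> sc \<i> \<otimes> (a \<otimes> d \<oplus> b \<otimes> c)"
    unfolding fg using h[THEN HcI] sc_closed[of \<i>] by algebra
  also have "(sc \<i> \<otimes> sc \<i>) \<otimes> (b \<otimes> d) = \<ominus> (b \<otimes> d)"
    unfolding jj using h[THEN HcI] by (simp add: l_minus)
  finally have "character (f \<otimes> g) =
      complex_of_real (state (a \<otimes> c \<oplus> \<ominus> (b \<otimes> d))) + \<i> * complex_of_real (state (a \<otimes> d \<oplus> b \<otimes> c))"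
    using character_eq[OF H_closed(1)[OF m(1,5)] H_closed(1)[OF m(3,4)]] by simp
  also have "\<dots> = complex_of_real (state a * state c - state b * state d)
      + \<i> * complex_of_real (state a * state d + state b * state c)"
    using state_add[OF m(1,5)] state_add[OF m(3,4)] state_minus[OF m(2)] state_mult h by simp
  also have "\<dots> = (of_real (state a) + \<i> * of_real (state b)) * (of_real (state c) + \<i> * of_real (state d))"
    by (simp add: algebra_simps)
  finally show ?thesis
    using character_eq[OF h(1,2)] character_eq[OF h(3,4)] fg by simp
qed

lemma character_sc: "character (sc z) = z"
proof -
  have "sc z = sc (of_real (Re z)) \<oplus> sc \<i> \<otimes> sc (of_real (Im z))"
    unfolding sc_mult[symmetric] sc_add[symmetric] by (simp flip: complex_eq)
  then show ?thesis
    using character_eq[OF H_closed(7) H_closed(7), of "Re z" "Im z"] state_sc by (simp flip: complex_eq)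
qed

lemma character_in_characters: "character \<in> characters B"
proof -
  have "character (a \<odot> f) = a * character f" if "f \<in> carrier B" for a f
    using that by (simp add: smult_eq character_mult character_sc)
  moreover have "character \<one> \<noteq> 0"
    using character_sc[of 1] by simp
  ultimately show ?thesis
    unfolding characters_def using character_add character_mult
    by (auto simp: character_def)
qed

lemma character_H: "f \<in> H \<Longrightarrow> character f = of_real (state f)"
  using character_eq[of f \<zero>] state_sc[of 0] H_closed(6) HcI by simp

end

section \<open>Characters attain the norm, are contractive and respect the involution\<close>

context comm_cstar_algebra
begin

text \<open>The preordering generated by \<open>f - \<parallel>f\<parallel>\<close> is proper: \<open>- 1 = p + (f - \<parallel>f\<parallel>) q\<close> with sums of squares \<open>p\<close>, \<open>q\<close> would give
  \<open>f \<le> \<parallel>f\<parallel> - \<delta>\<close> with \<open>\<delta> = 1 / (2 t)\<close>, \<open>t > \<parallel>q\<parallel>\<close>.\<close>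

lemma exists_character_attaining_nrm:
  assumes f: "f \<in> sos"
  obtains x where "x \<in> characters B" "nrm B f \<le> Re (x f)"
proof -
  interpret sos: preordering B sos
    by (rule preordering_sos)
  define r where "r = nrm B f"
  define R where "R = sc (of_real r)"
  have fH: "f \<in> H" "f \<in> carrier B"
    using sos_H[OF f] by (auto simp: H_iff)
  have R: "R \<in> H" "R \<in> carrier B"
    by (auto simp: R_def)
  have g: "f \<ominus> R \<in> H"
    using fH R by auto
  have "sc (- 1) \<notin> sos.extend (f \<ominus> R)"
  proof
    assume "sc (- 1) \<in> sos.extend (f \<ominus> R)"
    then obtain p q where pq: "p \<in> sos" "q \<in> sos" and eq: "\<ominus> \<one> = p \<oplus> (f \<ominus> R) \<otimes> q"
      unfolding sos.extend_def by (auto simp: sc_minus)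
    have pqc: "p \<in> carrier B" "q \<in> carrier B" "q \<in> H"
      using pq[THEN sos_H] by (auto simp: H_iff)
    define t where "t = nrm B q + 1"
    define \<delta> where "\<delta> = 1 / (2 * t)"
    have t: "0 < t" "nrm B q < t" "0 < \<delta>" "nrm B f < r + \<delta>"
      using nrm_nonneg[OF pqc(2)] by (auto simp: t_def r_def \<delta>_def add_nonneg_pos)
    define s where "s = sc (of_real t)"
    define e where "e = sc (of_real \<delta>)"
    have se: "s \<in> carrier B" "e \<in> carrier B" "e \<in> sos"
      using t sos_sc[of \<delta>] by (auto simp: s_def e_def)
    obtain b where b: "b \<in> H" "s \<ominus> q = b \<otimes> b"
      using scalar_minus_is_square[OF pqc(3) t(2)] unfolding s_def .
    obtain c where c: "c \<in> H" "(R \<oplus> e) \<ominus> f = c \<otimes> c"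
      using scalar_minus_is_square[OF fH(1) t(4)] unfolding R_def e_def of_real_add sc_add .
    \<comment> \<open>In scalars, w = (t - q)(r + \<delta> - f) + \<delta> q + p = t (r - f) + t
      \<delta> + (p + (f - r) q). The last bracket is -1 and t \<delta> = 1/2, so w = t (r -
      \<delta> - f), while its first form shows it to be a sum of squares.\<close>
    define w where "w = (s \<ominus> q) \<otimes> ((R \<oplus> e) \<ominus> f) \<oplus> (e \<otimes> q \<oplus> p)"
    have "w \<in> sos"
      unfolding w_def b(2) c(2)
      using sos.add[OF sos_mult[OF sos.square[OF b(1)] sos.square[OF c(1)]] sos.add[OF sos_mult[OF se(3) pq(2)] pq(1)]] .
    then have "sc (of_real (1 / t)) \<otimes> w \<in> sos"
      using sos_mult[OF sos_sc, of "1 / t"] t(1) by simp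
    moreover have "w = s \<otimes> (R \<ominus> f) \<oplus> s \<otimes> e \<oplus> (p \<oplus> (f \<ominus> R) \<otimes> q)"
      unfolding w_def using pqc(1,2) se(1,2) R fH(2) by algebra
    then have "w = s \<otimes> (R \<ominus> f) \<oplus> s \<otimes> e \<oplus> \<ominus> \<one>"
      by (simp only: eq)
    moreover have "s \<otimes> e \<oplus> \<ominus> \<one> = \<ominus> (s \<otimes> e)"
    proof -
      have se2: "s \<otimes> e = sc (1/2)"
        unfolding s_def e_def sc_mult[symmetric] using t(1) by (simp add: \<delta>_def)
      show ?thesis
        unfolding se2 sc_minus[symmetric] sc_1[symmetric] sc_add[symmetric] by simp
    qed
    moreover have "sc (of_real (1 / t)) \<otimes> s = \<one>"
      unfolding s_def sc_mult[symmetric] using t(1) by simp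
    moreover have "sc (of_real (1 / t)) \<otimes> (s \<otimes> (R \<ominus> f) \<oplus> \<ominus> (s \<otimes> e)) =
        (sc (of_real (1 / t)) \<otimes> s) \<otimes> ((R \<ominus> e) \<ominus> f)"
      using se(1,2) R fH(2) sc_closed[of "of_real (1 / t)"] by algebra
    ultimately have "(R \<ominus> e) \<ominus> f \<in> sos"
      using se(1,2) R fH(2) by (simp add: a_assoc)
    then have "sc (of_real (r - \<delta>)) \<ominus> f \<in> sos"
      unfolding R_def e_def sc_diff[symmetric] by simp
    from nrm_le_if_sos[OF f this] show False
      using t by (simp add: r_def)
  qed
  then obtain M where M: "preordering B M" "sos.extend (f \<ominus> R) \<subseteq> M" "sc (- 1) \<notin> M"
    "\<And>f. f \<in> H \<Longrightarrow> f \<in> M \<or> \<ominus> f \<in> M"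
    using exists_total_preordering[OF sos.preordering_extend(1)[OF g]] by blast
  interpret preordering B M
    by (rule M(1))
  interpret total_preordering B M
    by unfold_locales (use M in auto)
  have "lower f r"
    unfolding lower_def using M(2) sos.preordering_extend(3)[OF g] R_def by blast
  then have "r \<le> state f"
    by (rule state_ge[OF fH(1)])
  then show thesis
    using that[OF character_in_characters] character_H[OF fH(1)] by (simp add: r_def)
qed

text \<open>With f = a + i b the product is the sum of the squares of a and b. Thus norm attainment,
  known for sums of squares, reaches arbitrary elements through the C*-identity.\<close>

lemma star_mult_self_sos:
  assumes f: "f \<in> carrier B"
  shows "star B f \<otimes> f \<in> sos"
proof -
  define a b where "a = re f" "b = im f"
  have h: "a \<in> H" "b \<in> H"
    using re_im_H f by (auto simp: a_b_def)
  then have hc: "a \<in> carrier B" "b \<in> carrier B" "star B a = a" "star B b = b"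
    by (auto simp: H_iff)
  have fe: "f = a \<oplus> sc \<i> \<otimes> b"
    using re_im_eq f by (auto simp: a_b_def)
  have st: "star B f = a \<oplus> \<ominus> sc \<i> \<otimes> b"
    unfolding fe using hc by (simp add: star_add star_mult star_sc sc_minus m_comm)
  have "star B f \<otimes> f = (a \<oplus> \<ominus> sc \<i> \<otimes> b) \<otimes> (a \<oplus> sc \<i> \<otimes> b)"
    by (rule arg_cong2[OF st fe])
  also have "\<dots> = a \<otimes> a \<ominus> (sc \<i> \<otimes> sc \<i>) \<otimes> (b \<otimes> b)"
    using hc(1,2) sc_closed[of \<i>] by algebra
  also have "sc \<i> \<otimes> sc \<i> = \<ominus> \<one>"
    unfolding sc_mult[symmetric] by (simp add: sc_minus)
  also have "a \<otimes> a \<ominus> \<ominus> \<one> \<otimes> (b \<otimes> b) = a \<otimes> a \<oplus> b \<otimes> b"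
    using hc(1,2) one_closed by algebra
  finally show ?thesis
    using sos.add[OF sos.square[OF h(1)] sos.square[OF h(2)]] by simp
qed

lemma characters_simps:
  assumes x: "x \<in> characters B"
  shows "\<lbrakk>f \<in> carrier B; g \<in> carrier B\<rbrakk> \<Longrightarrow> x (f \<oplus> g) = x f + x g"
    "\<lbrakk>f \<in> carrier B; g \<in> carrier B\<rbrakk> \<Longrightarrow> x (f \<otimes> g) = x f * x g"
    "f \<in> carrier B \<Longrightarrow> x (a \<odot> f) = a * x f"
    "x \<one> = 1" "x \<zero> = 0" "x (sc a) = a" "f \<in> carrier B \<Longrightarrow> x (\<ominus> f) = - x f"
    "\<lbrakk>f \<in> carrier B; g \<in> carrier B\<rbrakk> \<Longrightarrow> x (f \<ominus> g) = x f - x g"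
proof -
  show add: "x (f \<oplus> g) = x f + x g" and mult: "x (f \<otimes> g) = x f * x g"
    if "f \<in> carrier B" "g \<in> carrier B" for f g
    using x that unfolding characters_def by auto
  show smult: "x (a \<odot> f) = a * x f" if "f \<in> carrier B" for f a
    using x that unfolding characters_def by auto
  obtain h where h: "h \<in> carrier B" "x h \<noteq> 0"
    using x unfolding characters_def by auto
  show one: "x \<one> = 1"
    using mult[OF one_closed h(1)] h by simp
  show "x \<zero> = 0"
    using add[of \<zero> \<zero>] by simp
  show "x (sc a) = a"
    using smult[OF one_closed] one by (simp add: sc_def)
  show minus: "x (\<ominus> f) = - x f" if "f \<in> carrier B" for f
    using smult[OF that] that by (simp add: minus_eq_smult)
  show "x (f \<ominus> g) = x f - x g" if "f \<in> carrier B" "g \<in> carrier B"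
    using add[of f "\<ominus> g"] minus that by (simp add: minus_eq)
qed

lemma character_Units:
  assumes "x \<in> characters B" "u \<in> Units B"
  shows "x u \<noteq> 0" "x (inv u) = 1 / x u"
proof -
  have "x u * x (inv u) = 1"
    using characters_simps(2)[OF assms(1), of u "inv u"] assms Units_closed[of u] Units_inv_closed[of u]
      characters_simps(4)[OF assms(1)] Units_r_inv[of u] by simp
  moreover from this show "x u \<noteq> 0"
    by auto
  ultimately show "x (inv u) = 1 / x u"
    by (simp add: nonzero_eq_divide_eq mult.commute)
qed

text \<open>Otherwise f divided by its value has norm below 1, so its difference from the unit is
  invertible, yet the character maps that difference to 0.\<close>

lemma character_le_nrm:
  assumes x: "x \<in> characters B" and f: "f \<in> carrier B"
  shows "cmod (x f) \<le> nrm B f"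
proof (rule ccontr)
  assume less: "\<not> cmod (x f) \<le> nrm B f"
  then have xf: "x f \<noteq> 0"
    using nrm_nonneg[OF f] by auto
  have "nrm B ((1 / x f) \<odot> f) < 1"
    using less xf f by (simp add: nrm_smult norm_divide)
  then have "\<one> \<ominus> (1 / x f) \<odot> f \<in> Units B"
    using f by (intro one_minus_in_Units) auto
  from character_Units(1)[OF x this] show False
    using xf f x by (simp add: characters_simps)
qed

text \<open>Arens' argument: compare \<open>\<bar>x (f + \<i> t)\<bar>\<^sup>2\<close> with \<open>\<parallel>f + \<i> t\<parallel>\<^sup>2 \<le> \<parallel>f\<parallel>\<^sup>2 + t\<^sup>2\<close> for large real \<open>t\<close>.\<close>

lemma character_H_real:
  assumes x: "x \<in> characters B" and f: "f \<in> H"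
  shows "Im (x f) = 0"
proof (rule ccontr)
  assume ne: "Im (x f) \<noteq> 0"
  have fc: "f \<in> carrier B" "star B f = f"
    using f by (auto simp: H_iff)
  define N where "N = nrm B f"
  have bound: "2 * Im (x f) * t \<le> N\<^sup>2" for t :: real
  proof -
    define z where "z = sc (\<i> * of_real t)"
    define u where "u = f \<oplus> z"
    have z: "z \<in> carrier B" "star B z = \<ominus> z" "z \<otimes> z = \<ominus> sc (of_real (t\<^sup>2))"
    proof -
      show "star B z = \<ominus> z"
        unfolding z_def star_sc sc_minus[symmetric] by simp
      have "z \<otimes> z = sc (- of_real (t\<^sup>2))"
        unfolding z_def sc_mult[symmetric] by (rule arg_cong[of _ _ sc], rule complex_eqI) (auto simp: power2_eq_square)
      then show "z \<otimes> z = \<ominus> sc (of_real (t\<^sup>2))"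
        by (simp only: sc_minus)
    qed (simp add: z_def)
    have u: "u \<in> carrier B" "star B u = f \<ominus> z"
      using fc z by (auto simp: u_def star_add minus_eq)
    have "star B u \<otimes> u = f \<otimes> f \<ominus> z \<otimes> z"
      unfolding u(2) unfolding u_def using fc(1) z(1) by algebra
    also have "\<dots> = f \<otimes> f \<oplus> sc (of_real (t\<^sup>2))"
      unfolding z(3) using fc(1) by (simp add: minus_eq)
    finally have "(nrm B u)\<^sup>2 = nrm B (f \<otimes> f \<oplus> sc (of_real (t\<^sup>2)))"
      using cstar_identity[OF u(1)] by simp
    also have "\<dots> \<le> nrm B (f \<otimes> f) + nrm B (sc (of_real (t\<^sup>2)))"
      using fc by (intro nrm_triangle) auto
    also have "\<dots> \<le> N\<^sup>2 + t\<^sup>2"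
      using nrm_mult[OF fc(1) fc(1)] by (simp add: N_def power2_eq_square norm_mult)
    finally have "(nrm B u)\<^sup>2 \<le> N\<^sup>2 + t\<^sup>2" .
    moreover have "(cmod (x u))\<^sup>2 \<le> (nrm B u)\<^sup>2"
      using character_le_nrm[OF x u(1)] by (intro power_mono) auto
    moreover have "x u = x f + \<i> * of_real t"
      unfolding u_def z_def using characters_simps(1)[OF x fc(1) sc_closed] characters_simps(6)[OF x] by simp
    then have "(cmod (x u))\<^sup>2 = (Re (x f))\<^sup>2 + (Im (x f) + t)\<^sup>2"
      by (simp add: cmod_power2)
    ultimately have "(Re (x f))\<^sup>2 + (Im (x f) + t)\<^sup>2 \<le> N\<^sup>2 + t\<^sup>2"
      by linarith
    then have "(Re (x f))\<^sup>2 + (Im (x f))\<^sup>2 + 2 * Im (x f) * t \<le> N\<^sup>2"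
      by (simp add: power2_sum)
    then show ?thesis
      using zero_le_power2[of "Re (x f)"] zero_le_power2[of "Im (x f)"] by linarith
  qed
  have "2 * Im (x f) * ((N\<^sup>2 + 1) / (2 * Im (x f))) = N\<^sup>2 + 1"
    using ne by simp
  then show False
    using bound[of "(N\<^sup>2 + 1) / (2 * Im (x f))"] by linarith
qed

text \<open>Reality on hermitian elements, applied to the hermitian decomposition.\<close>

lemma character_star:
  assumes x: "x \<in> characters B" and f: "f \<in> carrier B"
  shows "x (star B f) = cnj (x f)"
proof -
  define a b where "a = re f" "b = im f"
  have h: "a \<in> H" "b \<in> H"
    using re_im_H f by (auto simp: a_b_def)
  then have hc: "a \<in> carrier B" "b \<in> carrier B" "star B a = a" "star B b = b"
    by (auto simp: H_iff)
  have fe: "f = a \<oplus> \<i> \<odot> b"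
    using re_im_eq f smult_eq[of b \<i>] hc by (auto simp: a_b_def)
  have "star B f = a \<oplus> (- \<i>) \<odot> b"
    unfolding fe using hc by (simp add: star_add star_smult)
  moreover have "cnj (x a) = x a" "cnj (x b) = x b"
    using character_H_real[OF x h(1)] character_H_real[OF x h(2)] by (simp_all add: complex_eq_iff)
  ultimately show ?thesis
    unfolding fe using x hc by (simp add: characters_simps)
qed

text \<open>A character attaining the norm of \<open>star B f \<otimes> f\<close> attains that of
  \<open>f\<close>, since both sides are squares.\<close>

lemma nrm_eq_SUP_characters:
  assumes f: "f \<in> carrier B"
  shows "nrm B f = (SUP x\<in>characters B. cmod (x f))" and "\<exists>x\<in>characters B. nrm B f \<le> cmod (x f)"
proof -
  obtain x where x: "x \<in> characters B" "nrm B (star B f \<otimes> f) \<le> Re (x (star B f \<otimes> f))"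
    using exists_character_attaining_nrm[OF star_mult_self_sos[OF f]] .
  have "x (star B f \<otimes> f) = cnj (x f) * x f"
    using x(1) f by (simp add: characters_simps star_closed character_star)
  also have "\<dots> = complex_of_real ((cmod (x f))\<^sup>2)"
    by (simp only: complex_norm_square mult.commute)
  finally have "Re (x (star B f \<otimes> f)) = (cmod (x f))\<^sup>2"
    by simp
  then have "(nrm B f)\<^sup>2 \<le> (cmod (x f))\<^sup>2"
    using x(2) cstar_identity[OF f] by simp
  then have le: "nrm B f \<le> cmod (x f)"
    by (rule power2_le_imp_le) simp
  then show "\<exists>x\<in>characters B. nrm B f \<le> cmod (x f)"
    using x(1) by blast
  have "bdd_above ((\<lambda>x. cmod (x f)) ` characters B)"
    using character_le_nrm[OF _ f] by (auto simp: bdd_above_def)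
  then have "cmod (x f) \<le> (SUP x\<in>characters B. cmod (x f))"
    using x(1) by (intro cSUP_upper)
  moreover have "(SUP x\<in>characters B. cmod (x f)) \<le> nrm B f"
    using x(1) character_le_nrm[OF _ f] by (intro cSUP_least) auto
  ultimately show "nrm B f = (SUP x\<in>characters B. cmod (x f))"
    using le by linarith
qed

lemma characters_nonempty: "characters B \<noteq> {}"
  using nrm_eq_SUP_characters(2)[OF one_closed] by blast

section \<open>The spectrum as a compact Hausdorff space\<close>

lemma topspace_spectrum: "topspace (spectrum_topology B) = characters B"
  by (auto simp: spectrum_topology_def characters_def PiE_def)

lemma Hausdorff_spectrum: "Hausdorff_space (spectrum_topology B)"
  unfolding spectrum_topology_def
  by (intro Hausdorff_space_subtopology) (simp add: Hausdorff_space_product_topology)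

lemma continuous_spectrum:
  "f \<in> carrier B \<Longrightarrow> continuous_map (spectrum_topology B) euclidean (\<lambda>x. x f)"
  unfolding spectrum_topology_def
  by (intro continuous_map_from_subtopology continuous_map_product_projection)

text \<open>By contractivity the characters lie in a product of discs, compact by Tychonoff. Being
  non-zero is not a closed condition; for multiplicative functionals it is equivalent to taking the
  value 1 at the unit, which is closed.\<close>

lemma compact_spectrum: "compact_space (spectrum_topology B)"
proof -
  let ?P = "product_topology (\<lambda>_. euclidean :: complex topology) (carrier B)"
  have proj: "continuous_map ?P euclidean (\<lambda>x. x f)" if "f \<in> carrier B" for f
    using that by (rule continuous_map_product_projection)
  let ?K = "PiE (carrier B) (\<lambda>f. cball 0 (nrm B f))"
  have "compactin ?P ?K"
    by (subst compactin_PiE) auto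
  let ?Z = "{x \<in> topspace ?P. \<forall>(f, g)\<in>carrier B \<times> carrier B. x (f \<oplus> g) - (x f + x g) = 0} \<inter>
    {x \<in> topspace ?P. \<forall>(f, g)\<in>carrier B \<times> carrier B. x (f \<otimes> g) - x f * x g = 0} \<inter>
    {x \<in> topspace ?P. \<forall>(a, f)\<in>UNIV \<times> carrier B. x (a \<odot> f) - a * x f = 0} \<inter>
    {x \<in> topspace ?P. \<forall>f\<in>{\<one>}. x f - 1 = 0}"
  have "closedin ?P ?Z"
    unfolding case_prod_beta
    by (intro closedin_Int closedin_zeros continuous_map_diff continuous_map_add proj
        continuous_map_complex_mult) auto
  moreover have "?Z = characters B"
  proof
    show "characters B \<subseteq> ?Z"
    proof
      fix x assume x: "x \<in> characters B"
      then have "x \<one> = 1"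
        by (rule characters_simps(4))
      then show "x \<in> ?Z"
        using x by (simp add: characters_def PiE_def)
    qed
    show "?Z \<subseteq> characters B"
      unfolding characters_def by (auto simp: PiE_def intro!: bexI[of _ "\<one>"])
  qed
  ultimately have "closedin ?P (characters B)"
    by simp
  moreover have "characters B \<subseteq> ?K"
  proof
    fix x assume "x \<in> characters B"
    then show "x \<in> ?K"
      using character_le_nrm[of x] by (auto simp: PiE_def characters_def[of B])
  qed
  ultimately have "compactin ?P (characters B)"
    using \<open>compactin ?P ?K\<close> closed_compactin by blast
  then show ?thesis
    by (simp add: spectrum_topology_def compact_space_subtopology)
qed

end

sublocale comm_cstar_algebra \<subseteq> Spectrum: nonempty_compact "spectrum_topology B"
  by unfold_locales (auto simp: compact_spectrum topspace_spectrum characters_nonempty)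

section \<open>The Gelfand isomorphism\<close>

context comm_cstar_algebra
begin

lemma nrm_le_characters:
  "\<lbrakk>f \<in> carrier B; \<And>x. x \<in> characters B \<Longrightarrow> cmod (x f) \<le> c\<rbrakk> \<Longrightarrow> nrm B f \<le> c"
  using nrm_eq_SUP_characters(2) by (meson order_trans)

lemma characters_eqI:
  assumes f: "f \<in> carrier B" and g: "g \<in> carrier B" and eq: "\<And>x. x \<in> characters B \<Longrightarrow> x f = x g"
  shows "f = g"
proof -
  have "nrm B (f \<ominus> g) \<le> 0"
    using f g eq by (intro nrm_le_characters) (auto simp: characters_simps)
  then have "nrm_dist B f g = 0"
    using f g nrm_nonneg[of "f \<ominus> g"] by (simp add: nrm_dist)
  then show ?thesis
    using f g by simp
qed

lemma H_if_real:
  assumes f: "f \<in> carrier B" and real: "\<And>x. x \<in> characters B \<Longrightarrow> Im (x f) = 0"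
  shows "f \<in> H"
proof -
  have "star B f = f"
    using real by (intro characters_eqI star_closed f) (simp add: character_star f complex_eq_iff)
  then show ?thesis
    using f by (simp add: H_iff)
qed

lemma character_H_of_real: "\<lbrakk>x \<in> characters B; f \<in> H\<rbrakk> \<Longrightarrow> x f = of_real (Re (x f))"
  by (simp add: complex_eq_iff character_H_real)

text \<open>With t = ||f||, 1 + f = (1 + t)(1 - a) for a = (t - f) / (1 + t). Character values of f
  lie between 0 and t, so a has norm at most t / (1 + t) < 1.\<close>

lemma one_plus_in_Units:
  assumes f: "f \<in> H" and nonneg: "\<And>x. x \<in> characters B \<Longrightarrow> 0 \<le> Re (x f)"
  shows "\<one> \<oplus> f \<in> Units B"
proof -
  have fc: "f \<in> carrier B"
    using f by (simp add: H_iff)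
  define t where "t = nrm B f"
  have t: "0 \<le> t"
    using nrm_nonneg[OF fc] by (simp add: t_def)
  define s where "s = sc (of_real (1 / (1 + t)))"
  define a where "a = s \<otimes> (sc (of_real t) \<ominus> f)"
  have s: "s \<in> carrier B" "sc (of_real (1 + t)) \<otimes> s = \<one>"
    unfolding s_def sc_mult[symmetric] using t by (auto simp flip: of_real_mult of_real_add)
  have ac: "a \<in> carrier B"
    using s fc by (simp add: a_def)
  have "cmod (x a) \<le> t / (1 + t)" if x: "x \<in> characters B" for x
  proof -
    have "Re (x f) \<le> t"
      using complex_Re_le_cmod[of "x f"] character_le_nrm[OF x fc] by (simp add: t_def)
    moreover have "x a = of_real ((t - Re (x f)) / (1 + t))"
      using character_H_of_real[OF x f] characters_simps[OF x] fc s(1) by (simp add: a_def s_def)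
    then have "cmod (x a) = \<bar>(t - Re (x f)) / (1 + t)\<bar>"
      by (simp only: norm_of_real)
    ultimately show ?thesis
      using t nonneg[OF x] by (simp add: abs_of_nonneg divide_right_mono)
  qed
  then have "nrm B a \<le> t / (1 + t)"
    using ac by (rule nrm_le_characters[rotated])
  also have "\<dots> < 1"
    using t by simp
  finally have "\<one> \<ominus> a \<in> Units B"
    using ac by (intro one_minus_in_Units)
  moreover have "sc (of_real (1 + t)) \<in> Units B"
    using s by (auto simp: Units_def m_comm)
  ultimately have "sc (of_real (1 + t)) \<otimes> (\<one> \<ominus> a) \<in> Units B"
    by blast
  moreover have "sc (of_real (1 + t)) \<otimes> (\<one> \<ominus> a) =
      sc (of_real (1 + t)) \<ominus> (sc (of_real (1 + t)) \<otimes> s) \<otimes> (sc (of_real t) \<ominus> f)"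
    unfolding a_def using fc s(1) sc_closed[of "of_real (1 + t)"] sc_closed[of "of_real t"] one_closed
    by algebra
  moreover have "\<dots> = \<one> \<oplus> f"
    unfolding s(2) unfolding of_real_add sc_add of_real_1 sc_1
    using fc sc_closed[of "of_real t"] one_closed by algebra
  ultimately show ?thesis
    by simp
qed

end

text \<open>The hypotheses on the cone rephrased through character values, with condition (iv) as a
  pointwise identity free of inverses. The locale is instantiated by the given cone and by all
  positive elements.\<close>

locale spectral_cone = comm_cstar_algebra B
  for B :: "'b star_algebra" (structure) +
  fixes C :: "'b set"
  assumes C_H: "C \<subseteq> H"
    and C_closed: "closedin (nrm_topology B) C"
    and C_add: "\<lbrakk>f \<in> C; g \<in> C\<rbrakk> \<Longrightarrow> f \<oplus> g \<in> C"
    and C_scale: "\<lbrakk>0 < a; f \<in> C\<rbrakk> \<Longrightarrow> complex_of_real a \<odot> f \<in> C"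
    and C_nonneg: "\<lbrakk>f \<in> C; x \<in> characters B\<rbrakk> \<Longrightarrow> 0 \<le> Re (x f)"
    and C_positive: "\<exists>p\<in>C. \<forall>x\<in>characters B. 0 < Re (x p)"
    and C_iv: "(\<forall>f\<in>C. \<exists>g\<in>C. \<forall>x\<in>characters B. Re (x g) = 2 * (Re (x f))\<^sup>2 / (1 + (Re (x f))\<^sup>2)) \<or>
      (\<forall>f\<in>C. \<exists>g\<in>C. \<forall>x\<in>characters B. Re (x g) = (2 * Re (x f) / (1 + Re (x f)))\<^sup>2)"
begin

text \<open>Agreement is required on characters only: the pointwise identities of
  \<open>C_iv\<close> say nothing about other arguments, while closure of the cone is stated for
  total functions.\<close>

definition real_functions :: "(('b \<Rightarrow> complex) \<Rightarrow> real) set" where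
  "real_functions = {u. \<exists>f\<in>C. \<forall>x\<in>characters B. u x = Re (x f)}"

lemma C_carrier: "f \<in> C \<Longrightarrow> f \<in> carrier B"
  using C_H by (auto simp: H_iff)

lemma real_functionsI: "\<lbrakk>f \<in> C; \<And>x. x \<in> characters B \<Longrightarrow> u x = Re (x f)\<rbrakk> \<Longrightarrow> u \<in> real_functions"
  by (auto simp: real_functions_def)

lemma continuous_Re: "f \<in> carrier B \<Longrightarrow> continuous_map (spectrum_topology B) euclideanreal (\<lambda>x. Re (x f))"
  using continuous_map_compose[OF continuous_spectrum, of f euclideanreal Re]
  by (simp add: o_def continuous_on_Re)

sublocale cone: steep_cone "spectrum_topology B" real_functions
proof -
  interpret cone: function_cone "spectrum_topology B" real_functions
  proof
    show "compact_space (spectrum_topology B)"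
      by (rule compact_spectrum)
    fix u assume "u \<in> real_functions"
    then obtain f where f: "f \<in> C" "\<forall>x\<in>characters B. u x = Re (x f)"
      by (auto simp: real_functions_def)
    show "continuous_map (spectrum_topology B) euclideanreal u"
      using f by (intro continuous_map_eq[OF continuous_Re[OF C_carrier[OF f(1)]]]) (simp add: topspace_spectrum)
    show "0 \<le> u x" if "x \<in> topspace (spectrum_topology B)" for x
      using that f C_nonneg by (simp add: topspace_spectrum)
    show "(\<lambda>x. a * u x) \<in> real_functions" if "0 < a" for a
    proof (rule real_functionsI[OF C_scale[OF that f(1)]])
      fix x assume x: "x \<in> characters B"
      show "a * u x = Re (x (complex_of_real a \<odot> f))"
        using f(2) x characters_simps(3)[OF x C_carrier[OF f(1)]] by simp
    qed
    fix v assume "v \<in> real_functions"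
    then obtain g where g: "g \<in> C" "\<forall>x\<in>characters B. v x = Re (x g)"
      by (auto simp: real_functions_def)
    show "(\<lambda>x. u x + v x) \<in> real_functions"
    proof (rule real_functionsI[OF C_add[OF f(1) g(1)]])
      fix x assume x: "x \<in> characters B"
      show "u x + v x = Re (x (f \<oplus> g))"
        using f(2) g(2) x characters_simps(1)[OF x C_carrier[OF f(1)] C_carrier[OF g(1)]] by simp
    qed
  next
    obtain p where "p \<in> C" "\<forall>x\<in>characters B. 0 < Re (x p)"
      using C_positive by blast
    then show "\<exists>p\<in>real_functions. \<forall>x\<in>topspace (spectrum_topology B). 0 < p x"
      by (intro bexI[of _ "\<lambda>x. Re (x p)"]) (auto simp: topspace_spectrum intro: real_functionsI)
  qed
  show "steep_cone (spectrum_topology B) real_functions"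
  proof (rule cone.steep_cone_if_condition_iv, use C_iv in \<open>elim disjE\<close>)
    assume iv: "\<forall>f\<in>C. \<exists>g\<in>C. \<forall>x\<in>characters B. Re (x g) = 2 * (Re (x f))\<^sup>2 / (1 + (Re (x f))\<^sup>2)"
    have "(\<lambda>x. 2 * (u x)\<^sup>2 / (1 + (u x)\<^sup>2)) \<in> real_functions" if u: "u \<in> real_functions" for u
    proof -
      obtain f where f: "f \<in> C" "\<forall>x\<in>characters B. u x = Re (x f)"
        using u by (auto simp: real_functions_def)
      obtain g where "g \<in> C" "\<forall>x\<in>characters B. Re (x g) = 2 * (Re (x f))\<^sup>2 / (1 + (Re (x f))\<^sup>2)"
        using iv f(1) by blast
      with f show ?thesis
        by (intro real_functionsI[of g]) auto
    qed
    then show "(\<forall>f\<in>real_functions. (\<lambda>x. 2 * (f x)\<^sup>2 / (1 + (f x)\<^sup>2)) \<in> real_functions) \<or>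
        (\<forall>f\<in>real_functions. (\<lambda>x. (2 * f x / (1 + f x))\<^sup>2) \<in> real_functions)"
      by blast
  next
    assume iv: "\<forall>f\<in>C. \<exists>g\<in>C. \<forall>x\<in>characters B. Re (x g) = (2 * Re (x f) / (1 + Re (x f)))\<^sup>2"
    have "(\<lambda>x. (2 * u x / (1 + u x))\<^sup>2) \<in> real_functions" if u: "u \<in> real_functions" for u
    proof -
      obtain f where f: "f \<in> C" "\<forall>x\<in>characters B. u x = Re (x f)"
        using u by (auto simp: real_functions_def)
      obtain g where "g \<in> C" "\<forall>x\<in>characters B. Re (x g) = (2 * Re (x f) / (1 + Re (x f)))\<^sup>2"
        using iv f(1) by blast
      with f show ?thesis
        by (intro real_functionsI[of g]) auto
    qed
    then show "(\<forall>f\<in>real_functions. (\<lambda>x. 2 * (f x)\<^sup>2 / (1 + (f x)\<^sup>2)) \<in> real_functions) \<or>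
        (\<forall>f\<in>real_functions. (\<lambda>x. (2 * f x / (1 + f x))\<^sup>2) \<in> real_functions)"
      by blast
  qed
qed

text \<open>Uniform approximants from \<open>C\<close> are Cauchy in norm because the norm is the
  supremum over the characters; completeness gives a limit, and closedness keeps it in
  \<open>C\<close>.\<close>

theorem represents_isotone:
  fixes h :: "('b \<Rightarrow> complex) \<Rightarrow> real"
  assumes h: "continuous_map (spectrum_topology B) euclideanreal h"
    "\<And>x. x \<in> characters B \<Longrightarrow> 0 \<le> h x"
    and mono: "\<And>x y. \<lbrakk>x \<in> characters B; y \<in> characters B; \<forall>f\<in>C. Re (x f) \<le> Re (y f)\<rbrakk> \<Longrightarrow> h x \<le> h y"
  obtains f where "f \<in> C" "\<And>x. x \<in> characters B \<Longrightarrow> x f = of_real (h x)"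
proof -
  have approx: "\<exists>f\<in>C. \<forall>x\<in>characters B. \<bar>Re (x f) - h x\<bar> \<le> \<epsilon>" if "0 < \<epsilon>" for \<epsilon>
  proof -
    have "\<exists>u\<in>real_functions. \<forall>x\<in>topspace (spectrum_topology B). \<bar>u x - h x\<bar> \<le> \<epsilon>"
    proof (rule cone.approximates_isotone)
      show "h x \<le> h y" if "x \<in> topspace (spectrum_topology B)" "y \<in> topspace (spectrum_topology B)"
        "\<forall>u\<in>real_functions. u x \<le> u y" for x y
        using that by (intro mono) (auto simp: topspace_spectrum intro: real_functionsI)
    qed (use h \<open>0 < \<epsilon>\<close> in \<open>auto simp: topspace_spectrum\<close>)
    then obtain u f where "f \<in> C" "\<forall>x\<in>characters B. u x = Re (x f)" "\<forall>x\<in>characters B. \<bar>u x - h x\<bar> \<le> \<epsilon>"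
      by (auto simp: topspace_spectrum real_functions_def)
    then show ?thesis
      by (intro bexI[of _ f]) auto
  qed
  have "\<forall>n::nat. \<exists>f. f \<in> C \<and> (\<forall>x\<in>characters B. \<bar>Re (x f) - h x\<bar> \<le> 1 / Suc n)"
    using approx by (auto simp: Bex_def)
  then obtain \<sigma> where \<sigma>: "\<And>n::nat. \<sigma> n \<in> C" "\<And>n x. x \<in> characters B \<Longrightarrow> \<bar>Re (x (\<sigma> n)) - h x\<bar> \<le> 1 / Suc n"
    by metis
  have \<sigma>c: "\<sigma> n \<in> carrier B" "\<sigma> n \<in> H" for n
    using \<sigma>(1) C_carrier C_H by auto
  have dist: "nrm B (\<sigma> m \<ominus> \<sigma> n) \<le> 1 / Suc m + 1 / Suc n" for m n
  proof (rule nrm_le_characters)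
    fix x assume x: "x \<in> characters B"
    have "x (\<sigma> m \<ominus> \<sigma> n) = of_real (Re (x (\<sigma> m)) - Re (x (\<sigma> n)))"
      using character_H_of_real[OF x \<sigma>c(2)[of m]] character_H_of_real[OF x \<sigma>c(2)[of n]]
        characters_simps(8)[OF x \<sigma>c(1)[of m] \<sigma>c(1)[of n]] by simp
    then have "cmod (x (\<sigma> m \<ominus> \<sigma> n)) = \<bar>Re (x (\<sigma> m)) - Re (x (\<sigma> n))\<bar>"
      by (simp only: norm_of_real)
    then show "cmod (x (\<sigma> m \<ominus> \<sigma> n)) \<le> 1 / Suc m + 1 / Suc n"
      using \<sigma>(2)[OF x, of m] \<sigma>(2)[OF x, of n] by linarith
  qed (use \<sigma>c in auto)
  have "Metric.MCauchy \<sigma>"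
    unfolding Metric.MCauchy_def
  proof (intro conjI allI impI)
    show "range \<sigma> \<subseteq> carrier B"
      using \<sigma>c by auto
    fix \<epsilon> :: real assume "0 < \<epsilon>"
    then obtain N where N: "1 / real (Suc N) < \<epsilon> / 2"
      using nat_approx_posE[of "\<epsilon> / 2"] by auto
    have "nrm_dist B (\<sigma> m) (\<sigma> n) < \<epsilon>" if "N \<le> m" "N \<le> n" for m n
    proof -
      have "1 / real (Suc m) \<le> 1 / real (Suc N)" "1 / real (Suc n) \<le> 1 / real (Suc N)"
        using that by (auto intro!: divide_left_mono)
      then show ?thesis
        using dist[of m n] N \<sigma>c by (simp only: nrm_dist)
    qed
    then show "\<exists>N. \<forall>m n. N \<le> m \<longrightarrow> N \<le> n \<longrightarrow> nrm_dist B (\<sigma> m) (\<sigma> n) < \<epsilon>"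
      by blast
  qed
  then obtain f where "limitin Metric.mtopology \<sigma> f sequentially"
    using complete unfolding Metric.mcomplete_def by blast
  then have f: "f \<in> carrier B" and lim: "\<And>\<epsilon>. 0 < \<epsilon> \<Longrightarrow> \<exists>N. \<forall>n\<ge>N. nrm_dist B (\<sigma> n) f < \<epsilon>"
    unfolding Metric.limit_metric_sequentially by blast+
  have "\<exists>g\<in>C. nrm B (f \<ominus> g) < \<epsilon>" if pos: "0 < \<epsilon>" for \<epsilon>
  proof -
    obtain N where "\<forall>n\<ge>N. nrm_dist B (\<sigma> n) f < \<epsilon>"
      using lim[OF pos] by blast
    then have "nrm_dist B f (\<sigma> N) < \<epsilon>"
      by (simp add: Metric.commute)
    then show ?thesis
      using \<sigma>(1)[of N] \<sigma>c(1)[of N] f by (auto simp: nrm_dist)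
  qed
  then have "f \<in> C"
    using C_closed C_carrier f by (subst (asm) nrm_closedin_iff) auto
  moreover have "x f = of_real (h x)" if x: "x \<in> characters B" for x
  proof -
    have "\<bar>Re (x f) - h x\<bar> \<le> \<epsilon>" if \<epsilon>: "0 < \<epsilon>" for \<epsilon>
    proof -
      obtain N where N: "\<forall>n\<ge>N. nrm_dist B (\<sigma> n) f < \<epsilon> / 2"
        using lim[of "\<epsilon> / 2"] \<epsilon> by auto
      obtain M where M: "1 / real (Suc M) < \<epsilon> / 2"
        using nat_approx_posE[of "\<epsilon> / 2"] \<epsilon> by auto
      define n where "n = max M N"
      have "cmod (x (\<sigma> n \<ominus> f)) < \<epsilon> / 2"
        using character_le_nrm[OF x, of "\<sigma> n \<ominus> f"] N[rule_format, of n] f \<sigma>c(1)[of n]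
        by (simp add: n_def nrm_dist)
      then have "\<bar>Re (x (\<sigma> n)) - Re (x f)\<bar> < \<epsilon> / 2"
        using abs_Re_le_cmod[of "x (\<sigma> n \<ominus> f)"] characters_simps(8)[OF x \<sigma>c(1)[of n] f] by simp
      moreover have "1 / real (Suc n) \<le> 1 / real (Suc M)"
        by (auto simp: n_def intro!: divide_left_mono)
      then have "\<bar>Re (x (\<sigma> n)) - h x\<bar> < \<epsilon> / 2"
        using \<sigma>(2)[OF x, of n] M by linarith
      ultimately show ?thesis
        by linarith
    qed
    then have "\<bar>Re (x f) - h x\<bar> \<le> 0"
      by (rule field_le_epsilon[where y = 0, simplified])
    then show ?thesis
      using character_H_of_real[OF x, of f] C_H \<open>f \<in> C\<close> by auto
  qed
  ultimately show thesis
    using that by blast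
qed

end

section \<open>Surjectivity of the Gelfand map\<close>

context comm_cstar_algebra
begin

definition positive_elements where
  "positive_elements = {f \<in> H. \<forall>x\<in>characters B. 0 \<le> Re (x f)}"

text \<open>Alternative (iv.2) is the one verified: 1 + f is invertible for positive f, and the
  square of 2f / (1 + f) again has nonnegative values.\<close>

lemma spectral_cone_positive_elements: "spectral_cone B positive_elements"
proof unfold_locales
  show H: "positive_elements \<subseteq> H"
    by (auto simp: positive_elements_def)
  have "f \<in> positive_elements"
    if f: "f \<in> carrier B" and lim: "\<forall>\<epsilon>>0. \<exists>g\<in>positive_elements. nrm B (f \<ominus> g) < \<epsilon>" for f
  proof -
    have "\<forall>\<epsilon>>0. \<exists>g\<in>H. nrm B (f \<ominus> g) < \<epsilon>"
      using lim H by blast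
    moreover have "H \<subseteq> carrier B"
      by (auto simp: H_iff)
    ultimately have "f \<in> H"
      using H_closedin f nrm_closedin_iff[of H] by blast
    moreover have "0 \<le> Re (x f)" if x: "x \<in> characters B" for x
    proof (rule ccontr)
      assume "\<not> 0 \<le> Re (x f)"
      then obtain g where g: "g \<in> positive_elements" "nrm B (f \<ominus> g) < - Re (x f)"
        using lim[rule_format, of "- Re (x f)"] by auto
      have gc: "g \<in> carrier B"
        using g H by (auto simp: H_iff)
      have "\<bar>Re (x f) - Re (x g)\<bar> \<le> nrm B (f \<ominus> g)"
        using abs_Re_le_cmod[of "x (f \<ominus> g)"] character_le_nrm[OF x, of "f \<ominus> g"]
          characters_simps(8)[OF x f gc] f gc by simp
      moreover have "0 \<le> Re (x g)"
        using g x by (auto simp: positive_elements_def)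
      ultimately show False
        using g(2) by linarith
    qed
    ultimately show ?thesis
      by (simp add: positive_elements_def)
  qed
  then show "closedin (nrm_topology B) positive_elements"
    using H by (subst nrm_closedin_iff) (auto simp: H_iff)
  show "f \<oplus> g \<in> positive_elements" if "f \<in> positive_elements" "g \<in> positive_elements" for f g
    using that by (auto simp: positive_elements_def characters_simps H_iff star_add)
  show "complex_of_real a \<odot> f \<in> positive_elements" if "0 < a" "f \<in> positive_elements" for a f
  proof -
    have "0 \<le> Re (x (complex_of_real a \<odot> f))" if x: "x \<in> characters B" for x
      using characters_simps(3)[OF x, of f] \<open>0 < a\<close> \<open>f \<in> positive_elements\<close> x
      by (simp add: positive_elements_def H_iff)
    then show ?thesis
      using that by (auto simp: positive_elements_def H_iff star_smult)
  qed
  show "0 \<le> Re (x f)" if "f \<in> positive_elements" "x \<in> characters B" for f x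
    using that by (auto simp: positive_elements_def)
  have "Re (x \<one>) = 1" if "x \<in> characters B" for x
    using characters_simps(4)[OF that] by simp
  then show "\<exists>p\<in>positive_elements. \<forall>x\<in>characters B. 0 < Re (x p)"
    by (intro bexI[of _ \<one>]) (auto simp: positive_elements_def)
  have "\<exists>g\<in>positive_elements. \<forall>x\<in>characters B. Re (x g) = (2 * Re (x f) / (1 + Re (x f)))\<^sup>2"
    if f: "f \<in> positive_elements" for f
  proof -
    have fH: "f \<in> H" "f \<in> carrier B" "\<And>x. x \<in> characters B \<Longrightarrow> 0 \<le> Re (x f)"
      using f by (auto simp: positive_elements_def H_iff)
    have U: "\<one> \<oplus> f \<in> Units B"
      using fH by (intro one_plus_in_Units)
    define k where "k = (2 \<odot> f) \<otimes> inv (\<one> \<oplus> f)"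
    have k: "k \<in> carrier B"
      using fH(2) U by (simp add: k_def)
    have xk: "Re (x (k \<otimes> k)) = (2 * Re (x f) / (1 + Re (x f)))\<^sup>2 \<and> Im (x (k \<otimes> k)) = 0"
      if x: "x \<in> characters B" for x
    proof -
      have "x k = 2 * x f / (1 + x f)"
        using characters_simps[OF x] character_Units[OF x U] fH(2) U by (simp add: k_def)
      also have "\<dots> = of_real (2 * Re (x f) / (1 + Re (x f)))"
        by (subst (1 2) character_H_of_real[OF x fH(1)]) simp
      finally have k_val: "x k = of_real (2 * Re (x f) / (1 + Re (x f)))" .
      have "x (k \<otimes> k) = of_real ((2 * Re (x f) / (1 + Re (x f)))\<^sup>2)"
        by (simp only: characters_simps(2)[OF x k k] k_val power2_eq_square of_real_mult)
      then show ?thesis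
        by (simp only: Re_complex_of_real Im_complex_of_real)
    qed
    have "k \<otimes> k \<in> H"
      using k xk by (intro H_if_real) auto
    then show ?thesis
      using xk by (intro bexI[of _ "k \<otimes> k"]) (auto simp: positive_elements_def)
  qed
  then show "(\<forall>f\<in>positive_elements. \<exists>g\<in>positive_elements. \<forall>x\<in>characters B. Re (x g) = 2 * (Re (x f))\<^sup>2 / (1 + (Re (x f))\<^sup>2)) \<or>
      (\<forall>f\<in>positive_elements. \<exists>g\<in>positive_elements. \<forall>x\<in>characters B. Re (x g) = (2 * Re (x f) / (1 + Re (x f)))\<^sup>2)"
    by blast
qed

lemma H_separates_characters:
  assumes x: "x \<in> characters B" and y: "y \<in> characters B" and eq: "\<And>f. f \<in> H \<Longrightarrow> x f = y f"
  shows "x = y"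
proof (rule extensionalityI[of _ "carrier B"])
  show "x \<in> extensional (carrier B)" "y \<in> extensional (carrier B)"
    using x y by (auto simp: characters_def)
  fix f assume f: "f \<in> carrier B"
  have h: "re f \<in> H" "im f \<in> H" "re f \<in> carrier B" "im f \<in> carrier B"
    using re_im_H[OF f] by (auto simp: H_iff)
  have dec: "z f = z (re f) + \<i> * z (im f)" if z: "z \<in> characters B" for z
  proof -
    have "z (re f \<oplus> sc \<i> \<otimes> im f) = z (re f) + \<i> * z (im f)"
      using characters_simps[OF z] h(3,4) by simp
    then show ?thesis
      using re_im_eq[OF f] by simp
  qed
  show "x f = y f"
    using dec[OF x] dec[OF y] eq[OF h(1)] eq[OF h(2)] by simp
qed

text \<open>The order given by the positive elements is equality: adding the norm of a hermitian
  element makes it positive, so x f <= y f for every hermitian f, and also for -f. Hence the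
  monotonicity hypothesis of \<open>represents_isotone\<close> is automatic.\<close>

lemma gelfand_surjective_nonneg:
  fixes h :: "('b \<Rightarrow> complex) \<Rightarrow> real"
  assumes h: "continuous_map (spectrum_topology B) euclideanreal h"
    "\<And>x. x \<in> characters B \<Longrightarrow> 0 \<le> h x"
  obtains f where "f \<in> H" "\<And>x. x \<in> characters B \<Longrightarrow> x f = of_real (h x)"
proof -
  interpret pos: spectral_cone B positive_elements
    by (rule spectral_cone_positive_elements)
  have "x = y" if x: "x \<in> characters B" and y: "y \<in> characters B"
    and le: "\<forall>f\<in>positive_elements. Re (x f) \<le> Re (y f)" for x y
  proof (rule H_separates_characters[OF x y])
    fix f assume f: "f \<in> H"
    have *: "Re (x f) \<le> Re (y f)" if f: "f \<in> H" for f
    proof -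
      define c where "c = sc (of_real (nrm B f))"
      have fc: "f \<in> carrier B" "c \<in> carrier B" "f \<oplus> c \<in> H"
        using f by (auto simp: H_iff c_def star_add star_sc)
      have val: "z (f \<oplus> c) = z f + of_real (nrm B f)" if z: "z \<in> characters B" for z
        unfolding c_def using characters_simps(1)[OF z fc(1) sc_closed] characters_simps(6)[OF z] by simp
      have "0 \<le> Re (z (f \<oplus> c))" if z: "z \<in> characters B" for z
        using val[OF z] character_le_nrm[OF z fc(1)] abs_Re_le_cmod[of "z f"] by simp
      then have "f \<oplus> c \<in> positive_elements"
        using fc by (auto simp: positive_elements_def)
      then show ?thesis
        using le val[OF x] val[OF y] by force
    qed
    have "Re (y f) \<le> Re (x f)"
      using *[OF H_closed(3)[OF f]] characters_simps(7)[OF x] characters_simps(7)[OF y] f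
      by (auto simp: H_iff)
    then show "x f = y f"
      using *[OF f] character_H_of_real[OF x f] character_H_of_real[OF y f] by simp
  qed
  then obtain f where "f \<in> positive_elements" "\<And>x. x \<in> characters B \<Longrightarrow> x f = of_real (h x)"
    using pos.represents_isotone[OF h] by (metis order_refl)
  then show thesis
    using that by (auto simp: positive_elements_def)
qed

lemma gelfand_surjective:
  fixes h :: "('b \<Rightarrow> complex) \<Rightarrow> complex"
  assumes h: "continuous_map (spectrum_topology B) euclidean h"
  obtains f where "f \<in> carrier B" "\<And>x. x \<in> characters B \<Longrightarrow> x f = h x"
proof -
  have real: "\<exists>f\<in>carrier B. \<forall>x\<in>characters B. x f = of_real (u x)"
    if u: "continuous_map (spectrum_topology B) euclideanreal u" for u
  proof -
    have "continuous_map (spectrum_topology B) euclideanreal (\<lambda>x. max 0 (u x))"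
      using u by (intro continuous_map_real_max) auto
    then obtain f where f: "f \<in> H" "\<And>x. x \<in> characters B \<Longrightarrow> x f = of_real (max 0 (u x))"
      using gelfand_surjective_nonneg[of "\<lambda>x. max 0 (u x)"] by auto
    have "continuous_map (spectrum_topology B) euclideanreal (\<lambda>x. max 0 (- u x))"
      using u by (intro continuous_map_real_max) auto
    then obtain g where g: "g \<in> H" "\<And>x. x \<in> characters B \<Longrightarrow> x g = of_real (max 0 (- u x))"
      using gelfand_surjective_nonneg[of "\<lambda>x. max 0 (- u x)"] by auto
    note fg = f g
    have "x (f \<ominus> g) = of_real (u x)" if "x \<in> characters B" for x
      using fg(1,3) fg(2)[OF that] fg(4)[OF that] characters_simps(8)[OF that, of f g] by (simp add: H_iff max_def)
    then show ?thesis
      using fg by (intro bexI[of _ "f \<ominus> g"]) (auto simp: H_iff)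
  qed
  have "continuous_map (spectrum_topology B) euclideanreal (\<lambda>x. Re (h x))"
    "continuous_map (spectrum_topology B) euclideanreal (\<lambda>x. Im (h x))"
    using continuous_map_compose[OF h, of euclideanreal Re] continuous_map_compose[OF h, of euclideanreal Im]
    by (simp_all add: o_def continuous_on_Re continuous_on_Im)
  then obtain f g where fg: "f \<in> carrier B" "\<forall>x\<in>characters B. x f = of_real (Re (h x))"
    "g \<in> carrier B" "\<forall>x\<in>characters B. x g = of_real (Im (h x))"
    using real by meson
  have "x (f \<oplus> \<i> \<odot> g) = h x" if x: "x \<in> characters B" for x
    using fg characters_simps(1)[OF x fg(1), of "\<i> \<odot> g"] characters_simps(3)[OF x fg(3), of \<i>] x
      complex_eq[of "h x"] by simp
  then show thesis
    using fg by (intro that[of "f \<oplus> \<i> \<odot> g"]) auto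
qed

lemma gelfand_map_in: "f \<in> carrier B \<Longrightarrow> gelfand_map B f \<in> carrier Spectrum.A"
  unfolding gelfand_map_def topspace_spectrum[symmetric]
  by (intro Spectrum.restrict_in_A continuous_spectrum)

theorem gelfand_iso: "gelfand_map B \<in> cstar_iso B (continuous_functions (spectrum_topology B))"
  unfolding cstar_iso_def ring_iso_def ring_hom_def
proof (intro CollectI conjI ballI allI impI)
  show "gelfand_map B \<in> carrier B \<rightarrow> carrier Spectrum.A"
    using gelfand_map_in by blast
  show "gelfand_map B \<one> = \<one>\<^bsub>Spectrum.A\<^esub>"
    by (auto simp: gelfand_map_def Spectrum.A_simps topspace_spectrum characters_simps)
  show "gelfand_map B (f \<otimes> g) = gelfand_map B f \<otimes>\<^bsub>Spectrum.A\<^esub> gelfand_map B g"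
    "gelfand_map B (f \<oplus> g) = gelfand_map B f \<oplus>\<^bsub>Spectrum.A\<^esub> gelfand_map B g"
    if "f \<in> carrier B \<and> g \<in> carrier B" for f g
    using that by (auto simp: gelfand_map_def Spectrum.A_simps topspace_spectrum characters_simps)
  fix f assume f: "f \<in> carrier B"
  show "gelfand_map B (a \<odot> f) = a \<odot>\<^bsub>Spectrum.A\<^esub> gelfand_map B f" for a
    unfolding gelfand_map_def Spectrum.A_simps topspace_spectrum
    using f by (intro restrict_ext) (simp add: characters_simps(3)[OF _ f])
  show "gelfand_map B (star B f) = star Spectrum.A (gelfand_map B f)"
    unfolding gelfand_map_def Spectrum.A_simps topspace_spectrum
    using f by (intro restrict_ext) (simp add: character_star)
  show "nrm Spectrum.A (gelfand_map B f) = nrm B f"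
    unfolding gelfand_map_def Spectrum.A_simps topspace_spectrum
    using f by (simp add: nrm_eq_SUP_characters(1))
next
  show "bij_betw (gelfand_map B) (carrier B) (carrier Spectrum.A)"
    unfolding bij_betw_def
  proof
    show "inj_on (gelfand_map B) (carrier B)"
    proof (rule inj_onI)
      fix f g assume fg: "f \<in> carrier B" "g \<in> carrier B" and eq: "gelfand_map B f = gelfand_map B g"
      have "x f = x g" if "x \<in> characters B" for x
        using fun_cong[OF eq, of x] that by (simp add: gelfand_map_def)
      then show "f = g"
        using fg by (intro characters_eqI)
    qed
    show "gelfand_map B ` carrier B = carrier Spectrum.A"
    proof (intro equalityI subsetI)
      fix h assume h: "h \<in> carrier Spectrum.A"
      then obtain f where "f \<in> carrier B" "\<And>x. x \<in> characters B \<Longrightarrow> x f = h x"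
        using gelfand_surjective[OF Spectrum.continuous_A[OF h]] by blast
      moreover from this have "gelfand_map B f = h"
        using h gelfand_map_in[of f] by (intro Spectrum.A_eqI) (auto simp: gelfand_map_def topspace_spectrum)
      ultimately show "h \<in> gelfand_map B ` carrier B"
        by blast
    qed (use gelfand_map_in in auto)
  qed
qed

end

section \<open>Characters of algebras of continuous functions\<close>

context nonempty_compact
begin

lemma continuous_Re_A: "f \<in> carrier A \<Longrightarrow> continuous_map X euclideanreal (\<lambda>x. Re (f x))"
  using continuous_map_compose[OF continuous_A, of f euclideanreal Re]
  by (simp add: o_def continuous_on_Re)

lemma of_real_in_A:
  assumes "continuous_map X euclideanreal u"
  shows "(\<lambda>x\<in>topspace X. complex_of_real (u x)) \<in> carrier A"
  using continuous_map_compose[OF assms, of euclidean complex_of_real]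
  by (intro restrict_in_A) (simp add: o_def)

lemma inv_A:
  assumes f: "f \<in> carrier A" and nz: "\<And>x. x \<in> topspace X \<Longrightarrow> f x \<noteq> 0"
  shows "f \<in> Units A" "x \<in> topspace X \<Longrightarrow> (inv\<^bsub>A\<^esub> f) x = 1 / f x"
proof -
  interpret cring A
    by (rule cring_A)
  have "continuous_map X euclidean (\<lambda>x. 1 / f x)"
    using continuous_A[OF f] nz by (simp add: continuous_map_atin tendsto_divide)
  then have g: "(\<lambda>x\<in>topspace X. 1 / f x) \<in> carrier A"
    by (rule restrict_in_A)
  have "f \<otimes>\<^bsub>A\<^esub> (\<lambda>x\<in>topspace X. 1 / f x) = \<one>\<^bsub>A\<^esub>"
    using nz by (auto simp: A_simps intro!: restrict_ext)
  moreover from this have "(\<lambda>x\<in>topspace X. 1 / f x) \<otimes>\<^bsub>A\<^esub> f = \<one>\<^bsub>A\<^esub>"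
    using m_comm[OF g f] by simp
  ultimately show "f \<in> Units A"
    using f g by (auto simp: Units_def)
  have "inv\<^bsub>A\<^esub> f = (\<lambda>x\<in>topspace X. 1 / f x)"
    using f g \<open>f \<otimes>\<^bsub>A\<^esub> (\<lambda>x\<in>topspace X. 1 / f x) = \<one>\<^bsub>A\<^esub>\<close> by (simp add: comm_inv_char)
  then show "x \<in> topspace X \<Longrightarrow> (inv\<^bsub>A\<^esub> f) x = 1 / f x"
    by simp
qed

lemma evaluation_in_characters:
  assumes x: "x \<in> topspace X"
  shows "evaluation X x \<in> characters A"
proof -
  have one: "\<one>\<^bsub>A\<^esub> \<in> carrier A"
    using A_closed(5) cring_A cring.cring_simprules(6) by blast
  moreover have "\<one>\<^bsub>A\<^esub> x = 1"
    using x by (simp add: A_simps)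
  ultimately have "\<exists>f\<in>carrier A. evaluation X x f \<noteq> 0"
    by (intro bexI[of _ "\<one>\<^bsub>A\<^esub>"]) (auto simp: evaluation_def)
  moreover have "evaluation X x (f \<oplus>\<^bsub>A\<^esub> g) = evaluation X x f + evaluation X x g"
    "evaluation X x (f \<otimes>\<^bsub>A\<^esub> g) = evaluation X x f * evaluation X x g"
    "evaluation X x (a \<odot>\<^bsub>A\<^esub> f) = a * evaluation X x f"
    if "f \<in> carrier A" "g \<in> carrier A" for f g a
    using A_closed(1-3)[OF that] that x by (simp_all add: evaluation_def) (simp_all add: A_simps)
  ultimately show ?thesis
    unfolding characters_def by (auto simp: evaluation_def)
qed

text \<open>If no point were a common zero of the kernel, finitely many \<open>|f|\<^sup>2\<close> with \<open>f\<close> in the kernel would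
  add up to an invertible element of the kernel.\<close>

lemma character_is_evaluation:
  assumes \<kappa>: "\<kappa> \<in> characters A"
  obtains x where "x \<in> topspace X" "\<kappa> = evaluation X x"
proof -
  interpret CX: comm_cstar_algebra A
    by (rule comm_cstar_algebra_A)
  have "\<exists>x\<in>topspace X. \<forall>f\<in>carrier A. \<kappa> f = 0 \<longrightarrow> f x = 0"
  proof (rule ccontr)
    assume "\<not> ?thesis"
    then have "\<forall>x\<in>topspace X. \<exists>f. f \<in> carrier A \<and> \<kappa> f = 0 \<and> f x \<noteq> 0"
      by blast
    then obtain F where F: "\<And>x. x \<in> topspace X \<Longrightarrow> F x \<in> carrier A" "\<And>x. x \<in> topspace X \<Longrightarrow> \<kappa> (F x) = 0"
      "\<And>x. x \<in> topspace X \<Longrightarrow> F x x \<noteq> 0"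
      by (auto simp: bchoice_iff)
    define U where "U x = {y \<in> topspace X. F x y \<in> - {0}}" for x
    have "openin X (U x)" if "x \<in> topspace X" for x
      unfolding U_def using continuous_A[OF F(1)[OF that]]
      by (rule openin_continuous_map_preimage) auto
    moreover have "topspace X \<subseteq> \<Union>(U ` topspace X)"
      using F(3) by (auto simp: U_def)
    moreover have "compactin X (topspace X)"
      using compact by (simp add: compact_space_def)
    ultimately obtain J where J: "finite J" "J \<subseteq> topspace X" "topspace X \<subseteq> \<Union>(U ` J)"
      using compactin_finite_subcover_image[of X "topspace X" "topspace X" U] by blast
    have "\<exists>g\<in>carrier A. \<kappa> g = 0 \<and> (\<forall>y\<in>topspace X. 0 \<le> Re (g y) \<and> (\<forall>j\<in>J. F j y \<noteq> 0 \<longrightarrow> 0 < Re (g y)))"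
      using J(1,2)
    proof (induction rule: finite_induct)
      case empty
      show ?case
        by (intro bexI[of _ "\<zero>\<^bsub>A\<^esub>"]) (auto simp: CX.characters_simps(5)[OF \<kappa>], simp add: A_simps)
    next
      case (insert j J)
      then obtain g where g: "g \<in> carrier A" "\<kappa> g = 0" "\<And>y. y \<in> topspace X \<Longrightarrow> 0 \<le> Re (g y)"
        "\<And>y i. \<lbrakk>y \<in> topspace X; i \<in> J; F i y \<noteq> 0\<rbrakk> \<Longrightarrow> 0 < Re (g y)"
        by auto
      have Fj: "F j \<in> carrier A" "\<kappa> (F j) = 0" "star A (F j) \<in> carrier A"
        using F insert.prems CX.star_closed by auto
      define k where "k = g \<oplus>\<^bsub>A\<^esub> (star A (F j) \<otimes>\<^bsub>A\<^esub> F j)"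
      have k: "k \<in> carrier A" "\<kappa> k = 0"
        using g(1,2) Fj CX.characters_simps[OF \<kappa>] by (auto simp: k_def)
      have val: "Re (k y) = Re (g y) + (cmod (F j y))\<^sup>2" if "y \<in> topspace X" for y
        using that by (simp add: k_def A_simps cmod_power2) (simp add: power2_eq_square)
      have "0 \<le> Re (k y) \<and> (\<forall>i\<in>insert j J. F i y \<noteq> 0 \<longrightarrow> 0 < Re (k y))" if y: "y \<in> topspace X" for y
        using val[OF y] g(3)[OF y] g(4)[OF y] by (auto intro: add_nonneg_pos add_pos_nonneg)
      then show ?case
        using k by blast
    qed
    then obtain g where g: "g \<in> carrier A" "\<kappa> g = 0"
      "\<And>y j. \<lbrakk>y \<in> topspace X; j \<in> J; F j y \<noteq> 0\<rbrakk> \<Longrightarrow> 0 < Re (g y)"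
      by blast
    have "g y \<noteq> 0" if y: "y \<in> topspace X" for y
    proof -
      obtain j where "j \<in> J" "F j y \<noteq> 0"
        using J(3) y by (auto simp: U_def)
      then show ?thesis
        using g(3)[OF y] by force
    qed
    then have "g \<in> Units A"
      by (rule inv_A(1)[OF g(1)])
    then show False
      using CX.character_Units(1)[OF \<kappa>] g(2) by blast
  qed
  then obtain x where x: "x \<in> topspace X" "\<And>f. \<lbrakk>f \<in> carrier A; \<kappa> f = 0\<rbrakk> \<Longrightarrow> f x = 0"
    by blast
  \<comment> \<open>The difference of \<open>f\<close> and the scalar \<open>\<kappa> f\<close> is
    in the kernel, hence vanishes at \<open>x\<close>.\<close>
  have "\<kappa> f = f x" if f: "f \<in> carrier A" for f
  proof -
    have "f \<ominus>\<^bsub>A\<^esub> CX.sc (\<kappa> f) \<in> carrier A" "\<kappa> (f \<ominus>\<^bsub>A\<^esub> CX.sc (\<kappa> f)) = 0"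
      using f CX.characters_simps(8)[OF \<kappa> f CX.sc_closed] CX.characters_simps(6)[OF \<kappa>] by auto
    then have "(f \<ominus>\<^bsub>A\<^esub> CX.sc (\<kappa> f)) x = 0"
      by (rule x(2))
    then show ?thesis
      using x(1) f CX.sc_closed[of "\<kappa> f"] by (simp add: A_minus CX.sc_def) (simp add: A_simps)
  qed
  moreover have "\<kappa> \<in> extensional (carrier A)"
    using \<kappa> by (simp add: characters_def)
  ultimately have "\<kappa> = evaluation X x"
    by (intro extensionalityI[of _ "carrier A"]) (auto simp: evaluation_def)
  then show thesis
    using x(1) that by blast
qed

end

section \<open>The cone of isotone functions\<close>

sublocale compact_ordered \<subseteq> nonempty_compact X
  by unfold_locales (fact compact nonempty)+

context compact_ordered
begin

abbreviation "K \<equiv> isotone_cone X R"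

definition isotone :: "('a \<Rightarrow> real) set" where
  "isotone = {u. continuous_map X euclideanreal u \<and> (\<forall>x\<in>topspace X. 0 \<le> u x) \<and>
    (\<forall>x\<in>topspace X. \<forall>y\<in>topspace X. (x, y) \<in> R \<longrightarrow> u x \<le> u y)}"

lemma K_eq: "K = (\<lambda>u. \<lambda>x\<in>topspace X. complex_of_real (u x)) ` isotone"
  by (simp add: isotone_cone_def isotone_def)

lemma K_iff:
  "f \<in> K \<longleftrightarrow> f \<in> carrier A \<and> (\<forall>x\<in>topspace X. Im (f x) = 0) \<and> (\<lambda>x. Re (f x)) \<in> isotone"
proof
  assume "f \<in> K"
  then obtain u where u: "u \<in> isotone" "f = (\<lambda>x\<in>topspace X. complex_of_real (u x))"
    by (auto simp: K_eq)
  then have "f \<in> carrier A"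
    by (simp add: isotone_def of_real_in_A)
  then show "f \<in> carrier A \<and> (\<forall>x\<in>topspace X. Im (f x) = 0) \<and> (\<lambda>x. Re (f x)) \<in> isotone"
    using u continuous_Re_A[of f] by (simp add: isotone_def)
next
  assume f: "f \<in> carrier A \<and> (\<forall>x\<in>topspace X. Im (f x) = 0) \<and> (\<lambda>x. Re (f x)) \<in> isotone"
  then have "f = (\<lambda>x\<in>topspace X. complex_of_real (Re (f x)))"
    using of_real_in_A[OF continuous_Re_A, of f] by (intro A_eqI) (auto simp: complex_eq_iff)
  then show "f \<in> K"
    using f unfolding K_eq by (intro image_eqI[of f _ "\<lambda>x. Re (f x)"]) simp_all
qed

lemma isotone_add: "\<lbrakk>u \<in> isotone; v \<in> isotone\<rbrakk> \<Longrightarrow> (\<lambda>x. u x + v x) \<in> isotone"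
  by (auto simp: isotone_def intro!: continuous_intros add_mono)

lemma isotone_scale: "\<lbrakk>u \<in> isotone; 0 \<le> a\<rbrakk> \<Longrightarrow> (\<lambda>x. a * u x) \<in> isotone"
  by (auto simp: isotone_def intro!: continuous_intros mult_left_mono)

lemma isotone_const: "0 \<le> a \<Longrightarrow> (\<lambda>x. a) \<in> isotone"
  by (auto simp: isotone_def)

lemma isotone_max_min:
  assumes "u \<in> isotone" "v \<in> isotone"
  shows "(\<lambda>x. max (u x) (v x)) \<in> isotone" "(\<lambda>x. min (u x) (v x)) \<in> isotone"
proof -
  have "continuous_map X euclideanreal (\<lambda>x. max (u x) (v x))" "continuous_map X euclideanreal (\<lambda>x. min (u x) (v x))"
    using assms by (auto simp: isotone_def intro: continuous_map_real_max continuous_map_real_min)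
  moreover have "max (u x) (v x) \<le> max (u y) (v y) \<and> min (u x) (v x) \<le> min (u y) (v y)"
    if "x \<in> topspace X" "y \<in> topspace X" "(x, y) \<in> R" for x y
  proof -
    have "u x \<le> u y" "v x \<le> v y"
      using assms that by (auto simp: isotone_def)
    then show ?thesis
      by (auto simp: le_max_iff_disj min_le_iff_disj)
  qed
  ultimately show "(\<lambda>x. max (u x) (v x)) \<in> isotone" "(\<lambda>x. min (u x) (v x)) \<in> isotone"
    using assms unfolding isotone_def by (simp_all add: le_max_iff_disj)
qed

text \<open>Nonnegativity is imposed so that these functions form a \<open>function_cone\<close>;
  other real functions are reached by adding a constant.\<close>

definition differences :: "('a \<Rightarrow> real) set" where
  "differences = {w. \<exists>u\<in>isotone. \<exists>v\<in>isotone. \<forall>x\<in>topspace X. w x = u x - v x \<and> 0 \<le> w x}"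

lemma differencesI:
  "\<lbrakk>u \<in> isotone; v \<in> isotone; \<And>x. x \<in> topspace X \<Longrightarrow> w x = u x - v x \<and> 0 \<le> w x\<rbrakk> \<Longrightarrow> w \<in> differences"
  unfolding differences_def by blast

text \<open>Steepness by truncation: the affine image \<open>k * (w x - s)\<close> is cut off to the
  unit interval. With isotone \<open>P\<close> and \<open>Q\<close> whose difference is this image,
  the cut-off is \<open>min (1 + Q) (max P Q) - Q\<close>, again a difference of isotone
  functions.\<close>

lemma steep_cone_differences: "steep_cone X differences"
proof
  show "compact_space X"
    by (rule compact)
  show "\<exists>p\<in>differences. \<forall>x\<in>topspace X. 0 < p x"
    using isotone_const[of 1] isotone_const[of 0]
    by (intro bexI[of _ "\<lambda>x. 1"] differencesI[of "\<lambda>x. 1" "\<lambda>x. 0"]) auto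
  fix w assume "w \<in> differences"
  then obtain u v where uv: "u \<in> isotone" "v \<in> isotone"
    and w: "\<And>x. x \<in> topspace X \<Longrightarrow> w x = u x - v x" "\<And>x. x \<in> topspace X \<Longrightarrow> 0 \<le> w x"
    unfolding differences_def by blast
  have "continuous_map X euclideanreal u" "continuous_map X euclideanreal v"
    using uv by (simp_all add: isotone_def)
  then have "continuous_map X euclideanreal (\<lambda>x. u x - v x)"
    by (rule continuous_map_diff)
  then show "continuous_map X euclideanreal w"
    by (rule continuous_map_eq) (simp add: w(1))
  show "0 \<le> w x" if "x \<in> topspace X" for x
    using w(2) that .
  show "(\<lambda>x. a * w x) \<in> differences" if "0 < a" for a
    using that uv w
    by (intro differencesI[of "\<lambda>x. a * u x" "\<lambda>x. a * v x"] isotone_scale) (auto simp: right_diff_distrib)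
  show "(\<lambda>x. w x + w' x) \<in> differences" if w': "w' \<in> differences" for w'
  proof -
    obtain u' v' where uv': "u' \<in> isotone" "v' \<in> isotone"
      and w': "\<And>x. x \<in> topspace X \<Longrightarrow> w' x = u' x - v' x" "\<And>x. x \<in> topspace X \<Longrightarrow> 0 \<le> w' x"
      using w' unfolding differences_def by blast
    show ?thesis
      using uv uv' w w' by (intro differencesI[of "\<lambda>x. u x + u' x" "\<lambda>x. v x + v' x"] isotone_add) auto
  qed
  fix \<epsilon> r :: real assume "0 < \<epsilon>" "r < 1"
  \<comment> \<open>Replacing \<open>r\<close> by a nonnegative threshold makes the constant
    \<open>k * s\<close> in \<open>Q\<close> nonnegative, as membership in \<open>isotone\<close>
    demands; \<open>k\<close> is the slope that leads from 0 at \<open>s\<close> to 1 at 1.\<close>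
  define s where "s = max r 0"
  define k where "k = 1 / (1 - s)"
  have s: "0 \<le> s" "s < 1" "r \<le> s"
    using \<open>r < 1\<close> by (auto simp: s_def)
  then have k: "0 < k" "k * (1 - s) = 1"
    by (auto simp: k_def)
  define P where "P x = k * u x" for x
  define Q where "Q x = k * v x + k * s" for x
  have PQ: "P \<in> isotone" "Q \<in> isotone"
    unfolding P_def Q_def using uv k s by (auto intro!: isotone_add isotone_scale isotone_const)
  have PQw: "P x - Q x = k * (w x - s)" if "x \<in> topspace X" for x
    unfolding P_def Q_def w(1)[OF that] by (simp add: algebra_simps)
  let ?g = "\<lambda>x. min (1 + Q x) (max (P x) (Q x)) - Q x"
  have "?g \<in> differences"
    using PQ by (intro differencesI[of "\<lambda>x. min (1 + Q x) (max (P x) (Q x))" Q] isotone_max_min isotone_add isotone_const) auto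
  moreover have "?g x \<le> 1 + \<epsilon>" for x
    using \<open>0 < \<epsilon>\<close> by simp
  moreover have "1 \<le> ?g x" if "x \<in> topspace X" "1 \<le> w x" for x
  proof -
    have "k * (1 - s) \<le> k * (w x - s)"
      using that k by (intro mult_left_mono) auto
    then show ?thesis
      using PQw[OF that(1)] k by simp
  qed
  moreover have "?g x \<le> \<epsilon>" if "x \<in> topspace X" "w x \<le> r" for x
  proof -
    have "k * (w x - s) \<le> 0"
      using that k s by (intro mult_nonneg_nonpos) auto
    then have "P x \<le> Q x"
      using PQw[OF that(1)] by linarith
    then show ?thesis
      using \<open>0 < \<epsilon>\<close> by simp
  qed
  ultimately show "\<exists>g\<in>differences. \<forall>x\<in>topspace X. g x \<le> 1 + \<epsilon> \<and> (1 \<le> w x \<longrightarrow> 1 \<le> g x) \<and> (w x \<le> r \<longrightarrow> g x \<le> \<epsilon>)"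
    by (intro bexI[of _ ?g]) auto
qed

lemma isotone_separates:
  assumes "x \<in> topspace X" "y \<in> topspace X" "(x, y) \<notin> R"
  obtains u where "u \<in> isotone" "u y < u x"
proof -
  obtain u where "continuous_map X euclideanreal u" "\<And>z. 0 \<le> u z"
    "\<And>z w. (z, w) \<in> R \<Longrightarrow> u z \<le> u w" "u y < u x"
    using Nachbin_separation[OF assms] by blast
  then show thesis
    by (intro that[of u]) (auto simp: isotone_def)
qed

text \<open>If \<open>x\<close> lies below \<open>y\<close>, no isotone function is larger at
  \<open>x\<close>; a constant minus an isotone function then does the separation.\<close>

lemma differences_separate:
  assumes xy: "x \<in> topspace X" "y \<in> topspace X" "x \<noteq> y"
  obtains w where "w \<in> differences" "w y < w x"
proof (cases "(x, y) \<in> R")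
  case False
  then obtain u where "u \<in> isotone" "u y < u x"
    using isotone_separates xy by blast
  then show thesis
    using isotone_const[of 0] by (intro that[of u] differencesI[of u "\<lambda>x. 0"]) (auto simp: isotone_def)
next
  case True
  then have "(y, x) \<notin> R"
    using order_antisym xy by blast
  then obtain u where u: "u \<in> isotone" "u x < u y"
    using isotone_separates xy by blast
  obtain c where c: "0 \<le> c" "\<And>z. z \<in> topspace X \<Longrightarrow> u z \<le> c"
  proof -
    have "compact (u ` topspace X)"
      using image_compactin[of X "topspace X" euclideanreal u] compact u
      by (simp add: compact_space_def isotone_def)
    then have "bounded (u ` topspace X)"
      by (rule compact_imp_bounded)
    then obtain b where "\<forall>y\<in>u ` topspace X. norm y \<le> b"
      unfolding bounded_iff by blast
    then show thesis
      by (intro that[of "\<bar>b\<bar>"]) force+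
  qed
  show thesis
    using u c by (intro that[of "\<lambda>z. c - u z"] differencesI[of "\<lambda>x. c" u] isotone_const) auto
qed

text \<open>Since \<open>differences\<close> separates points in both directions, the order it
  defines is equality and every nonnegative continuous function is isotone for it.\<close>

lemma differences_dense:
  assumes h: "continuous_map X euclideanreal h" "\<And>x. x \<in> topspace X \<Longrightarrow> 0 \<le> h x" and "0 < \<epsilon>"
  obtains u v where "u \<in> isotone" "v \<in> isotone" "\<And>x. x \<in> topspace X \<Longrightarrow> \<bar>u x - v x - h x\<bar> \<le> \<epsilon>"
proof -
  have "\<exists>w\<in>differences. \<forall>x\<in>topspace X. \<bar>w x - h x\<bar> \<le> \<epsilon>"
  proof (rule steep_cone.approximates_isotone[OF steep_cone_differences h])
    fix x y assume xy: "x \<in> topspace X" "y \<in> topspace X" and le: "\<forall>f\<in>differences. f x \<le> f y"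
    have "x = y"
    proof (rule ccontr)
      assume "x \<noteq> y"
      then obtain w where "w \<in> differences" "w y < w x"
        by (rule differences_separate[OF xy])
      then show False
        using le by fastforce
    qed
    then show "h x \<le> h y"
      by simp
  qed (use \<open>0 < \<epsilon>\<close> in auto)
  then show thesis
    unfolding differences_def by (force intro: that)
qed

text \<open>Isotony survives because t maps to the square of 2t / (1 + t) increasingly for
  nonnegative t.\<close>

lemma K_iv2:
  assumes f: "f \<in> K"
  shows "\<one>\<^bsub>A\<^esub> \<oplus>\<^bsub>A\<^esub> f \<in> Units A"
    "((2 \<odot>\<^bsub>A\<^esub> f) \<otimes>\<^bsub>A\<^esub> inv\<^bsub>A\<^esub> (\<one>\<^bsub>A\<^esub> \<oplus>\<^bsub>A\<^esub> f)) [^]\<^bsub>A\<^esub> (2::nat) \<in> K"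
proof -
  interpret cring A
    by (rule cring_A)
  have fA: "f \<in> carrier A" and fK: "\<And>x. x \<in> topspace X \<Longrightarrow> Im (f x) = 0" "(\<lambda>x. Re (f x)) \<in> isotone"
    using f by (auto simp: K_iff)
  let ?u = "\<one>\<^bsub>A\<^esub> \<oplus>\<^bsub>A\<^esub> f"
  have u: "?u \<in> carrier A" "\<And>x. x \<in> topspace X \<Longrightarrow> ?u x = 1 + f x"
    using A_closed(1)[OF A_closed(5)[OF fA fA] fA] by (auto simp: A_simps(3,4))
  have nz: "?u x \<noteq> 0" if "x \<in> topspace X" for x
  proof -
    have "0 \<le> Re (f x)"
      using that fK(2) by (simp add: isotone_def)
    then have "Re (?u x) \<noteq> 0"
      using u(2)[OF that] by simp
    then show ?thesis
      by (metis zero_complex.sel(1))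
  qed
  show U: "?u \<in> Units A"
    by (rule inv_A(1)[OF u(1) nz])
  define g where "g = (2 \<odot>\<^bsub>A\<^esub> f) \<otimes>\<^bsub>A\<^esub> inv\<^bsub>A\<^esub> ?u"
  have two: "2 \<odot>\<^bsub>A\<^esub> f \<in> carrier A"
    using A_closed(3)[OF fA fA] .
  have g: "g \<in> carrier A"
    unfolding g_def using two U by simp
  have gg: "g [^]\<^bsub>A\<^esub> (2::nat) = g \<otimes>\<^bsub>A\<^esub> g"
    using g by (simp add: numeral_2_eq_2)
  have val: "(g [^]\<^bsub>A\<^esub> (2::nat)) x = of_real ((2 * Re (f x) / (1 + Re (f x)))\<^sup>2)" if x: "x \<in> topspace X" for x
  proof -
    have fx: "f x = of_real (Re (f x))"
      using fK(1)[OF x] by (simp add: complex_eq_iff)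
    have "g x = 2 * f x / (1 + f x)"
      using x inv_A(2)[OF u(1) nz x] u(2)[OF x] unfolding g_def A_simps(2,6) by simp
    also have "\<dots> = of_real (2 * Re (f x) / (1 + Re (f x)))"
      by (subst (1 2) fx) simp
    finally have "g x = of_real (2 * Re (f x) / (1 + Re (f x)))" .
    then show ?thesis
      using x unfolding gg A_simps(2) by (simp only: restrict_apply' power2_eq_square of_real_mult)
  qed
  have gA: "g [^]\<^bsub>A\<^esub> (2::nat) \<in> carrier A"
    using g by simp
  have mono: "(2 * s / (1 + s))\<^sup>2 \<le> (2 * t / (1 + t))\<^sup>2" if "0 \<le> s" "s \<le> t" for s t :: real
    using that by (intro power_mono) (auto simp: divide_le_eq le_divide_eq field_simps)
  have "(\<lambda>x. Re ((g [^]\<^bsub>A\<^esub> (2::nat)) x)) \<in> isotone"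
    using continuous_Re_A[OF gA] fK(2) mono by (auto simp: isotone_def val simp del: of_real_power of_real_divide)
  then show "((2 \<odot>\<^bsub>A\<^esub> f) \<otimes>\<^bsub>A\<^esub> inv\<^bsub>A\<^esub> ?u) [^]\<^bsub>A\<^esub> (2::nat) \<in> K"
    using gA val unfolding g_def[symmetric] K_iff by (simp del: of_real_power of_real_divide)
qed

theorem cstar_cone_A: "cstar_cone (map_II (X, R))"
proof -
  interpret CX: comm_cstar_algebra A
    by (rule comm_cstar_algebra_A)
  have KA: "K \<subseteq> carrier A"
    by (auto simp: K_iff)
  have H: "f \<in> hermitian A \<longleftrightarrow> f \<in> carrier A \<and> (\<forall>x\<in>topspace X. Im (f x) = 0)" for f
  proof -
    have "star A f = f \<longleftrightarrow> (\<forall>x\<in>topspace X. Im (f x) = 0)" if "f \<in> carrier A"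
    proof
      assume "star A f = f"
      then have "cnj (f x) = f x" if "x \<in> topspace X" for x
        using that by (metis A_simps(7) restrict_apply')
      then show "\<forall>x\<in>topspace X. Im (f x) = 0"
        by (simp add: complex_eq_iff)
    next
      assume "\<forall>x\<in>topspace X. Im (f x) = 0"
      then show "star A f = f"
        using that by (intro A_eqI A_closed) (auto simp: A_simps(7) complex_eq_iff)
    qed
    then show ?thesis
      by (auto simp: hermitian_def)
  qed
  have add: "f \<oplus>\<^bsub>A\<^esub> g \<in> K" if f: "f \<in> K" and g: "g \<in> K" for f g
  proof -
    have "f \<oplus>\<^bsub>A\<^esub> g \<in> carrier A"
      using f g KA by auto
    moreover from this have "(\<lambda>x. Re ((f \<oplus>\<^bsub>A\<^esub> g) x)) \<in> isotone"
      using continuous_Re_A[of "f \<oplus>\<^bsub>A\<^esub> g"] isotone_add[of "\<lambda>x. Re (f x)" "\<lambda>x. Re (g x)"] f g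
      by (simp add: isotone_def K_iff A_simps(3))
    ultimately show ?thesis
      using f g by (simp add: K_iff A_simps(3))
  qed
  have scale: "complex_of_real a \<odot>\<^bsub>A\<^esub> f \<in> K" if a: "0 < a" and f: "f \<in> K" for a f
  proof -
    have "complex_of_real a \<odot>\<^bsub>A\<^esub> f \<in> carrier A"
      using f KA by auto
    moreover from this have "(\<lambda>x. Re ((complex_of_real a \<odot>\<^bsub>A\<^esub> f) x)) \<in> isotone"
      using continuous_Re_A[of "complex_of_real a \<odot>\<^bsub>A\<^esub> f"] isotone_scale[of "\<lambda>x. Re (f x)" a] f a
      by (simp add: isotone_def K_iff A_simps(6))
    ultimately show ?thesis
      using f by (simp add: K_iff A_simps(6))
  qed
  have pointwise: "cmod (f x - g x) < \<epsilon>" if "f \<in> carrier A" "g \<in> carrier A" "nrm A (f \<ominus>\<^bsub>A\<^esub> g) < \<epsilon>" "x \<in> topspace X"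
    for f g \<epsilon> x
    using nrm_dist_A_upper[of f g x] that by (simp add: CX.nrm_dist dist_norm)
  have "f \<in> K" if f: "f \<in> carrier A" and lim: "\<forall>\<epsilon>>0. \<exists>g\<in>K. nrm A (f \<ominus>\<^bsub>A\<^esub> g) < \<epsilon>" for f
  proof -
    have near: "\<exists>g\<in>K. \<forall>x\<in>topspace X. \<bar>Re (f x) - Re (g x)\<bar> < \<epsilon> \<and> \<bar>Im (f x)\<bar> < \<epsilon>" if \<epsilon>: "0 < \<epsilon>" for \<epsilon>
    proof -
      obtain g where g: "g \<in> K" "nrm A (f \<ominus>\<^bsub>A\<^esub> g) < \<epsilon>"
        using lim \<epsilon> by blast
      have "\<bar>Re (f x) - Re (g x)\<bar> < \<epsilon> \<and> \<bar>Im (f x)\<bar> < \<epsilon>" if x: "x \<in> topspace X" for x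
      proof -
        have "g \<in> carrier A" "Im (g x) = 0"
          using g(1) x by (auto simp: K_iff)
        then show ?thesis
          using pointwise[OF f _ g(2) x] abs_Re_le_cmod[of "f x - g x"] abs_Im_le_cmod[of "f x - g x"] by simp
      qed
      then show ?thesis
        using g(1) by blast
    qed
    have Im0: "Im (f x) = 0" if x: "x \<in> topspace X" for x
    proof (rule ccontr)
      assume "Im (f x) \<noteq> 0"
      then show False
        using near[of "\<bar>Im (f x)\<bar>"] x by auto
    qed
    have Re0: "0 \<le> Re (f x)" if x: "x \<in> topspace X" for x
    proof (rule ccontr)
      assume "\<not> 0 \<le> Re (f x)"
      then obtain g where "g \<in> K" "\<bar>Re (f x) - Re (g x)\<bar> < - Re (f x)"
        using near[of "- Re (f x)"] x by auto
      moreover from this have "0 \<le> Re (g x)"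
        using x by (simp add: K_iff isotone_def)
      ultimately show False
        by linarith
    qed
    have mono: "Re (f x) \<le> Re (f y)" if x: "x \<in> topspace X" and y: "y \<in> topspace X" and "(x, y) \<in> R" for x y
    proof (rule field_le_epsilon)
      fix \<epsilon> :: real assume "0 < \<epsilon>"
      then obtain g where g: "g \<in> K" "\<forall>z\<in>topspace X. \<bar>Re (f z) - Re (g z)\<bar> < \<epsilon> / 2"
        using near[of "\<epsilon> / 2"] by auto
      have "Re (g x) \<le> Re (g y)"
        using g(1) that by (simp add: K_iff isotone_def)
      moreover have "Re (f x) - Re (g x) < \<epsilon> / 2" "Re (g y) - Re (f y) < \<epsilon> / 2"
        using g(2)[rule_format, OF x] g(2)[rule_format, OF y]
          abs_ge_self[of "Re (f x) - Re (g x)"] abs_ge_minus_self[of "Re (f y) - Re (g y)"] by linarith+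
      ultimately show "Re (f x) \<le> Re (f y) + \<epsilon>"
        by linarith
    qed
    show ?thesis
      using f Im0 Re0 mono continuous_Re_A[OF f] by (simp add: K_iff isotone_def)
  qed
  then have closed: "closedin (nrm_topology A) K"
    using KA by (subst CX.nrm_closedin_iff) auto
  let ?D = "{f \<ominus>\<^bsub>A\<^esub> g | f g. f \<in> K \<and> g \<in> K}"
  have "?D \<subseteq> hermitian A"
    using KA CX.H_closed(4) by (auto simp: H K_iff A_minus)
  have DA: "?D \<subseteq> carrier A"
    using KA by auto
  have "nrm_topology A closure_of ?D = hermitian A"
  proof
    show "nrm_topology A closure_of ?D \<subseteq> hermitian A"
      using \<open>?D \<subseteq> hermitian A\<close> CX.H_closedin by (rule closure_of_minimal)
    have "\<exists>g\<in>?D. nrm A (f \<ominus>\<^bsub>A\<^esub> g) < \<epsilon>" if f: "f \<in> hermitian A" and \<epsilon>: "0 < \<epsilon>" for f \<epsilon>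
    proof -
      have fA: "f \<in> carrier A" and Im0: "\<And>x. x \<in> topspace X \<Longrightarrow> Im (f x) = 0"
        using f by (auto simp: H)
      \<comment> \<open>Adding \<open>c\<close> makes the real part of \<open>f\<close> nonnegative,
        so that \<open>differences_dense\<close> applies; the constant is moved into the subtracted
        function \<open>q\<close> afterwards.\<close>
      define c where "c = nrm A f"
      have c: "0 \<le> c" "0 \<le> Re (f x) + c" if "x \<in> topspace X" for x
        using nrm_A_nonneg[OF fA] nrm_A_upper[OF fA that] abs_Re_le_cmod[of "f x"] by (auto simp: c_def)
      have "continuous_map X euclideanreal (\<lambda>x. Re (f x) + c)"
        using continuous_Re_A[OF fA] by (intro continuous_intros)
      then obtain u v where uv: "u \<in> isotone" "v \<in> isotone"
        "\<And>x. x \<in> topspace X \<Longrightarrow> \<bar>u x - v x - (Re (f x) + c)\<bar> \<le> \<epsilon> / 2"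
        using differences_dense[of "\<lambda>x. Re (f x) + c", OF _ c(2) half_gt_zero[OF \<epsilon>]] by blast
      define p where "p = (\<lambda>x\<in>topspace X. complex_of_real (u x))"
      define q where "q = (\<lambda>x\<in>topspace X. complex_of_real (v x + c))"
      have "0 \<le> c"
        using nrm_A_nonneg[OF fA] by (simp add: c_def)
      then have "(\<lambda>x. v x + c) \<in> isotone"
        using isotone_add[OF uv(2) isotone_const[of c]] by simp
      with uv(1) have pq: "p \<in> K" "q \<in> K"
        by (simp_all add: K_eq p_def q_def del: of_real_add)
      then have pqA: "p \<in> carrier A" "q \<in> carrier A" "p \<ominus>\<^bsub>A\<^esub> q \<in> carrier A"
        using KA by auto
      have "nrm_dist A f (p \<ominus>\<^bsub>A\<^esub> q) \<le> \<epsilon> / 2"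
      proof (rule nrm_dist_A_least[OF fA pqA(3)])
        fix x assume x: "x \<in> topspace X"
        have "f x = of_real (Re (f x))"
          using Im0[OF x] by (simp add: complex_eq_iff)
        then have "f x - (p \<ominus>\<^bsub>A\<^esub> q) x = of_real (Re (f x) - (u x - (v x + c)))"
          using x pqA by (simp add: A_minus p_def q_def)
        then have "dist (f x) ((p \<ominus>\<^bsub>A\<^esub> q) x) = \<bar>Re (f x) - (u x - (v x + c))\<bar>"
          by (simp only: dist_norm norm_of_real)
        then show "dist (f x) ((p \<ominus>\<^bsub>A\<^esub> q) x) \<le> \<epsilon> / 2"
          using uv(3)[OF x] by linarith
      qed
      then have "nrm A (f \<ominus>\<^bsub>A\<^esub> (p \<ominus>\<^bsub>A\<^esub> q)) < \<epsilon>"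
        using \<epsilon> by (simp add: CX.nrm_dist[OF fA pqA(3)])
      then show ?thesis
        using pq by blast
    qed
    then show "hermitian A \<subseteq> nrm_topology A closure_of ?D"
      unfolding CX.nrm_closure_of[OF DA] by (auto simp: H)
  qed
  then show ?thesis
    unfolding cstar_cone_def map_II_def
    using CX.comm_cstar_algebra_axioms KA add scale closed K_iv2 by simp
qed

end

section \<open>The evaluation map onto the spectrum\<close>

context compact_ordered
begin

text \<open>A continuous bijection from a compact onto a Hausdorff space is a homeomorphism. Nachbin
  separation gives both injectivity and the reflection of the order.\<close>

theorem evaluation_iso: "ordered_space_iso (X, R) (map_I (map_II (X, R))) (evaluation X)"
proof -
  interpret CX: comm_cstar_algebra A
    by (rule comm_cstar_algebra_A)
  have lift: "(\<lambda>x\<in>topspace X. complex_of_real (u x)) \<in> K" if "u \<in> isotone" for u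
    using that by (simp add: K_eq)
  have ev: "evaluation X x (\<lambda>x\<in>topspace X. complex_of_real (u x)) = complex_of_real (u x)"
    if "x \<in> topspace X" "u \<in> isotone" for x u
    using that lift[OF that(2)] by (simp add: evaluation_def K_iff)
  have homeo: "homeomorphic_map X (spectrum_topology A) (evaluation X)"
  proof (rule continuous_imp_homeomorphic_map)
    show "continuous_map X (spectrum_topology A) (evaluation X)"
      unfolding spectrum_topology_def
    proof (rule continuous_map_into_subtopology)
      have "continuous_map X euclidean (\<lambda>x. evaluation X x f)" if "f \<in> carrier A" for f
        using continuous_A[OF that] that by (simp add: evaluation_def)
      then show "continuous_map X (product_topology (\<lambda>_. euclidean) (carrier A)) (evaluation X)"
        unfolding continuous_map_componentwise by (auto simp: evaluation_def)
    qed (use evaluation_in_characters in auto)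
    show "compact_space X" "Hausdorff_space (spectrum_topology A)"
      by (fact compact CX.Hausdorff_spectrum)+
    show "evaluation X ` topspace X = topspace (spectrum_topology A)"
      unfolding CX.topspace_spectrum using evaluation_in_characters character_is_evaluation by blast
    have separated: "evaluation X x \<noteq> evaluation X y"
      if xy: "x \<in> topspace X" "y \<in> topspace X" "(x, y) \<notin> R" for x y
    proof -
      obtain u where u: "u \<in> isotone" "u y < u x"
        using isotone_separates[OF xy] .
      then show ?thesis
        using ev[OF xy(1) u(1)] ev[OF xy(2) u(1)] by auto
    qed
    show "inj_on (evaluation X) (topspace X)"
      using separated order_antisym unfolding inj_on_def by metis
  qed
  have "(x, y) \<in> R \<longleftrightarrow> (evaluation X x, evaluation X y) \<in> spectrum_order A K"
    if xy: "x \<in> topspace X" "y \<in> topspace X" for x y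
  proof
    assume "(x, y) \<in> R"
    then have "Re (evaluation X x f) \<le> Re (evaluation X y f)" if "f \<in> K" for f
      using that xy by (simp add: evaluation_def K_iff isotone_def)
    then show "(evaluation X x, evaluation X y) \<in> spectrum_order A K"
      using xy evaluation_in_characters by (simp add: spectrum_order_def)
  next
    assume le: "(evaluation X x, evaluation X y) \<in> spectrum_order A K"
    show "(x, y) \<in> R"
    proof (rule ccontr)
      assume "(x, y) \<notin> R"
      then obtain u where u: "u \<in> isotone" "u y < u x"
        using isotone_separates[OF xy] by blast
      then have "u x \<le> u y"
        using le lift[OF u(1)] ev[OF xy(1) u(1)] ev[OF xy(2) u(1)] by (auto simp: spectrum_order_def)
      then show False
        using u by simp
    qed
  qed
  then show ?thesis
    using homeo by (simp add: ordered_space_iso_def map_I_def map_II_def)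
qed

end

section \<open>The space of an algebra with a cone\<close>

locale cstar_cone_pair =
  fixes B :: "'b star_algebra" (structure) and C :: "'b set"
  assumes cone: "cstar_cone (B, C)"
begin

sublocale comm_cstar_algebra B
  using cone by (simp add: cstar_cone_def)

lemma cone_carrier: "C \<subseteq> carrier B"
  and cone_add: "\<lbrakk>f \<in> C; g \<in> C\<rbrakk> \<Longrightarrow> f \<oplus> g \<in> C"
  and cone_scale: "\<lbrakk>0 < a; f \<in> C\<rbrakk> \<Longrightarrow> complex_of_real a \<odot> f \<in> C"
  and cone_closed: "closedin (nrm_topology B) C"
  and cone_iv: "(C \<subseteq> nonneg_elements B \<and>
       (\<forall>f\<in>C. (2 \<odot> (f [^] (2::nat))) \<otimes> inv (\<one> \<oplus> f [^] (2::nat)) \<in> C)) \<or>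
      (\<forall>f\<in>C. \<one> \<oplus> f \<in> Units B \<and>
        ((2 \<odot> f) \<otimes> inv (\<one> \<oplus> f)) [^] (2::nat) \<in> C)"
  and cone_dense: "nrm_topology B closure_of {f \<ominus> g | f g. f \<in> C \<and> g \<in> C} = H"
  using cone unfolding cstar_cone_def by simp_all

lemma differences_carrier: "{f \<ominus> g | f g. f \<in> C \<and> g \<in> C} \<subseteq> carrier B"
  using cone_carrier by auto

lemma cone_approx:
  assumes "f \<in> H" "0 < \<epsilon>"
  obtains p q where "p \<in> C" "q \<in> C" "nrm B (f \<ominus> (p \<ominus> q)) < \<epsilon>"
proof -
  have "f \<in> {f \<in> carrier B. \<forall>\<epsilon>>0. \<exists>g\<in>{f \<ominus> g | f g. f \<in> C \<and> g \<in> C}. nrm B (f \<ominus> g) < \<epsilon>}"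
    using assms(1) unfolding cone_dense[symmetric] nrm_closure_of[OF differences_carrier] .
  then show thesis
    using \<open>0 < \<epsilon>\<close> that by blast
qed

text \<open>f = 2f - f is itself a difference of elements of the cone, hence in the closure
  \<open>H\<close>.\<close>

lemma cone_H: "C \<subseteq> H"
proof
  fix f assume f: "f \<in> C"
  then have fc: "f \<in> carrier B"
    using cone_carrier by blast
  have "2 \<odot> f \<in> C"
    using cone_scale[of 2 f] f by simp
  moreover have "(2 \<odot> f) \<ominus> f = f"
  proof -
    have "2 \<odot> f = f \<oplus> f"
      using smult_l_distr[of 1 1 f] smult_one fc by simp
    then show ?thesis
      using fc by algebra
  qed
  ultimately have "f \<in> {f \<ominus> g | f g. f \<in> C \<and> g \<in> C}"
    using f by (metis (mono_tags, lifting) mem_Collect_eq)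
  moreover have "{f \<ominus> g | f g. f \<in> C \<and> g \<in> C} \<subseteq> topspace (nrm_topology B)"
    using differences_carrier by (simp add: nrm_topology_def)
  ultimately show "f \<in> H"
    using closure_of_subset cone_dense by blast
qed

lemma character_cone:
  assumes "x \<in> characters B" "f \<in> C"
  shows "x f = of_real (Re (x f))"
  using assms cone_H by (intro character_H_of_real) auto

text \<open>\<open>1 + f\<^sup>2 = (f - i) (f + i)\<close>, and neither i nor -i is in a nonnegative
  spectrum. This makes the inverse in (iv.1) a genuine one.\<close>

lemma one_plus_square_in_Units:
  assumes f: "f \<in> nonneg_elements B"
  shows "\<one> \<oplus> f [^] (2::nat) \<in> Units B"
proof -
  have fc: "f \<in> carrier B" and spec: "spectrum B f \<subseteq> complex_of_real ` {0..}"
    using f by (auto simp: nonneg_elements_def)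
  have "z \<notin> spectrum B f" if "Im z \<noteq> 0" for z
    using spec that by auto
  then have U: "f \<ominus> sc \<i> \<in> Units B" "f \<ominus> sc (- \<i>) \<in> Units B"
    by (auto simp: spectrum_def sc_def)
  have ii: "sc \<i> \<otimes> sc \<i> = \<ominus> \<one>"
    unfolding sc_mult[symmetric] by (simp add: sc_minus)
  have "(f \<ominus> sc \<i>) \<otimes> (f \<ominus> sc (- \<i>)) = f \<otimes> f \<ominus> sc \<i> \<otimes> sc \<i>"
    unfolding sc_minus using fc sc_closed[of \<i>] by algebra
  also have "\<dots> = \<one> \<oplus> f \<otimes> f"
    unfolding ii using fc one_closed by algebra
  also have "f \<otimes> f = f [^] (2::nat)"
    using fc by (simp add: numeral_2_eq_2)
  finally show ?thesis
    using Units_m_closed[OF U] by simp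
qed

text \<open>Under (iv.1) the value x f is in the spectrum of f. Under (iv.2) a negative value could
  be scaled to -1, and then a character would annihilate the invertible element 1 + a f.\<close>

lemma cone_nonneg:
  assumes x: "x \<in> characters B" and f: "f \<in> C"
  shows "0 \<le> Re (x f)"
  using cone_iv
proof (elim disjE conjE)
  have fc: "f \<in> carrier B"
    using f cone_carrier by blast
  assume "C \<subseteq> nonneg_elements B"
  then have spec: "spectrum B f \<subseteq> complex_of_real ` {0..}"
    using f by (auto simp: nonneg_elements_def)
  have "x (f \<ominus> sc (x f)) = 0"
    using characters_simps(8)[OF x fc sc_closed] characters_simps(6)[OF x] by simp
  then have "f \<ominus> sc (x f) \<notin> Units B"
    using character_Units(1)[OF x] by blast
  then have "x f \<in> spectrum B f"
    by (simp add: spectrum_def sc_def)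
  then show ?thesis
    using spec by auto
next
  assume iv: "\<forall>f\<in>C. \<one> \<oplus> f \<in> Units B \<and>
    ((2 \<odot> f) \<otimes> inv (\<one> \<oplus> f)) [^] (2::nat) \<in> C"
  show ?thesis
  proof (rule ccontr)
    assume neg: "\<not> 0 \<le> Re (x f)"
    define a where "a = - 1 / Re (x f)"
    have "complex_of_real a \<odot> f \<in> C"
      using neg f by (intro cone_scale) (auto simp: a_def field_simps)
    then have g: "complex_of_real a \<odot> f \<in> carrier B"
      and U: "\<one> \<oplus> complex_of_real a \<odot> f \<in> Units B"
      using iv cone_carrier by blast+
    have fc: "f \<in> carrier B"
      using f cone_carrier by blast
    have "x (\<one> \<oplus> complex_of_real a \<odot> f) = 1 + complex_of_real a * x f"
      using characters_simps(1)[OF x one_closed g] characters_simps(3)[OF x fc] characters_simps(4)[OF x] by simp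
    also have "\<dots> = 1 + complex_of_real (a * Re (x f))"
      by (subst character_cone[OF x f]) simp
    also have "a * Re (x f) = - 1"
      using neg by (simp add: a_def)
    finally show False
      using character_Units(1)[OF x U] by simp
  qed
qed

lemma spectral_cone_C: "spectral_cone B C"
proof unfold_locales
  show "C \<subseteq> H"
    by (rule cone_H)
  show "closedin (nrm_topology B) C"
    by (rule cone_closed)
  show "f \<oplus> g \<in> C" if "f \<in> C" "g \<in> C" for f g
    using that by (rule cone_add)
  show "complex_of_real a \<odot> f \<in> C" if "0 < a" "f \<in> C" for a f
    using that by (rule cone_scale)
  show "0 \<le> Re (x f)" if "f \<in> C" "x \<in> characters B" for f x
    using cone_nonneg that by blast
  show "\<exists>p\<in>C. \<forall>x\<in>characters B. 0 < Re (x p)"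
  proof -
    \<comment> \<open>Approximating the unit within distance 1 suffices: the real part of x p - x q
      is then positive, and x q is nonnegative.\<close>
    obtain p q where pq: "p \<in> C" "q \<in> C" "nrm B (\<one> \<ominus> (p \<ominus> q)) < 1"
      using cone_approx[of "\<one>" 1] by auto
    then have pqc: "p \<in> carrier B" "q \<in> carrier B"
      using cone_carrier by auto
    have "0 < Re (x p)" if x: "x \<in> characters B" for x
    proof -
      have "x (\<one> \<ominus> (p \<ominus> q)) = 1 - (x p - x q)"
        using characters_simps[OF x] pqc by simp
      then have "cmod (1 - (x p - x q)) < 1"
        using character_le_nrm[OF x, of "\<one> \<ominus> (p \<ominus> q)"] pqc pq(3) by simp
      then show ?thesis
        using complex_Re_le_cmod[of "1 - (x p - x q)"] cone_nonneg[OF x pq(2)] by simp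
    qed
    then show ?thesis
      using pq(1) by blast
  qed
  show "(\<forall>f\<in>C. \<exists>g\<in>C. \<forall>x\<in>characters B. Re (x g) = 2 * (Re (x f))\<^sup>2 / (1 + (Re (x f))\<^sup>2)) \<or>
      (\<forall>f\<in>C. \<exists>g\<in>C. \<forall>x\<in>characters B. Re (x g) = (2 * Re (x f) / (1 + Re (x f)))\<^sup>2)"
    using cone_iv
  proof (elim disjE conjE)
    assume nn: "C \<subseteq> nonneg_elements B"
      and iv: "\<forall>f\<in>C. (2 \<odot> (f [^] (2::nat))) \<otimes> inv (\<one> \<oplus> f [^] (2::nat)) \<in> C"
    have "Re (x ((2 \<odot> (f [^] (2::nat))) \<otimes> inv (\<one> \<oplus> f [^] (2::nat)))) =
        2 * (Re (x f))\<^sup>2 / (1 + (Re (x f))\<^sup>2)" if f: "f \<in> C" and x: "x \<in> characters B" for f x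
    proof -
      have fc: "f \<in> carrier B"
        using f cone_carrier by blast
      define s where "s = f [^] (2::nat)"
      have s: "s \<in> carrier B" "s = f \<otimes> f" "\<one> \<oplus> s \<in> Units B"
        using fc one_plus_square_in_Units[of f] nn f by (auto simp: s_def numeral_2_eq_2)
      have "x s = of_real ((Re (x f))\<^sup>2)"
        unfolding s(2) characters_simps(2)[OF x fc fc]
        by (subst (1 2) character_cone[OF x f]) (simp add: power2_eq_square)
      moreover have "x ((2 \<odot> s) \<otimes> inv (\<one> \<oplus> s)) = 2 * x s / (1 + x s)"
        using characters_simps[OF x] character_Units[OF x s(3)] s by simp
      ultimately have "x ((2 \<odot> s) \<otimes> inv (\<one> \<oplus> s)) =
          of_real (2 * (Re (x f))\<^sup>2 / (1 + (Re (x f))\<^sup>2))"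
        by simp
      then show ?thesis
        unfolding s_def by (simp only: Re_complex_of_real)
    qed
    then show ?thesis
      using iv by blast
  next
    assume iv: "\<forall>f\<in>C. \<one> \<oplus> f \<in> Units B \<and>
      ((2 \<odot> f) \<otimes> inv (\<one> \<oplus> f)) [^] (2::nat) \<in> C"
    have "Re (x (((2 \<odot> f) \<otimes> inv (\<one> \<oplus> f)) [^] (2::nat))) =
        (2 * Re (x f) / (1 + Re (x f)))\<^sup>2" if f: "f \<in> C" and x: "x \<in> characters B" for f x
    proof -
      have fc: "f \<in> carrier B" and U: "\<one> \<oplus> f \<in> Units B"
        using f cone_carrier iv by auto
      define k where "k = (2 \<odot> f) \<otimes> inv (\<one> \<oplus> f)"
      have k: "k \<in> carrier B"
        using fc U by (simp add: k_def)
      have "x k = 2 * x f / (1 + x f)"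
        using characters_simps[OF x] character_Units[OF x U] fc U by (simp add: k_def)
      also have "\<dots> = of_real (2 * Re (x f) / (1 + Re (x f)))"
        by (subst (1 2) character_cone[OF x f]) simp
      finally have k_val: "x k = of_real (2 * Re (x f) / (1 + Re (x f)))" .
      have "k [^] (2::nat) = k \<otimes> k"
        using k by (simp add: numeral_2_eq_2)
      then have "x (k [^] (2::nat)) = of_real ((2 * Re (x f) / (1 + Re (x f)))\<^sup>2)"
        by (simp only: characters_simps(2)[OF x k k] k_val power2_eq_square of_real_mult)
      then show ?thesis
        unfolding k_def by (simp only: Re_complex_of_real)
    qed
    then show ?thesis
      using iv by blast
  qed
qed

text \<open>Differences of cone elements are dense in \<open>H\<close> and characters are
  contractive. This yields antisymmetry of the order on the spectrum.\<close>

lemma character_eqI_cone: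
  assumes x: "x \<in> characters B" and y: "y \<in> characters B" and eq: "\<And>f. f \<in> C \<Longrightarrow> x f = y f"
  shows "x = y"
proof (rule H_separates_characters[OF x y])
  fix f assume f: "f \<in> H"
  then have fc: "f \<in> carrier B"
    by (simp add: H_iff)
  have "cmod (x f - y f) \<le> 0"
  proof (rule field_le_epsilon)
    fix \<epsilon> :: real assume "0 < \<epsilon>"
    then obtain p q where pq: "p \<in> C" "q \<in> C" "nrm B (f \<ominus> (p \<ominus> q)) < \<epsilon> / 2"
      using cone_approx[OF f, of "\<epsilon> / 2"] by auto
    then have pqc: "p \<in> carrier B" "q \<in> carrier B" "f \<ominus> (p \<ominus> q) \<in> carrier B"
      using cone_carrier fc by auto
    have near: "cmod (z f - (z p - z q)) < \<epsilon> / 2" if z: "z \<in> characters B" for z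
      using character_le_nrm[OF z pqc(3)] pq(3) characters_simps(8)[OF z] fc pqc(1,2) by simp
    have "x f - y f = (x f - (x p - x q)) - (y f - (y p - y q))"
      using eq[OF pq(1)] eq[OF pq(2)] by simp
    then have "cmod (x f - y f) \<le> cmod (x f - (x p - x q)) + cmod (y f - (y p - y q))"
      by (simp only: norm_triangle_ineq4)
    then show "cmod (x f - y f) \<le> 0 + \<epsilon>"
      using near[OF x] near[OF y] by linarith
  qed
  then show "x f = y f"
    by simp
qed

theorem compact_ordered_map_I: "compact_ordered_space (map_I (B, C))"
proof -
  let ?T = "spectrum_topology B" and ?R = "spectrum_order B C"
  have "partial_order_on (characters B) ?R"
    unfolding partial_order_on_def preorder_on_def
  proof (intro conjI)
    show "?R \<subseteq> characters B \<times> characters B"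
      by (auto simp: spectrum_order_def)
    show "refl_on (characters B) ?R"
      by (auto simp: spectrum_order_def refl_on_def)
    show "trans ?R"
      unfolding spectrum_order_def by (rule transI) (auto intro: order_trans)
    show "antisym ?R"
    proof (rule antisymI)
      fix x y assume "(x, y) \<in> ?R" "(y, x) \<in> ?R"
      then have xy: "x \<in> characters B" "y \<in> characters B" and eq: "\<And>f. f \<in> C \<Longrightarrow> Re (x f) = Re (y f)"
        by (auto simp: spectrum_order_def intro: antisym)
      show "x = y"
        using character_cone[OF xy(1)] character_cone[OF xy(2)] eq
        by (intro character_eqI_cone[OF xy]) metis
    qed
  qed
  moreover have "closedin (prod_topology ?T ?T) ?R"
  proof -
    interpret spectral_cone B C
      by (rule spectral_cone_C)
    have "closedin (prod_topology ?T ?T) {p \<in> topspace (prod_topology ?T ?T). Re (fst p f) - Re (snd p f) \<le> 0}"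
      if f: "f \<in> C" for f
    proof -
      have "continuous_map (prod_topology ?T ?T) euclideanreal (\<lambda>p. Re (fst p f))"
        "continuous_map (prod_topology ?T ?T) euclideanreal (\<lambda>p. Re (snd p f))"
        using continuous_map_compose[OF continuous_map_fst continuous_Re[OF C_carrier[OF f]]]
          continuous_map_compose[OF continuous_map_snd continuous_Re[OF C_carrier[OF f]]]
        by (simp_all add: o_def)
      then have "continuous_map (prod_topology ?T ?T) euclideanreal (\<lambda>p. Re (fst p f) - Re (snd p f))"
        by (rule continuous_map_diff)
      then show ?thesis
        by (simp only: continuous_map_upper_lower_semicontinuous_le)
    qed
    moreover have "C \<noteq> {}"
      using C_positive by blast
    ultimately have "closedin (prod_topology ?T ?T)
        (\<Inter>f\<in>C. {p \<in> topspace (prod_topology ?T ?T). Re (fst p f) - Re (snd p f) \<le> 0})"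
      by (intro closedin_INT) auto
    also have "(\<Inter>f\<in>C. {p \<in> topspace (prod_topology ?T ?T). Re (fst p f) - Re (snd p f) \<le> 0}) = ?R"
      using \<open>C \<noteq> {}\<close> by (auto simp: spectrum_order_def topspace_spectrum)
    finally show ?thesis .
  qed
  ultimately show ?thesis
    using compact_spectrum characters_nonempty
    unfolding compact_ordered_space_def map_I_def case_prod_conv topspace_spectrum by blast
qed

text \<open>The order on the spectrum is defined so that elements of \<open>C\<close> become
  isotone; that every nonnegative isotone function arises this way is
  \<open>represents_isotone\<close>.\<close>

theorem gelfand_cone_iso: "cstar_cone_iso (B, C) (map_II (map_I (B, C))) (gelfand_map B)"
proof -
  interpret spectral_cone B C
    by (rule spectral_cone_C)
  interpret S: compact_ordered "spectrum_topology B" "spectrum_order B C"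
    using compact_ordered_map_I by unfold_locales (simp add: map_I_def)
  have "gelfand_map B ` C = S.K"
  proof (intro equalityI subsetI)
    fix h assume "h \<in> gelfand_map B ` C"
    then obtain f where f: "f \<in> C" "h = gelfand_map B f"
      by blast
    have hA: "h \<in> carrier Spectrum.A"
      using f gelfand_map_in[OF C_carrier] by blast
    have "(\<lambda>x. Re (h x)) \<in> S.isotone"
      unfolding S.isotone_def using Spectrum.continuous_Re_A[OF hA] f cone_nonneg
      by (auto simp: gelfand_map_def topspace_spectrum spectrum_order_def)
    moreover have "Im (h x) = 0" if "x \<in> characters B" for x
      using that f character_H_real[of x f] cone_H by (auto simp: gelfand_map_def)
    ultimately show "h \<in> S.K"
      using hA by (auto simp: S.K_iff topspace_spectrum)
  next
    fix h assume h: "h \<in> S.K"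
    then have hA: "h \<in> carrier Spectrum.A" and real: "\<And>x. x \<in> characters B \<Longrightarrow> Im (h x) = 0"
      and iso: "(\<lambda>x. Re (h x)) \<in> S.isotone"
      by (auto simp: S.K_iff topspace_spectrum)
    obtain f where f: "f \<in> C" "\<And>x. x \<in> characters B \<Longrightarrow> x f = of_real (Re (h x))"
    proof (rule represents_isotone)
      show "continuous_map (spectrum_topology B) euclideanreal (\<lambda>x. Re (h x))"
        using iso by (simp add: S.isotone_def)
      show "0 \<le> Re (h x)" if "x \<in> characters B" for x
        using iso that by (simp add: S.isotone_def topspace_spectrum)
      show "Re (h x) \<le> Re (h y)" if "x \<in> characters B" "y \<in> characters B" "\<forall>f\<in>C. Re (x f) \<le> Re (y f)" for x y
        using iso[unfolded S.isotone_def] that by (simp add: topspace_spectrum spectrum_order_def)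
    qed (rule that)
    have "gelfand_map B f = h"
      using gelfand_map_in[OF C_carrier[OF f(1)]] hA f(2) real
      by (intro Spectrum.A_eqI) (auto simp: gelfand_map_def topspace_spectrum complex_eq_iff)
    then show "h \<in> gelfand_map B ` C"
      using f(1) by blast
  qed
  then show ?thesis
    using gelfand_iso by (simp add: cstar_cone_iso_def map_II_def map_I_def)
qed

end

section \<open>Functoriality and duality\<close>

lemma cstar_iso_simps:
  assumes "h \<in> cstar_iso B D"
  shows "f \<in> carrier B \<Longrightarrow> h f \<in> carrier D"
    "\<lbrakk>f \<in> carrier B; g \<in> carrier B\<rbrakk> \<Longrightarrow> h (f \<oplus>\<^bsub>B\<^esub> g) = h f \<oplus>\<^bsub>D\<^esub> h g"
    "\<lbrakk>f \<in> carrier B; g \<in> carrier B\<rbrakk> \<Longrightarrow> h (f \<otimes>\<^bsub>B\<^esub> g) = h f \<otimes>\<^bsub>D\<^esub> h g"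
    "h \<one>\<^bsub>B\<^esub> = \<one>\<^bsub>D\<^esub>"
    "f \<in> carrier B \<Longrightarrow> h (a \<odot>\<^bsub>B\<^esub> f) = a \<odot>\<^bsub>D\<^esub> h f"
    "f \<in> carrier B \<Longrightarrow> h (star B f) = star D (h f)"
    "f \<in> carrier B \<Longrightarrow> nrm D (h f) = nrm B f"
    "bij_betw h (carrier B) (carrier D)"
proof -
  have r: "h \<in> ring_iso B D" and s: "\<forall>a. \<forall>f\<in>carrier B. h (a \<odot>\<^bsub>B\<^esub> f) = a \<odot>\<^bsub>D\<^esub> h f"
    "\<forall>f\<in>carrier B. h (star B f) = star D (h f)" "\<forall>f\<in>carrier B. nrm D (h f) = nrm B f"
    using assms by (simp_all add: cstar_iso_def)
  show "f \<in> carrier B \<Longrightarrow> h f \<in> carrier D"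
    by (rule ring_iso_memE(1)[OF r])
  show "\<lbrakk>f \<in> carrier B; g \<in> carrier B\<rbrakk> \<Longrightarrow> h (f \<oplus>\<^bsub>B\<^esub> g) = h f \<oplus>\<^bsub>D\<^esub> h g"
    by (rule ring_iso_memE(3)[OF r])
  show "\<lbrakk>f \<in> carrier B; g \<in> carrier B\<rbrakk> \<Longrightarrow> h (f \<otimes>\<^bsub>B\<^esub> g) = h f \<otimes>\<^bsub>D\<^esub> h g"
    by (rule ring_iso_memE(2)[OF r])
  show "h \<one>\<^bsub>B\<^esub> = \<one>\<^bsub>D\<^esub>" "bij_betw h (carrier B) (carrier D)"
    by (fact ring_iso_memE(4,5)[OF r])+
  show "f \<in> carrier B \<Longrightarrow> h (a \<odot>\<^bsub>B\<^esub> f) = a \<odot>\<^bsub>D\<^esub> h f"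
    "f \<in> carrier B \<Longrightarrow> h (star B f) = star D (h f)"
    "f \<in> carrier B \<Longrightarrow> nrm D (h f) = nrm B f"
    using s by simp_all
qed

lemma cstar_isoI:
  assumes "\<And>f. f \<in> carrier B \<Longrightarrow> h f \<in> carrier D"
    "\<And>f g. \<lbrakk>f \<in> carrier B; g \<in> carrier B\<rbrakk> \<Longrightarrow> h (f \<oplus>\<^bsub>B\<^esub> g) = h f \<oplus>\<^bsub>D\<^esub> h g"
    "\<And>f g. \<lbrakk>f \<in> carrier B; g \<in> carrier B\<rbrakk> \<Longrightarrow> h (f \<otimes>\<^bsub>B\<^esub> g) = h f \<otimes>\<^bsub>D\<^esub> h g"
    "h \<one>\<^bsub>B\<^esub> = \<one>\<^bsub>D\<^esub>"
    "\<And>a f. f \<in> carrier B \<Longrightarrow> h (a \<odot>\<^bsub>B\<^esub> f) = a \<odot>\<^bsub>D\<^esub> h f"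
    "\<And>f. f \<in> carrier B \<Longrightarrow> h (star B f) = star D (h f)"
    "\<And>f. f \<in> carrier B \<Longrightarrow> nrm D (h f) = nrm B f"
    "bij_betw h (carrier B) (carrier D)"
  shows "h \<in> cstar_iso B D"
  using assms by (auto simp: cstar_iso_def intro: ring_iso_memI)

lemma (in comm_cstar_algebra) cstar_iso_inv:
  assumes h: "h \<in> cstar_iso B D"
  shows "inv_into (carrier B) h \<in> cstar_iso D B"
proof -
  let ?k = "inv_into (carrier B) h"
  note hs = cstar_iso_simps[OF h]
  have k: "?k g \<in> carrier B" "h (?k g) = g" if "g \<in> carrier D" for g
    using that hs(8) by (auto simp: bij_betw_def inv_into_into f_inv_into_f)
  have kh: "?k g = f" if "f \<in> carrier B" "h f = g" for f g
    using that hs(8) by (auto simp: bij_betw_def inv_into_f_f)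
  show ?thesis
  proof (rule cstar_isoI)
    show "bij_betw ?k (carrier D) (carrier B)"
      using hs(8) by (rule bij_betw_inv_into)
    show "?k g \<in> carrier B" "nrm B (?k g) = nrm D g" "?k (star D g) = star B (?k g)"
      "?k (a \<odot>\<^bsub>D\<^esub> g) = a \<odot>\<^bsub>B\<^esub> ?k g" if "g \<in> carrier D" for g a
      using k[OF that] hs(5-7) by (auto intro!: kh star_closed) metis
    show "?k \<one>\<^bsub>D\<^esub> = \<one>\<^bsub>B\<^esub>"
      using hs(4) by (intro kh) auto
    show "?k (f \<oplus>\<^bsub>D\<^esub> g) = ?k f \<oplus>\<^bsub>B\<^esub> ?k g" "?k (f \<otimes>\<^bsub>D\<^esub> g) = ?k f \<otimes>\<^bsub>B\<^esub> ?k g"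
      if "f \<in> carrier D" "g \<in> carrier D" for f g
      using k[OF that(1)] k[OF that(2)] hs(2,3) by (auto intro!: kh)
  qed
qed

lemma cstar_iso_compose:
  assumes h: "h \<in> cstar_iso B D" and k: "k \<in> cstar_iso D E"
  shows "k \<circ> h \<in> cstar_iso B E"
  by (rule cstar_isoI)
    (simp_all add: cstar_iso_simps[OF h] cstar_iso_simps[OF k] bij_betw_trans[OF cstar_iso_simps(8)[OF h] cstar_iso_simps(8)[OF k]])

lemma cstar_cone_iso_trans:
  assumes "cstar_cone_iso P Q h" "cstar_cone_iso Q S k"
  shows "cstar_cone_iso P S (k \<circ> h)"
  using assms by (auto simp: cstar_cone_iso_def cstar_iso_compose image_comp[symmetric] split: prod.splits)

lemma cstar_cone_iso_sym:
  assumes P: "cstar_cone P" and h: "cstar_cone_iso P Q h"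
  shows "\<exists>k. cstar_cone_iso Q P k"
proof -
  obtain B C D E where PQ: "P = (B, C)" "Q = (D, E)"
    by fastforce
  interpret cstar_cone_pair B C
    using P by unfold_locales (simp add: PQ)
  have h: "h \<in> cstar_iso B D" "h ` C = E"
    using h by (auto simp: PQ cstar_cone_iso_def)
  have "inv_into (carrier B) h ` E = C"
    unfolding h(2)[symmetric] using cstar_iso_simps(8)[OF h(1)] cone_carrier
    by (simp add: inv_into_image_cancel bij_betw_imp_inj_on)
  then show ?thesis
    using cstar_iso_inv[OF h(1)] by (auto simp: PQ cstar_cone_iso_def)
qed

lemma ordered_space_iso_sym:
  assumes "ordered_space_iso S T \<phi>"
  shows "\<exists>\<psi>. ordered_space_iso T S \<psi>"
proof -
  obtain X R Y Q where ST: "S = (X, R)" "T = (Y, Q)"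
    by fastforce
  have \<phi>: "homeomorphic_map X Y \<phi>" "\<And>x y. \<lbrakk>x \<in> topspace X; y \<in> topspace X\<rbrakk> \<Longrightarrow> (x, y) \<in> R \<longleftrightarrow> (\<phi> x, \<phi> y) \<in> Q"
    using assms by (auto simp: ST ordered_space_iso_def)
  then obtain \<psi> where \<psi>: "homeomorphic_maps X Y \<phi> \<psi>"
    by (auto simp: homeomorphic_map_maps)
  then have inv: "homeomorphic_map Y X \<psi>" "\<And>y. y \<in> topspace Y \<Longrightarrow> \<phi> (\<psi> y) = y"
    by (auto simp: homeomorphic_maps_map)
  then have "\<psi> y \<in> topspace X" if "y \<in> topspace Y" for y
    using that homeomorphic_imp_surjective_map by blast
  then have "ordered_space_iso T S \<psi>"
    using inv \<phi>(2) by (simp add: ST ordered_space_iso_def)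
  then show ?thesis
    by blast
qed

lemma ordered_space_iso_trans:
  assumes "ordered_space_iso S T \<phi>" "ordered_space_iso T U \<psi>"
  shows "ordered_space_iso S U (\<psi> \<circ> \<phi>)"
proof -
  obtain X R Y Q Z W where eq: "S = (X, R)" "T = (Y, Q)" "U = (Z, W)"
    by (metis surj_pair)
  have h: "homeomorphic_map X Y \<phi>" "homeomorphic_map Y Z \<psi>"
    using assms by (auto simp: eq ordered_space_iso_def)
  then have "\<phi> x \<in> topspace Y" if "x \<in> topspace X" for x
    using that homeomorphic_imp_surjective_map by blast
  then show ?thesis
    using assms homeomorphic_map_compose[OF h] by (simp add: eq ordered_space_iso_def)
qed

definition pullback :: "'b star_algebra \<Rightarrow> ('b \<Rightarrow> 'd) \<Rightarrow> ('d \<Rightarrow> complex) \<Rightarrow> 'b \<Rightarrow> complex" where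
  "pullback B h y = (\<lambda>f\<in>carrier B. y (h f))"

lemma (in comm_cstar_algebra) pullback_in_characters:
  assumes h: "h \<in> cstar_iso B D" and y: "y \<in> characters D"
  shows "pullback B h y \<in> characters B"
proof -
  note hs = cstar_iso_simps[OF h]
  obtain g where "g \<in> carrier D" "y g \<noteq> 0"
    using y by (auto simp: characters_def)
  moreover from this obtain f where "f \<in> carrier B" "g = h f"
    using hs(8) unfolding bij_betw_def by blast
  ultimately have "\<exists>f\<in>carrier B. pullback B h y f \<noteq> 0"
    by (intro bexI[of _ f]) (auto simp: pullback_def)
  then show ?thesis
    using y hs(1-3,5) unfolding characters_def by (auto simp: pullback_def)
qed

lemma (in comm_cstar_algebra) continuous_pullback:
  assumes h: "h \<in> cstar_iso B D" and D: "comm_cstar_algebra D"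
  shows "continuous_map (spectrum_topology D) (spectrum_topology B) (pullback B h)"
  unfolding spectrum_topology_def[of B]
proof (rule continuous_map_into_subtopology)
  have "continuous_map (spectrum_topology D) euclidean (\<lambda>y. pullback B h y f)" if "f \<in> carrier B" for f
    using that comm_cstar_algebra.continuous_spectrum[OF D cstar_iso_simps(1)[OF h that]]
    by (simp add: pullback_def)
  then show "continuous_map (spectrum_topology D) (product_topology (\<lambda>_. euclidean) (carrier B)) (pullback B h)"
    unfolding continuous_map_componentwise by (auto simp: pullback_def)
  show "pullback B h \<in> topspace (spectrum_topology D) \<rightarrow> characters B"
    using pullback_in_characters[OF h] comm_cstar_algebra.topspace_spectrum[OF D] by auto
qed

text \<open>Characters pull back against the direction of \<open>h\<close>, so the map from the
  spectrum of \<open>B\<close> to that of \<open>D\<close> is the pullback along the inverse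
  \<open>k\<close>.\<close>

lemma map_I_iso:
  assumes P: "cstar_cone P" and Q: "cstar_cone Q" and h: "cstar_cone_iso P Q h"
  shows "\<exists>\<phi>. ordered_space_iso (map_I P) (map_I Q) \<phi>"
proof -
  obtain B C D E where PQ: "P = (B, C)" "Q = (D, E)"
    by fastforce
  interpret B: cstar_cone_pair B C
    using P by unfold_locales (simp add: PQ)
  interpret D: cstar_cone_pair D E
    using Q by unfold_locales (simp add: PQ)
  have h: "h \<in> cstar_iso B D" "h ` C = E"
    using h by (auto simp: PQ cstar_cone_iso_def)
  define k where "k = inv_into (carrier B) h"
  have k: "k \<in> cstar_iso D B"
    unfolding k_def by (rule B.cstar_iso_inv[OF h(1)])
  have kh: "k (h f) = f" if "f \<in> carrier B" for f
    using that cstar_iso_simps(8)[OF h(1)] by (simp add: k_def bij_betw_def)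
  have hk: "h (k g) = g" if "g \<in> carrier D" for g
    using that cstar_iso_simps(8)[OF h(1)] by (simp add: k_def bij_betw_def f_inv_into_f)
  have ext: "x \<in> extensional (carrier B)" if "x \<in> characters B" for x
    using that by (simp add: characters_def)
  have ext': "y \<in> extensional (carrier D)" if "y \<in> characters D" for y
    using that by (simp add: characters_def)
  have "homeomorphic_maps (spectrum_topology B) (spectrum_topology D) (pullback D k) (pullback B h)"
    unfolding homeomorphic_maps_def B.topspace_spectrum D.topspace_spectrum
  proof (intro conjI ballI)
    show "continuous_map (spectrum_topology B) (spectrum_topology D) (pullback D k)"
      by (rule D.continuous_pullback[OF k]) unfold_locales
    show "continuous_map (spectrum_topology D) (spectrum_topology B) (pullback B h)"
      by (rule B.continuous_pullback[OF h(1)]) unfold_locales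
    show "pullback B h (pullback D k x) = x" if "x \<in> characters B" for x
      using ext[OF that] cstar_iso_simps(1)[OF h(1)] kh
      by (intro extensionalityI[of _ "carrier B"]) (auto simp: pullback_def)
    show "pullback D k (pullback B h y) = y" if "y \<in> characters D" for y
      using ext'[OF that] cstar_iso_simps(1)[OF k] hk
      by (intro extensionalityI[of _ "carrier D"]) (auto simp: pullback_def)
  qed
  then have "homeomorphic_map (spectrum_topology B) (spectrum_topology D) (pullback D k)"
    by (auto simp: homeomorphic_map_maps)
  moreover have "(x, y) \<in> spectrum_order B C \<longleftrightarrow> (pullback D k x, pullback D k y) \<in> spectrum_order D E"
    if xy: "x \<in> characters B" "y \<in> characters B" for x y
  proof -
    have "pullback D k z (h f) = z f" if "f \<in> C" for z f
      using that B.cone_carrier cstar_iso_simps(1)[OF h(1)] kh by (auto simp: pullback_def)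
    then show ?thesis
      using xy D.pullback_in_characters[OF k] unfolding spectrum_order_def h(2)[symmetric] by simp
  qed
  ultimately show ?thesis
    by (auto simp: PQ map_I_def ordered_space_iso_def B.topspace_spectrum)
qed

definition transport :: "'c topology \<Rightarrow> ('c \<Rightarrow> 'a) \<Rightarrow> ('a \<Rightarrow> complex) \<Rightarrow> 'c \<Rightarrow> complex" where
  "transport Y \<psi> f = (\<lambda>y\<in>topspace Y. f (\<psi> y))"

lemma transport_in:
  assumes X: "compact_ordered X R" and Y: "compact_ordered Y Q"
    and \<psi>: "continuous_map Y X \<psi>" and f: "f \<in> carrier (continuous_functions X)"
  shows "transport Y \<psi> f \<in> carrier (continuous_functions Y)"
proof -
  interpret X: compact_ordered X R by fact
  interpret Y: compact_ordered Y Q by fact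
  have "continuous_map Y euclidean (f \<circ> \<psi>)"
    using continuous_map_compose[OF \<psi> X.continuous_A[OF f]] .
  then show ?thesis
    unfolding transport_def by (intro Y.restrict_in_A) (simp add: o_def)
qed

text \<open>Functions on \<open>X\<close> are carried to \<open>Y\<close> by composition with the
  inverse \<open>\<psi>\<close> of \<open>\<phi>\<close>; the sup norms agree because
  \<open>\<psi>\<close> is onto.\<close>

lemma map_II_iso:
  assumes S: "compact_ordered_space S" and T: "compact_ordered_space T" and \<phi>: "ordered_space_iso S T \<phi>"
  shows "\<exists>h. cstar_cone_iso (map_II S) (map_II T) h"
proof -
  obtain X R Y Q where ST: "S = (X, R)" "T = (Y, Q)"
    by fastforce
  have co: "compact_ordered X R" "compact_ordered Y Q"
    using S T by (simp_all add: ST compact_ordered_def)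
  interpret X: compact_ordered X R by fact
  interpret Y: compact_ordered Y Q by fact
  have \<phi>: "homeomorphic_map X Y \<phi>" "\<And>x y. \<lbrakk>x \<in> topspace X; y \<in> topspace X\<rbrakk> \<Longrightarrow> (x, y) \<in> R \<longleftrightarrow> (\<phi> x, \<phi> y) \<in> Q"
    using \<phi> by (auto simp: ST ordered_space_iso_def)
  then obtain \<psi> where hm: "homeomorphic_maps X Y \<phi> \<psi>"
    by (auto simp: homeomorphic_map_maps)
  then have c: "continuous_map X Y \<phi>" "continuous_map Y X \<psi>"
    and inv: "\<And>x. x \<in> topspace X \<Longrightarrow> \<psi> (\<phi> x) = x" "\<And>y. y \<in> topspace Y \<Longrightarrow> \<phi> (\<psi> y) = y"
    by (auto simp: homeomorphic_maps_def)
  have mem: "\<And>x. x \<in> topspace X \<Longrightarrow> \<phi> x \<in> topspace Y" "\<And>y. y \<in> topspace Y \<Longrightarrow> \<psi> y \<in> topspace X"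
    using c continuous_map_image_subset_topspace by blast+
  have image: "\<psi> ` topspace Y = topspace X"
    using mem inv by force
  let ?h = "transport Y \<psi>" and ?k = "transport X \<phi>"
  note h = transport_in[OF co c(2)] and k = transport_in[OF co(2,1) c(1)]
  have kh: "?k (?h f) = f" if "f \<in> carrier X.A" for f
    using k[OF h[OF that]] that mem inv by (intro X.A_eqI) (auto simp: transport_def)
  have hk: "?h (?k g) = g" if "g \<in> carrier Y.A" for g
    using h[OF k[OF that]] that mem inv by (intro Y.A_eqI) (auto simp: transport_def)
  have "?h \<in> cstar_iso X.A Y.A"
  proof (rule cstar_isoI)
    show "bij_betw ?h (carrier X.A) (carrier Y.A)"
      by (rule bij_betw_byWitness[where f' = ?k]) (use h k kh hk in auto)
    show "nrm Y.A (?h f) = nrm X.A f" if "f \<in> carrier X.A" for f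
    proof -
      have "(\<lambda>y. cmod (?h f y)) ` topspace Y = (\<lambda>x. cmod (f x)) ` topspace X"
        unfolding image[symmetric] by (auto simp: transport_def image_image)
      then show ?thesis
        by (simp add: X.A_simps(8) Y.A_simps(8))
    qed
  qed (use h mem in \<open>auto simp: transport_def X.A_simps(2-7) Y.A_simps(2-7) intro!: restrict_ext\<close>)
  moreover have "?h ` X.K = Y.K"
  proof (intro equalityI subsetI)
    fix g assume "g \<in> ?h ` X.K"
    then obtain f where f: "f \<in> X.K" "g = ?h f"
      by blast
    then have g: "g \<in> carrier Y.A"
      using h by (simp add: X.K_iff)
    have "(\<psi> y, \<psi> z) \<in> R" if "y \<in> topspace Y" "z \<in> topspace Y" "(y, z) \<in> Q" for y z
      using \<phi>(2)[of "\<psi> y" "\<psi> z"] that mem inv by simp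
    then have "(\<lambda>y. Re (g y)) \<in> Y.isotone"
      using Y.continuous_Re_A[OF g] f mem by (auto simp: X.K_iff X.isotone_def Y.isotone_def transport_def)
    then show "g \<in> Y.K"
      using f g mem by (simp add: X.K_iff Y.K_iff transport_def)
  next
    fix g assume g: "g \<in> Y.K"
    then have gA: "g \<in> carrier Y.A"
      by (simp add: Y.K_iff)
    have "(\<lambda>x. Re (?k g x)) \<in> X.isotone"
      using X.continuous_Re_A[OF k[OF gA]] g mem \<phi>(2) by (auto simp: Y.K_iff X.isotone_def Y.isotone_def transport_def)
    then have "?k g \<in> X.K"
      using g mem k[OF gA] by (simp add: X.K_iff Y.K_iff transport_def)
    then show "g \<in> ?h ` X.K"
      using hk[OF gA] by (metis imageI)
  qed
  ultimately show ?thesis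
    by (auto simp: ST map_II_def cstar_cone_iso_def)
qed

section \<open>Isomorphism classes on the two sides\<close>

lemma compact_ordered_space_map_I: "cstar_cone P \<Longrightarrow> compact_ordered_space (map_I P)"
  using cstar_cone_pair.compact_ordered_map_I[of "fst P" "snd P"] by (simp add: cstar_cone_pair_def)

lemma gelfand_cstar_cone_iso: "cstar_cone P \<Longrightarrow> cstar_cone_iso P (map_II (map_I P)) (gelfand_map (fst P))"
  using cstar_cone_pair.gelfand_cone_iso[of "fst P" "snd P"] by (simp add: cstar_cone_pair_def)

lemma cstar_cone_map_II: "compact_ordered_space S \<Longrightarrow> cstar_cone (map_II S)"
  using compact_ordered.cstar_cone_A[of "fst S" "snd S"] by (simp add: compact_ordered_def)

lemma evaluation_ordered_space_iso:
  "compact_ordered_space S \<Longrightarrow> ordered_space_iso S (map_I (map_II S)) (evaluation (fst S))"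
  using compact_ordered.evaluation_iso[of "fst S" "snd S"] by (simp add: compact_ordered_def)

text \<open>For the converse, the induced isomorphism between the function algebras is composed with
  the Gelfand isomorphism of \<open>P\<close> and the inverse of that of \<open>Q\<close>.\<close>

lemma cone_iso_iff_space_iso:
  assumes P: "cstar_cone P" and Q: "cstar_cone Q"
  shows "(\<exists>h. cstar_cone_iso P Q h) \<longleftrightarrow> (\<exists>\<phi>. ordered_space_iso (map_I P) (map_I Q) \<phi>)"
proof
  assume "\<exists>h. cstar_cone_iso P Q h"
  then show "\<exists>\<phi>. ordered_space_iso (map_I P) (map_I Q) \<phi>"
    using map_I_iso[OF P Q] by blast
next
  assume "\<exists>\<phi>. ordered_space_iso (map_I P) (map_I Q) \<phi>"
  then obtain h where h: "cstar_cone_iso (map_II (map_I P)) (map_II (map_I Q)) h"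
    using map_II_iso[OF P[THEN compact_ordered_space_map_I] Q[THEN compact_ordered_space_map_I]] by blast
  obtain k where k: "cstar_cone_iso (map_II (map_I Q)) Q k"
    using cstar_cone_iso_sym[OF Q gelfand_cstar_cone_iso[OF Q]] by blast
  show "\<exists>h. cstar_cone_iso P Q h"
    using cstar_cone_iso_trans[OF gelfand_cstar_cone_iso[OF P] cstar_cone_iso_trans[OF h k]] by blast
qed

text \<open>The mirror image, with the evaluation maps in place of the Gelfand maps.\<close>

lemma space_iso_iff_cone_iso:
  assumes S: "compact_ordered_space S" and T: "compact_ordered_space T"
  shows "(\<exists>\<phi>. ordered_space_iso S T \<phi>) \<longleftrightarrow> (\<exists>h. cstar_cone_iso (map_II S) (map_II T) h)"
proof
  assume "\<exists>\<phi>. ordered_space_iso S T \<phi>"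
  then show "\<exists>h. cstar_cone_iso (map_II S) (map_II T) h"
    using map_II_iso[OF S T] by blast
next
  assume "\<exists>h. cstar_cone_iso (map_II S) (map_II T) h"
  then obtain \<phi> where \<phi>: "ordered_space_iso (map_I (map_II S)) (map_I (map_II T)) \<phi>"
    using map_I_iso[OF S[THEN cstar_cone_map_II] T[THEN cstar_cone_map_II]] by blast
  obtain \<psi> where \<psi>: "ordered_space_iso (map_I (map_II T)) T \<psi>"
    using ordered_space_iso_sym[OF evaluation_ordered_space_iso[OF T]] by blast
  show "\<exists>\<phi>. ordered_space_iso S T \<phi>"
    using ordered_space_iso_trans[OF evaluation_ordered_space_iso[OF S] ordered_space_iso_trans[OF \<phi> \<psi>]] by blast
qed

lemma character_cone_real:
  assumes "cstar_cone (B, C)" "x \<in> characters B" "f \<in> C"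
  shows "x f \<in> \<real>"
proof -
  interpret cstar_cone_pair B C
    using assms(1) by unfold_locales
  show ?thesis
    using character_cone[OF assms(2,3)] by (metis Reals_of_real)
qed

text \<open>The correspondence is one-to-one up to isomorphism, which the last two conjuncts make
  precise; their separate type variables allow objects over different types to be compared.\<close>

theorem theorem2p5:
  shows
    "(\<forall>(B :: 'b star_algebra) C. cstar_cone (B, C) \<longrightarrow>
        compact_ordered_space (map_I (B, C)) \<and>
        (\<forall>x\<in>characters B. \<forall>f\<in>C. x f \<in> \<real>) \<and>
        cstar_cone_iso (B, C) (map_II (map_I (B, C))) (gelfand_map B)) \<and>
     (\<forall>(X :: 'a topology) R. compact_ordered_space (X, R) \<longrightarrow>
        cstar_cone (map_II (X, R)) \<and>
        ordered_space_iso (X, R) (map_I (map_II (X, R))) (evaluation X)) \<and>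
     (\<forall>(P :: 'b star_algebra \<times> 'b set) (Q :: 'd star_algebra \<times> 'd set).
        cstar_cone P \<longrightarrow> cstar_cone Q \<longrightarrow>
        ((\<exists>h. cstar_cone_iso P Q h) \<longleftrightarrow> (\<exists>\<phi>. ordered_space_iso (map_I P) (map_I Q) \<phi>))) \<and>
     (\<forall>(S :: 'a topology \<times> 'a rel) (T :: 'c topology \<times> 'c rel).
        compact_ordered_space S \<longrightarrow> compact_ordered_space T \<longrightarrow>
        ((\<exists>\<phi>. ordered_space_iso S T \<phi>) \<longleftrightarrow> (\<exists>h. cstar_cone_iso (map_II S) (map_II T) h)))"
proof (intro conjI allI impI ballI)
  show "compact_ordered_space (map_I (B, C))" if "cstar_cone (B, C)" for B :: "'b star_algebra" and C
    using that by (rule compact_ordered_space_map_I)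
  show "x f \<in> \<real>" if "cstar_cone (B, C)" "x \<in> characters B" "f \<in> C" for B :: "'b star_algebra" and C x f
    using that by (rule character_cone_real)
  show "cstar_cone_iso (B, C) (map_II (map_I (B, C))) (gelfand_map B)" if "cstar_cone (B, C)"
    for B :: "'b star_algebra" and C
    using gelfand_cstar_cone_iso[OF that] by simp
  show "cstar_cone (map_II (X, R))" if "compact_ordered_space (X, R)" for X :: "'a topology" and R
    using that by (rule cstar_cone_map_II)
  show "ordered_space_iso (X, R) (map_I (map_II (X, R))) (evaluation X)" if "compact_ordered_space (X, R)"
    for X :: "'a topology" and R
    using evaluation_ordered_space_iso[OF that] by simp
qed (fact cone_iso_iff_space_iso space_iso_iff_cone_iso)+

end
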